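(* Let $n-k>0$ be odd, $k>1$. Let $\alpha,\beta\colon S^{n-k}\to\widetilde{V}_k(\mathbb{R}^n)$ be smooth mappings and assume that there exist smooth $a,b\colon\overline{B}^{n-k+1}\to M_k(\mathbb{R}^n)$ such that $a|S^{n-k}=\alpha$, $b|S^{n-k}=\beta$, and $\widetilde{a},\widetilde{b}$ have a finite number of zeros. If $\alpha$ and $\beta$ are homotopic (i.e. $[\alpha]=[\beta]$ in $\pi_{n-k}\widetilde{V}_k(\mathbb{R}^n)$), then $$\Lambda(\alpha)=\Lambda(\beta),$$ where $\Lambda(\alpha)$ is computed using $a$ and $\Lambda(\beta)$ is computed using $b$.
   Context: $S^{n-k}$ and $\overline{B}^{n-k+1}$ are the unit sphere and the closed unit ball (centered at $0$) in $\mathbb{R}^{n-k+1}$. $M_k(\mathbb{R}^n)$ is the space of $k$-tuples of vectors in $\mathbb{R}^n$ (real $n\times k$ matrices), and $\widetilde{V}_k(\mathbb{R}^n)\subset M_k(\mathbb{R}^n)$ is the set of all $k$-frames (linearly independent $k$-tuples). For $a=(a_1,\ldots,a_k)\colon\overline{B}^{n-k+1}\to M_k(\mathbb{R}^n)$ define $\widetilde{a}\colon S^{k-1}\times\overline{B}^{n-k+1}\to\mathbb{R}^n$ by $\widetilde{a}(\gamma,x)=\gamma_1a_1(x)+\ldots+\gamma_ka_k(x)$. Then $\widetilde{a}(-\gamma,x)=-\widetilde{a}(\gamma,x)$. If $a$ is smooth, $a|S^{n-k}=\alpha$ takes values in $\widetilde{V}_k(\mathbb{R}^n)$ and $\widetilde{a}^{-1}(0)$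 is finite, then $\Lambda(\alpha)$ (computed using $a$) is $$\Lambda(\alpha)=\sum_{(\gamma,x)}\deg_{(\gamma,x)}\widetilde{a}\mod 2,$$ where the sum is over half of the zeros of $\widetilde{a}$: exactly one point is chosen from each pair $(\gamma,x),(-\gamma,x)\in\widetilde{a}^{-1}(0)$. Here $\deg_p$ denotes the local topological degree at an isolated zero $p$: for a compact $n$-dimensional neighbourhood $N$ of $p$ with boundary, containing no other zeros and none on $\partial N$, $\deg_p f$ is the topological degree of $\partial N\ni x\mapsto f(x)/|f(x)|\in S^{n-1}$. *)

theory Defs
  imports "HOL-Analysis.Analysis" "HOL-Homology.Homology"
begin

text \<open>A \<open>k\<close>-tuple of vectors in \<open>\<real>\<^sup>n\<close> is an element \<open>A\<close> of \<open>(real^'n)^'k\<close> with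
  \<open>k = CARD('k)\<close> and \<open>n = CARD('n)\<close>; its \<open>i\<close>-th vector is \<open>A $ i\<close>.\<close>

definition frames :: "((real^'n)^'k) set" where
  "frames = {A. inj (($) A) \<and> independent (range (($) A))}"

text \<open>\<open>C_times_on r f U\<close> is meant for open \<open>U\<close>. On an arbitrary set, smooth means that near every
  point the map is the restriction of a smooth map on an open subset of the ambient space.\<close>

primrec C_times_on ::
  "nat \<Rightarrow> ('a::euclidean_space \<Rightarrow> 'b::real_normed_vector) \<Rightarrow> 'a set \<Rightarrow> bool" where
  "C_times_on 0 f U \<longleftrightarrow> continuous_on U f"
| "C_times_on (Suc r) f U \<longleftrightarrow>
     f differentiable_on U \<and> (\<forall>v\<in>Basis. C_times_on r (\<lambda>x. frechet_derivative f (at x) v) U)"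

definition smooth_map_on ::
  "'a set \<Rightarrow> ('a::euclidean_space \<Rightarrow> 'b::real_normed_vector) \<Rightarrow> bool" where
  "smooth_map_on A f \<longleftrightarrow>
     (\<forall>x\<in>A. \<exists>U g. open U \<and> x \<in> U \<and> (\<forall>r. C_times_on r g U) \<and> (\<forall>y\<in>A \<inter> U. g y = f y))"

definition tilde :: "(real^'m \<Rightarrow> (real^'n)^'k) \<Rightarrow> (real^'k) \<times> (real^'m) \<Rightarrow> real^'n" where
  "tilde a = (\<lambda>(\<gamma>, x). \<Sum>i\<in>UNIV. (\<gamma> $ i) *\<^sub>R (a x $ i))"

definition tilde_zeros :: "(real^'m \<Rightarrow> (real^'n)^'k) \<Rightarrow> ((real^'k) \<times> (real^'m)) set" where
  "tilde_zeros a = {p \<in> sphere 0 1 \<times> cball 0 1. tilde a p = 0}"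

text \<open>Brouwer degrees in the library are those of self-maps of \<open>nsphere p\<close>, whose points are
  sequences \<open>nat \<Rightarrow> real\<close>. The coordinates of \<open>real^'n\<close> are numbered \<open>0, \<dots>, CARD('n) - 1\<close> by
  \<open>to_nat_on UNIV\<close>, which fixes the orientation of \<open>real^'n\<close>.\<close>

definition coords :: "real^'n \<Rightarrow> nat \<Rightarrow> real" where
  "coords w = (\<lambda>i. if i < CARD('n) then w $ from_nat_into UNIV i else 0)"

definition rotation_to :: "real^'k \<Rightarrow> real^'k \<Rightarrow> real^'k" where
  "rotation_to \<gamma> = (SOME R. orthogonal_transformation R \<and> det (matrix R) = 1 \<and>
                          R (axis (from_nat_into UNIV 0) 1) = \<gamma>)"

text \<open>A local parametrization of \<open>S\<^sup>k\<^sup>-\<^sup>1 \<times> \<real>\<^sup>m\<close> around \<open>(\<gamma>, x)\<close>, with \<open>(\<gamma>, x)\<close> at the origin. The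
  first \<open>k - 1\<close> coordinates parametrize the hemisphere centred at \<open>\<gamma>\<close>, as the graph
  \<open>u \<mapsto> (\<surd>(1 - |u|\<^sup>2), u)\<close> rotated so that its pole is \<open>\<gamma>\<close>; the remaining \<open>m\<close> are added to \<open>x\<close>. It
  preserves orientation when \<open>S\<^sup>k\<^sup>-\<^sup>1\<close> is oriented as the boundary of the ball (outward normal first)
  and \<open>S\<^sup>k\<^sup>-\<^sup>1 \<times> \<real>\<^sup>m\<close> as a product.\<close>

definition chart :: "(real^'k) \<times> (real^'m) \<Rightarrow> (nat \<Rightarrow> real) \<Rightarrow> (real^'k) \<times> (real^'m)" where
  "chart p y =
     (rotation_to (fst p)
        (\<chi> i. case to_nat_on (UNIV :: 'k set) i of
                0 \<Rightarrow> sqrt (1 - (\<Sum>j<CARD('k) - 1. (y j)\<^sup>2))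
              | Suc j \<Rightarrow> y j),
      snd p + (\<chi> j. y (CARD('k) - 1 + to_nat_on (UNIV :: 'm set) j)))"

definition disc :: "nat \<Rightarrow> real \<Rightarrow> (nat \<Rightarrow> real) set" where
  "disc n \<epsilon> = {y \<in> topspace (Euclidean_space n). (\<Sum>i<n. (y i)\<^sup>2) \<le> \<epsilon>\<^sup>2}"

text \<open>The neighbourhood of the isolated zero \<open>p\<close> is \<open>N = chart p ` disc n \<epsilon>\<close>; its boundary is
  identified with the unit sphere by \<open>y \<mapsto> chart p (\<epsilon> y)\<close>.\<close>

definition isolating_radius ::
  "((real^'k) \<times> (real^'m) \<Rightarrow> real^'n) \<Rightarrow> (real^'k) \<times> (real^'m) \<Rightarrow> real \<Rightarrow> bool" where
  "isolating_radius f p \<epsilon> \<longleftrightarrow> 0 < \<epsilon> \<and> \<epsilon> < 1 \<and>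
     chart p ` disc CARD('n) \<epsilon> \<subseteq> sphere 0 1 \<times> cball 0 1 \<and>
     (\<forall>q \<in> chart p ` disc CARD('n) \<epsilon>. f q = 0 \<longrightarrow> q = p)"

definition local_degree ::
  "((real^'k) \<times> (real^'m) \<Rightarrow> real^'n) \<Rightarrow> (real^'k) \<times> (real^'m) \<Rightarrow> int" where
  "local_degree f p =
     (let \<epsilon> = (SOME \<epsilon>. isolating_radius f p \<epsilon>)
      in Brouwer_degree2 (CARD('n) - 1) (\<lambda>y. coords (sgn (f (chart p (\<lambda>i. \<epsilon> * y i))))))"

definition half_of_zeros ::
  "(real^'m \<Rightarrow> (real^'n)^'k) \<Rightarrow> ((real^'k) \<times> (real^'m)) set \<Rightarrow> bool" where
  "half_of_zeros a P \<longleftrightarrow> P \<subseteq> tilde_zeros a \<and>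
     (\<forall>(\<gamma>, x) \<in> tilde_zeros a. ((\<gamma>, x) \<in> P) \<noteq> ((- \<gamma>, x) \<in> P))"

text \<open>The invariant \<open>\<Lambda>\<close> of \<open>a\<close> restricted to the sphere, computed using \<open>a\<close> and the half \<open>P\<close> of the
  zeros.\<close>

definition Lambda ::
  "(real^'m \<Rightarrow> (real^'n)^'k) \<Rightarrow> ((real^'k) \<times> (real^'m)) set \<Rightarrow> int" where
  "Lambda a P = (\<Sum>p\<in>P. local_degree (tilde a) p) mod 2"

end

theory Submission
  imports Defs
begin

text \<open>Only parities matter. Choose a pole \<open>l\<close> such that \<open>tilde c\<close> has no zero \<open>(\<gamma>, x)\<close> with
  \<open>\<gamma> \<bullet> l = 0\<close>. By homogeneity in \<open>\<gamma>\<close>, the antipodal pairs of zeros are then the zeros of the map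
  \<open>(u, x) \<mapsto> tilde c (l + u, x)\<close> on \<open>l\<^sup>\<bottom> \<times> \<real>\<^sup>m\<close>, a space of dimension \<open>n\<close>; it has a degree at
  infinity, which by additivity has the parity of the sum of the local degrees over any half of the zeros.
  In particular, after a perturbation which makes the zeros finite in number, this parity does not
  depend on \<open>l\<close>. During a homotopy of \<open>c\<close> zeros may cross the hyperplane \<open>l\<^sup>\<bottom>\<close>. To avoid this, replace
  \<open>c\<^sub>0\<close> by a nearby \<open>c\<^sub>1\<close> one column at a time: exchanging the \<open>j\<close>-th column does not alter \<open>tilde c\<close> over
  \<open>\<gamma>\<^sub>j = 0\<close>, where for reasons of dimension there are no zeros after a small perturbation, so the
  degree with pole the \<open>j\<close>-th basis vector is constant during the exchange.\<close>

section \<open>Degrees of maps of the sphere in coordinates\<close>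

text \<open>The homotopy is given on the boundary sphere only. Two maps of the ball that are close
  there may differ arbitrarily inside, so passing from one to the other is never a small
  deformation: smallness protects the boundary, and something else must keep zeros off the equator
  \<open>l^\<bottom>\<close>. The exchange of a single column does this exactly, whatever its size
  inside the ball. Its equator can be cleared beforehand because the part of \<open>S^(k-1)\<close>
  with \<open>\<gamma>_j = 0\<close>, times the ball, has dimension
  \<open>(k - 2) + (n - k + 1) = n - 1\<close>. Between two exchanges the pole must change, and this
  is where the integers are given up. For odd \<open>n - k\<close> the local degrees at
  \<open>(\<gamma>, x)\<close> and \<open>(-\<gamma>, x)\<close> are opposite, and different poles
  select different halves of the zeros. Modulo 2 the half, the signs of scalar factors and the
  orientations of the parametrizations all disappear. Sard's theorem and the dimension argument ask
  for differentiable maps, whence polynomial approximations; the constant by which such a map is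
  shifted off a critical value comes from adding a rank-one matrix.\<close>

definition uncoords :: "(nat \<Rightarrow> real) \<Rightarrow> real^'n" where
  "uncoords y = (\<chi> i. y (to_nat_on UNIV i))"

text \<open>Depends on \<open>h\<close> on the unit sphere only, where it should have no zeros. With
  \<open>coords\<close> and \<open>uncoords\<close> as translation to sequences,
  \<open>local_degree\<close> becomes an instance.\<close>

definition sphere_degree :: "(real^'n \<Rightarrow> real^'n) \<Rightarrow> int" where
  "sphere_degree h = Brouwer_degree2 (CARD('n) - 1) (\<lambda>y. coords (sgn (h (uncoords y))))"

lemma to_nat_on_less: "to_nat_on (UNIV :: 'n::finite set) i < CARD('n)"
  using to_nat_on_finite[of "UNIV :: 'n set"] by (auto simp: bij_betw_def)

lemma to_nat_on_from_nat_into_UNIV: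
  "j < CARD('n) \<Longrightarrow> to_nat_on UNIV (from_nat_into (UNIV :: 'n::finite set) j) = j"
  using to_nat_on_finite[of "UNIV :: 'n set"] by (simp add: bij_betw_def)

lemma from_nat_into_to_nat_on_UNIV:
  "from_nat_into UNIV (to_nat_on UNIV (i :: 'n::finite)) = i"
  by (simp add: countable_finite)

lemma sum_to_nat_on_UNIV:
  "(\<Sum>i\<in>UNIV. F (to_nat_on (UNIV :: 'n::finite set) i)) = (\<Sum>j<CARD('n). F j)"
  using sum.reindex_bij_betw[OF to_nat_on_finite[of "UNIV :: 'n set"]] by simp

lemma uncoords_coords [simp]: "uncoords (coords w) = w"
  by (simp add: uncoords_def coords_def to_nat_on_less from_nat_into_to_nat_on_UNIV vec_eq_iff)

lemma coords_uncoords: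
  assumes "\<And>i. i \<ge> CARD('n) \<Longrightarrow> y i = 0"
  shows "coords (uncoords y :: real^'n) = y"
  using assms by (auto simp: uncoords_def coords_def to_nat_on_from_nat_into_UNIV fun_eq_iff)

lemma norm_uncoords: "(norm (uncoords y :: real^'n))\<^sup>2 = (\<Sum>j<CARD('n). (y j)\<^sup>2)"
proof -
  have "(norm (uncoords y :: real^'n))\<^sup>2 = (\<Sum>i\<in>UNIV. (y (to_nat_on (UNIV::'n set) i))\<^sup>2)"
    unfolding norm_vec_def L2_set_def by (simp add: uncoords_def sum_nonneg)
  then show ?thesis
    using sum_to_nat_on_UNIV[where 'n='n, of "\<lambda>j. (y j)\<^sup>2"] by simp
qed

text \<open>Once \<open>nsphere\<close> is a \<open>top_of_set\<close>, continuity of maps into and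
  out of it turns into \<open>continuous_on\<close> for \<open>coords\<close> and
  \<open>uncoords\<close>. The unit sphere of \<open>real^'n\<close> has index
  \<open>CARD('n) - 1\<close>.\<close>

lemma nsphere_top_of_set:
  "nsphere (CARD('n) - 1) = top_of_set {y. norm (uncoords y :: real^'n) = 1 \<and> (\<forall>i\<ge>CARD('n). y i = 0)}"
proof -
  have *: "{..CARD('n) - 1} = {..<CARD('n)}"
    using zero_less_card_finite[where 'a='n] by (metis Suc_diff_1 lessThan_Suc_atMost)
  have **: "\<And>i. i > CARD('n) - 1 \<longleftrightarrow> i \<ge> CARD('n)"
    using zero_less_card_finite[where 'a='n] by linarith
  have "norm (uncoords y :: real^'n) = 1 \<longleftrightarrow> (\<Sum>j<CARD('n). (y j)\<^sup>2) = 1" for y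
    unfolding norm_uncoords[symmetric, where 'n='n]
    by (metis norm_ge_zero power2_eq_1_iff one_power2 norm_minus_cancel norm_not_less_zero not_one_less_zero less_minus_iff
        neg_less_0_iff_less zero_less_one)
  then show ?thesis
    unfolding nsphere euclidean_product_topology * ** by simp
qed

lemma continuous_on_coords: "continuous_on S (coords :: real^'n \<Rightarrow> nat \<Rightarrow> real)"
proof (rule continuous_on_coordinatewise_then_product)
  fix i show "continuous_on S (\<lambda>w::real^'n. coords w i)"
    by (cases "i < CARD('n)") (auto simp: coords_def intro!: continuous_intros)
qed

lemma continuous_on_uncoords: "continuous_on S (uncoords :: (nat \<Rightarrow> real) \<Rightarrow> real^'n)"
  unfolding uncoords_def
  by (intro continuous_on_vec_lambda)
     (auto intro: continuous_on_subset[OF continuous_on_product_coordinates])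

lemma continuous_map_coords:
  "continuous_map (top_of_set (sphere 0 1)) (nsphere (CARD('n) - 1)) (coords :: real^'n \<Rightarrow> _)"
  unfolding nsphere_top_of_set
  using continuous_on_coords[where 'n='n] by (auto, simp add: coords_def)

lemma continuous_map_uncoords:
  "continuous_map (nsphere (CARD('n) - 1)) (top_of_set (sphere 0 1)) (uncoords :: _ \<Rightarrow> real^'n)"
  unfolding nsphere_top_of_set
  by (auto simp: continuous_on_uncoords)

lemma continuous_map_sgn:
  "continuous_map (top_of_set (- {0})) (top_of_set (sphere 0 1)) (sgn :: real^'n \<Rightarrow> _)"
  by (auto simp: norm_sgn intro!: continuous_intros)

lemma continuous_map_nsphere_of:
  fixes h :: "real^'n \<Rightarrow> real^'n"
  assumes "continuous_on (sphere 0 1) h" "\<And>w. norm w = 1 \<Longrightarrow> h w \<noteq> 0"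
  shows "continuous_map (nsphere (CARD('n) - 1)) (nsphere (CARD('n) - 1))
     (\<lambda>y. coords (sgn (h (uncoords y))))"
proof -
  have "continuous_map (top_of_set (sphere 0 1)) (top_of_set (- {0})) h"
    using assms by auto
  from continuous_map_compose[OF continuous_map_compose[OF continuous_map_uncoords this]
      continuous_map_compose[OF continuous_map_sgn continuous_map_coords]]
  show ?thesis by (simp add: o_def)
qed

lemma sphere_degree_homotopic:
  fixes h h' :: "real^'n \<Rightarrow> real^'n"
  assumes "homotopic_with_canon (\<lambda>_. True) (sphere 0 1) (- {0}) h h'"
  shows "sphere_degree h = sphere_degree h'"
proof -
  have "homotopic_with (\<lambda>_. True) (nsphere (CARD('n) - 1)) (top_of_set (- {0})) (h \<circ> uncoords) (h' \<circ> uncoords)"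
    by (rule homotopic_with_compose_continuous_map_right[OF assms continuous_map_uncoords]) auto
  then have "homotopic_with (\<lambda>_. True) (nsphere (CARD('n) - 1)) (nsphere (CARD('n) - 1))
      ((coords \<circ> sgn) \<circ> (h \<circ> uncoords)) ((coords \<circ> sgn) \<circ> (h' \<circ> uncoords))"
    by (rule homotopic_with_compose_continuous_map_left
        [OF _ continuous_map_compose[OF continuous_map_sgn continuous_map_coords]]) auto
  then show ?thesis
    unfolding sphere_degree_def by (auto simp: o_def dest: Brouwer_degree2_homotopic)
qed

lemma sphere_degree_homotopy:
  fixes H :: "real \<Rightarrow> real^'n \<Rightarrow> real^'n"
  assumes "continuous_on ({0..1} \<times> sphere 0 1) (\<lambda>(s, w). H s w)"
    and "\<And>s w. 0 \<le> s \<Longrightarrow> s \<le> 1 \<Longrightarrow> norm w = 1 \<Longrightarrow> H s w \<noteq> 0"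
  shows "sphere_degree (H 0) = sphere_degree (H 1)"
proof (rule sphere_degree_homotopic)
  show "homotopic_with_canon (\<lambda>_. True) (sphere 0 1) (- {0}) (H 0) (H 1)"
    unfolding homotopic_with_def
    using assms by (intro exI[of _ "\<lambda>(s, w). H s w"]) (auto simp: image_subset_iff)
qed

lemma sphere_degree_cong:
  fixes h h' :: "real^'n \<Rightarrow> real^'n"
  assumes "\<And>w. norm w = 1 \<Longrightarrow> h w = h' w"
  shows "sphere_degree h = sphere_degree h'"
  unfolding sphere_degree_def
  by (rule Brouwer_degree2_eq, subst (asm) nsphere_top_of_set[where 'n='n]) (use assms in auto)

lemma norm_eq_1_imp: "norm w = 1 \<Longrightarrow> w \<noteq> (0 :: 'a::real_normed_vector)"
  by auto

text \<open>The degree normalizes \<open>k w\<close>, the composite \<open>h o k\<close> does not.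
  The segment from \<open>k w\<close> to \<open>sgn (k w)\<close> stays on an open ray and
  \<open>h\<close> has no zeros off the origin, so inserting \<open>sgn\<close> is a homotopy; then
  degrees multiply.\<close>

lemma sphere_degree_compose:
  fixes h k :: "real^'n \<Rightarrow> real^'n"
  assumes h: "continuous_on (- {0}) h" "\<And>w. w \<noteq> 0 \<Longrightarrow> h w \<noteq> 0"
    and k: "continuous_on (sphere 0 1) k" "\<And>w. norm w = 1 \<Longrightarrow> k w \<noteq> 0"
  shows "sphere_degree (h \<circ> k) = sphere_degree h * sphere_degree k"
proof -
  have ne: "(1 - s) *\<^sub>R v + s *\<^sub>R sgn v \<noteq> 0" if "0 \<le> s" "s \<le> 1" "v \<noteq> 0" for s and v :: "real^'n"
  proof -
    have "0 < (1 - s) + s / norm v"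
      using that by (cases "s = 1") (auto intro!: add_pos_nonneg)
    moreover have "(1 - s) *\<^sub>R v + s *\<^sub>R sgn v = ((1 - s) + s / norm v) *\<^sub>R v"
      by (simp add: sgn_vec_def scaleR_left_distrib divide_inverse sgn_div_norm)
    ultimately show ?thesis using that by simp
  qed
  have "sphere_degree (\<lambda>w. h ((1 - 0) *\<^sub>R k w + 0 *\<^sub>R sgn (k w))) =
        sphere_degree (\<lambda>w. h ((1 - 1) *\<^sub>R k w + 1 *\<^sub>R sgn (k w)))"
  proof (rule sphere_degree_homotopy[where H = "\<lambda>s w. h ((1 - s) *\<^sub>R k w + s *\<^sub>R sgn (k w))"])
    have kc: "continuous_on ({0..1} \<times> sphere 0 1) (\<lambda>x::real \<times> (real^'n). k (snd x))"
      by (rule continuous_on_compose2[OF k(1)]) (auto intro: continuous_intros)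
    show "continuous_on ({0..1} \<times> sphere 0 1) (\<lambda>(s, w). h ((1 - s) *\<^sub>R k w + s *\<^sub>R sgn (k w)))"
      unfolding split_def using k(2) ne
      by (intro continuous_on_compose2[OF h(1)] continuous_intros kc) auto
  qed (use k(2) ne h(2) in auto)
  then have "sphere_degree (h \<circ> k) = sphere_degree (\<lambda>w. h (sgn (k w)))"
    by (simp add: o_def)
  also have "\<dots> = Brouwer_degree2 (CARD('n) - 1)
      ((\<lambda>y. coords (sgn (h (uncoords y)))) \<circ> (\<lambda>y. coords (sgn (k (uncoords y)))))"
    by (simp add: sphere_degree_def o_def)
  also have "\<dots> = sphere_degree h * sphere_degree k"
    unfolding sphere_degree_def
    by (rule Brouwer_degree2_compose; rule continuous_map_nsphere_of)
       (use h k in \<open>auto intro: continuous_on_subset simp: norm_eq_1_imp\<close>)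
  finally show ?thesis .
qed

lemma sphere_degree_id: "sphere_degree (\<lambda>w. w) = 1"
proof -
  have "Brouwer_degree2 (CARD('n) - 1) (\<lambda>y. coords (sgn (uncoords y :: real^'n))) = Brouwer_degree2 (CARD('n) - 1) id"
    by (rule Brouwer_degree2_eq, subst (asm) nsphere_top_of_set[where 'n='n])
       (auto simp: sgn_div_norm coords_uncoords)
  then show ?thesis by (simp add: sphere_degree_def)
qed

text \<open>The degrees of \<open>T\<close> and of its inverse have product 1, so both are units of
  the integers.\<close>

lemma odd_sphere_degree_linear:
  fixes T :: "real^'n \<Rightarrow> real^'n"
  assumes "linear T" "inj T"
  shows "odd (sphere_degree T)"
proof -
  obtain T' where T': "linear T'" "\<And>x. T' (T x) = x" "\<And>x. T (T' x) = x"
    using linear_injective_isomorphism[OF assms] by blast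
  have nz: "T w \<noteq> 0" "T' w \<noteq> 0" if "w \<noteq> 0" for w
    using that T' assms(1) by (metis linear_0)+
  have cont: "continuous_on S T" "continuous_on S T'" for S
    using assms(1) T'(1) by (auto intro: linear_continuous_on simp: linear_linear)
  have "sphere_degree (T \<circ> T') = sphere_degree T * sphere_degree T'"
    by (rule sphere_degree_compose) (use nz cont in \<open>auto simp: norm_eq_1_imp\<close>)
  moreover have "T \<circ> T' = (\<lambda>w. w)"
    using T'(3) by (simp add: fun_eq_iff)
  ultimately have "sphere_degree T * sphere_degree T' = 1"
    by (simp add: sphere_degree_id)
  then show ?thesis
    by (metis dvd_mult2 odd_one)
qed

section \<open>Additivity of the degree over isolated zeros\<close>

lemma homologous_rel_set_int_pow:
  assumes "singular_relcycle p X S c"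
  shows "homologous_rel_set p X S c [^]\<^bsub>relative_homology_group (int p) X S\<^esub> (d::int) =
         homologous_rel_set p X S (frag_cmul d c)"
proof -
  have hom: "homologous_rel_set p X S \<in> hom (relcycle_group p X S) (relative_homology_group (int p) X S)"
    using normal.r_coset_hom_Mod[OF normal_subgroup_singular_relboundary_relcycle, of p X S]
    by (simp add: right_coset_singular_relboundary nontrivial_relative_homology_group)
  have c: "Poly_Mapping.keys c \<subseteq> singular_simplex_set p X"
    using assms by (simp add: singular_relcycle singular_chain_def)
  have "c [^]\<^bsub>relcycle_group p X S\<^esub> d = c [^]\<^bsub>chain_group p X\<^esub> d"
    unfolding relcycle_group_def
    by (rule group.int_pow_subgroup_generated) (use assms in \<open>simp_all add: relcycle_group_def[symmetric]\<close>)
  also have "\<dots> = frag_cmul d c"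
    unfolding chain_group_def using c by simp
  finally show ?thesis
    using hom_int_pow[OF hom, of c d] assms by simp
qed

text \<open>The degree is a multiplier on a cyclic homology group. Representing a generator by a
  cycle \<open>s\<close> turns it into a statement about chains, which can be cut into pieces. For
  \<open>p > 0\<close> reduced and ordinary homology coincide, so that classes have cycles as
  representatives.\<close>

lemma nsphere_fundamental_cycle:
  assumes "p > 0"
  obtains s where "singular_relcycle p (nsphere p) {} s"
    and "\<And>f. continuous_map (nsphere p) (nsphere p) f \<Longrightarrow>
            homologous_rel p (nsphere p) {} (chain_map p f s) (frag_cmul (Brouwer_degree2 p f) s)"
    and "\<And>f d. continuous_map (nsphere p) (nsphere p) f \<Longrightarrow>
            homologous_rel p (nsphere p) {} (chain_map p f s) (frag_cmul d s) \<Longrightarrow> Brouwer_degree2 p f = d"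
proof -
  let ?G = "reduced_homology_group (int p) (nsphere p)"
  have G: "?G = homology_group (int p) (nsphere p)"
    using assms by (simp add: un_reduced_homology_group)
  obtain a where a: "a \<in> carrier ?G" and gen: "subgroup_generated ?G {a} = ?G"
    using cyclic_reduced_homology_group_nsphere[of p p] by (auto simp: cyclic_group_def)
  obtain s where s: "singular_relcycle p (nsphere p) {} s" and as: "a = homologous_rel_set p (nsphere p) {} s"
    using a unfolding G carrier_relative_homology_group by auto
  have ind: "hom_induced p (nsphere p) {} (nsphere p) {} f a = homologous_rel_set p (nsphere p) {} (chain_map p f s)"
    if "continuous_map (nsphere p) (nsphere p) f" for f
    unfolding as using that s by (intro hom_induced_chain_map) auto
  have pow: "a [^]\<^bsub>?G\<^esub> d = homologous_rel_set p (nsphere p) {} (frag_cmul d s)" for d :: int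
    unfolding as G using s by (rule homologous_rel_set_int_pow)
  show ?thesis
  proof
    show "singular_relcycle p (nsphere p) {} s" by fact
    show "homologous_rel p (nsphere p) {} (chain_map p f s) (frag_cmul (Brouwer_degree2 p f) s)"
      if f: "continuous_map (nsphere p) (nsphere p) f" for f
      using Brouwer_degree2[OF a, of f] ind[OF f] pow by (simp add: homologous_rel_set_eq)
    show "Brouwer_degree2 p f = d" if f: "continuous_map (nsphere p) (nsphere p) f"
      and h: "homologous_rel p (nsphere p) {} (chain_map p f s) (frag_cmul d s)" for f d
      by (rule Brouwer_degree2_unique_generator[OF f gen])
         (use ind[OF f] pow[of d] h in \<open>simp add: homologous_rel_set_eq\<close>)
  qed
qed

lemma contractible_cycle_bounds:
  assumes "p > 0" "contractible_space X" "singular_relcycle p X {} c"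
  shows "singular_relboundary p X {} c"
proof -
  have "trivial_group (homology_group (int p) X)"
    using trivial_reduced_homology_group_contractible_space[OF assms(2), of "int p"] assms(1)
    by (simp add: un_reduced_homology_group)
  then have "carrier (homology_group (int p) X) = {\<one>\<^bsub>homology_group (int p) X\<^esub>}"
    by (simp add: trivial_group_def)
  moreover have "homologous_rel_set p X {} c \<in> carrier (homology_group (int p) X)"
    using assms(3) by (auto simp: carrier_relative_homology_group)
  ultimately have "homologous_rel_set p X {} c = \<one>\<^bsub>homology_group (int p) X\<^esub>"
    by (metis singletonD)
  then show ?thesis
    by (simp add: homologous_rel_set_eq_relboundary)
qed

lemma homologous_rel_chain_map:
  assumes "homologous_rel p X S a b" "continuous_map X Y g" "g \<in> S \<rightarrow> T"
  shows "homologous_rel p Y T (chain_map p g a) (chain_map p g b)"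
  using singular_relboundary_chain_map[OF _ assms(2,3)] assms(1)
  unfolding homologous_rel_def by (simp flip: chain_map_diff)

lemma homologous_rel_boundaries:
  assumes "singular_chain (Suc p) X (c - c')"
  shows "homologous_rel p X {} (chain_boundary (Suc p) c) (chain_boundary (Suc p) c')"
  using assms unfolding homologous_rel_def singular_boundary
  by (auto simp: chain_boundary_diff)

text \<open>A simplex \<open>f\<close> satisfies \<open>P p f\<close> for at most one
  \<open>p\<close>, so it is counted once: in the summand of that \<open>p\<close>, or in the
  leading term if there is none.\<close>

lemma frag_split:
  assumes "finite Z" "\<And>f p q. f \<in> Poly_Mapping.keys c \<Longrightarrow> p \<in> Z \<Longrightarrow> q \<in> Z \<Longrightarrow> P p f \<Longrightarrow> P q f \<Longrightarrow> p = q"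
  shows "c = frag_extend (\<lambda>f. if \<exists>p\<in>Z. P p f then 0 else frag_of f) c +
             (\<Sum>p\<in>Z. frag_extend (\<lambda>f. if P p f then frag_of f else 0) c)"
proof -
  have "(\<Sum>p\<in>Z. frag_extend (\<lambda>f. if P p f then frag_of f else 0) c)
     = (\<Sum>f\<in>Poly_Mapping.keys c. \<Sum>p\<in>Z. frag_cmul (Poly_Mapping.lookup c f) (if P p f then frag_of f else 0))"
    unfolding frag_extend_def by (rule sum.swap)
  also have "\<dots> = (\<Sum>f\<in>Poly_Mapping.keys c. frag_cmul (Poly_Mapping.lookup c f) (if \<exists>p\<in>Z. P p f then frag_of f else 0))"
  proof (rule sum.cong[OF refl])
    fix f assume f: "f \<in> Poly_Mapping.keys c"
    show "(\<Sum>p\<in>Z. frag_cmul (Poly_Mapping.lookup c f) (if P p f then frag_of f else 0)) =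
        frag_cmul (Poly_Mapping.lookup c f) (if \<exists>p\<in>Z. P p f then frag_of f else 0)"
    proof (cases "\<exists>p\<in>Z. P p f")
      case True
      then obtain p where p: "p \<in> Z" "P p f" by blast
      have "(\<Sum>q\<in>Z. frag_cmul (Poly_Mapping.lookup c f) (if P q f then frag_of f else 0))
          = (\<Sum>q\<in>Z. if q = p then frag_cmul (Poly_Mapping.lookup c f) (frag_of f) else 0)"
        by (rule sum.cong) (use assms(2)[OF f] p in auto)
      then show ?thesis using p assms(1) True by simp
    qed auto
  qed
  finally have "frag_extend (\<lambda>f. if \<exists>p\<in>Z. P p f then 0 else frag_of f) c +
             (\<Sum>p\<in>Z. frag_extend (\<lambda>f. if P p f then frag_of f else 0) c)
      = (\<Sum>f\<in>Poly_Mapping.keys c. frag_cmul (Poly_Mapping.lookup c f) (if \<exists>p\<in>Z. P p f then 0 else frag_of f)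
           + frag_cmul (Poly_Mapping.lookup c f) (if \<exists>p\<in>Z. P p f then frag_of f else 0))"
    by (simp add: frag_extend_def sum.distrib)
  also have "\<dots> = (\<Sum>f\<in>Poly_Mapping.keys c. frag_cmul (Poly_Mapping.lookup c f) (frag_of f))"
    by (rule sum.cong) auto
  also have "\<dots> = c"
    by (rule frag_expansion[of c, symmetric, unfolded frag_extend_def])
  finally show ?thesis by (rule sym)
qed

lemma singular_chain_filter:
  assumes "singular_chain p X c" "\<And>f. f \<in> Poly_Mapping.keys c \<Longrightarrow> P f \<Longrightarrow> f ` standard_simplex p \<subseteq> S"
  shows "singular_chain p (subtopology X S) (frag_extend (\<lambda>f. if P f then frag_of f else 0) c)"
proof (rule singular_chain_extend)
  fix f assume f: "f \<in> Poly_Mapping.keys c"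
  then have "singular_simplex p X f"
    using assms(1) by (auto simp: singular_chain_def)
  then show "singular_chain p (subtopology X S) (if P f then frag_of f else 0)"
    using assms(2)[OF f] by (auto simp: singular_chain_of singular_simplex_subtopology)
qed

lemma homologous_rel_finite_sum:
  assumes "finite I" "\<And>i. i \<in> I \<Longrightarrow> homologous_rel p X S (f i) (g i)"
  shows "homologous_rel p X S (sum f I) (sum g I)"
  using assms by (intro homologous_rel_sum) auto

text \<open>The interpolated radii are positive and at most \<open>r\<close>, so the spheres avoid
  the only possible zero, the centre.\<close>

lemma sphere_degree_shrink:
  fixes g :: "real^'n \<Rightarrow> real^'n"
  assumes "continuous_on (cball p r) g" "\<And>z. z \<in> cball p r \<Longrightarrow> g z = 0 \<Longrightarrow> z = p" "0 < r'" "r' \<le> r"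
  shows "sphere_degree (\<lambda>w. g (p + r' *\<^sub>R w)) = sphere_degree (\<lambda>w. g (p + r *\<^sub>R w))"
proof -
  let ?H = "\<lambda>s w. g (p + ((1 - s) * r' + s * r) *\<^sub>R w)"
  have pos: "0 < (1 - s) * r' + s * r" "(1 - s) * r' + s * r \<le> r" if "0 \<le> s" "s \<le> 1" for s
  proof -
    have "(1 - s) * r' + s * r \<ge> r'"
      using that mult_left_mono[OF assms(4) that(1)] by (simp add: algebra_simps)
    then show "0 < (1 - s) * r' + s * r" using assms(3) by linarith
    show "(1 - s) * r' + s * r \<le> r"
      using that mult_left_mono[OF assms(4), of "1 - s"] by (simp add: algebra_simps)
  qed
  have "sphere_degree (?H 0) = sphere_degree (?H 1)"
  proof (rule sphere_degree_homotopy)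
    show "continuous_on ({0..1} \<times> sphere 0 1) (\<lambda>(s, w). ?H s w)"
      unfolding split_def using pos
      by (intro continuous_on_compose2[OF assms(1)] continuous_intros)
         (auto simp: dist_norm less_imp_le abs_of_pos)
    show "?H s w \<noteq> 0" if "0 \<le> s" "s \<le> 1" "norm w = 1" for s w
    proof
      assume "?H s w = 0"
      then have "p + ((1 - s) * r' + s * r) *\<^sub>R w = p"
        using pos[OF that(1,2)] that(3) by (intro assms(2)) (auto simp: dist_norm)
      then show False using pos[OF that(1,2)] that(3) by auto
    qed
  qed
  then show ?thesis by simp
qed

text \<open>A chain bounding the large sphere is subdivided until each simplex is near a zero or misses all
  of them. The simplices through one zero then form a chain whose boundary is homologous to a small
  sphere around it; the boundary of the remaining ones is mapped to a boundary in \<open>- {0}\<close>.\<close>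

theorem sphere_degree_additive:
  fixes g :: "real^'n \<Rightarrow> real^'n"
  assumes n: "CARD('n) \<ge> 2" and g: "continuous_on UNIV g"
    and Z: "Z = {z. g z = 0}" "finite Z" "Z \<subseteq> ball 0 R"
    and r: "\<And>p. p \<in> Z \<Longrightarrow> 0 < r p \<and> cball p (r p) \<inter> Z = {p}" and "R > 0"
  shows "sphere_degree (\<lambda>w. g (R *\<^sub>R w)) = (\<Sum>p\<in>Z. sphere_degree (\<lambda>w. g (p + r p *\<^sub>R w)))"
proof -
  define N where "N = CARD('n) - 1"
  have "N > 0" using n by (simp add: N_def)
  then obtain s where s: "singular_relcycle N (nsphere N) {} s"
    and deg: "\<And>f. continuous_map (nsphere N) (nsphere N) f \<Longrightarrow>
            homologous_rel N (nsphere N) {} (chain_map N f s) (frag_cmul (Brouwer_degree2 N f) s)"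
    and deg_eq: "\<And>f d. continuous_map (nsphere N) (nsphere N) f \<Longrightarrow>
            homologous_rel N (nsphere N) {} (chain_map N f s) (frag_cmul d s) \<Longrightarrow> Brouwer_degree2 N f = d"
    using nsphere_fundamental_cycle by blast
  have s': "singular_chain N (nsphere N) s"
    using s by (simp add: singular_cycle)
  \<comment> \<open>One radius for all zeros: distinct zeros are more than \<open>\<rho>\<close>
    apart, so the balls of radius \<open>\<rho>/2\<close> are disjoint. For empty \<open>Z\<close>
    any positive value serves.\<close>
  obtain \<rho> where \<rho>: "\<rho> > 0" "\<And>p. p \<in> Z \<Longrightarrow> \<rho> \<le> r p"
  proof (cases "Z = {}")
    case False
    then show ?thesis using that[of "Min (r ` Z)"] r Z(2) by auto
  qed (use that[of 1] in auto)
  have sep: "p = q" if "p \<in> Z" "q \<in> Z" "dist p q \<le> \<rho>" for p q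
    using r[OF that(1)] \<rho>(2)[OF that(1)] that by auto
  \<comment> \<open>A simplex inside a member of this cover that hits a zero must lie in the ball of
    radius \<open>\<rho>/2\<close> around it.\<close>
  define \<C> where "\<C> = insert (- Z) ((\<lambda>p. ball p (\<rho>/2)) ` Z)"
  define \<sigma> where "\<sigma> = (\<lambda>y. R *\<^sub>R (uncoords y :: real^'n))"
  define \<tau> where "\<tau> = (\<lambda>p y. p + (\<rho>/2) *\<^sub>R (uncoords y :: real^'n))"
  have un: "continuous_map (nsphere N) (top_of_set (sphere 0 1)) (uncoords :: _ \<Rightarrow> real^'n)"
    unfolding N_def by (rule continuous_map_uncoords)
  have un': "continuous_map (nsphere N) (top_of_set T) (\<lambda>y. F (uncoords y))"
    if "continuous_on (sphere 0 1) F" "\<And>w. norm w = 1 \<Longrightarrow> F w \<in> T" for F :: "real^'n \<Rightarrow> real^'n" and T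
    using continuous_map_compose[OF un, of "top_of_set T" F] that by (auto simp: o_def)
  have \<sigma>Z: "continuous_map (nsphere N) (top_of_set (- Z)) \<sigma>"
    unfolding \<sigma>_def by (rule un') (use Z(3) \<open>R > 0\<close> in \<open>auto intro!: continuous_intros\<close>)
  have cyc: "singular_relcycle N (top_of_set (- Z)) {} (chain_map N \<sigma> s)"
    by (rule singular_relcycle_chain_map[OF s \<sigma>Z]) auto
  then have "singular_relcycle N (euclidean :: (real^'n) topology) {} (chain_map N \<sigma> s)"
    using singular_cycle_mono[of N euclidean "- Z" _ UNIV] by simp
  moreover have "contractible_space (euclidean :: (real^'n) topology)"
    using contractible_space_top_of_set[of "UNIV :: (real^'n) set"] by simp
  ultimately have "singular_relboundary N (euclidean :: (real^'n) topology) {} (chain_map N \<sigma> s)"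
    using contractible_cycle_bounds[OF \<open>N > 0\<close>] by blast
  then obtain c where c: "singular_chain (Suc N) euclidean c" "chain_boundary (Suc N) c = chain_map N \<sigma> s"
    unfolding singular_boundary by blast
  \<comment> \<open>The boundary of \<open>c\<close> is the large sphere, which misses
    \<open>Z\<close>; so \<open>c\<close> is a cycle modulo \<open>- Z\<close> and can be subdivided
    there. The boundary of the result \<open>c'\<close> is the large sphere only up to a boundary in
    \<open>- Z\<close>.\<close>
  have "singular_relcycle (Suc N) euclidean (- Z) c"
    using c cyc by (simp add: singular_relcycle singular_cycle)
  moreover have "openin euclidean U" if "U \<in> \<C>" for U
    using that Z(2) by (auto simp: \<C>_def finite_imp_closed)
  moreover have "topspace euclidean \<subseteq> \<Union>\<C>"
    using \<rho>(1) by (auto simp: \<C>_def)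
  ultimately obtain c' where c': "singular_relcycle (Suc N) euclidean (- Z) c'"
      "homologous_rel (Suc N) euclidean (- Z) c c'"
    and small: "\<And>f. f \<in> Poly_Mapping.keys c' \<Longrightarrow> \<exists>V\<in>\<C>. f \<in> standard_simplex (Suc N) \<rightarrow> V"
    using small_homologous_rel_relcycle_exists[of \<C> euclidean "Suc N" "- Z" c] by metis
  have c'c: "singular_chain (Suc N) euclidean c'" "singular_chain N (top_of_set (- Z)) (chain_boundary (Suc N) c')"
    using c'(1) by (auto simp: singular_relcycle)
  let ?hit = "\<lambda>p f. p \<in> f ` standard_simplex (Suc N)"
  define c0 where "c0 = frag_extend (\<lambda>f. if \<exists>p\<in>Z. ?hit p f then 0 else frag_of f) c'"
  define cc where "cc = (\<lambda>p. frag_extend (\<lambda>f. if ?hit p f then frag_of f else 0) c')"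
  have near: "f ` standard_simplex (Suc N) \<subseteq> ball p (\<rho>/2)" if fpq: "f \<in> Poly_Mapping.keys c'" "p \<in> Z" "?hit p f" for f p
  proof -
    obtain V where V: "V \<in> \<C>" "f ` standard_simplex (Suc N) \<subseteq> V"
      using small[OF fpq(1)] by (auto simp: Pi_iff image_subset_iff)
    with fpq have "V \<noteq> - Z" by blast
    with V obtain q where q: "q \<in> Z" "V = ball q (\<rho>/2)" by (auto simp: \<C>_def)
    then have "dist q p < \<rho>/2" using V fpq(3) by auto
    then have "q = p" using sep[OF q(1) fpq(2)] \<rho>(1) by simp
    with q V show ?thesis by simp
  qed
  have split: "c' = c0 + (\<Sum>p\<in>Z. cc p)"
    unfolding c0_def cc_def
  proof (rule frag_split[OF Z(2)])
    fix f p q assume f: "f \<in> Poly_Mapping.keys c'" and pq: "p \<in> Z" "q \<in> Z" "?hit p f" "?hit q f"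
    have "dist p q < \<rho>/2" using near[OF f pq(1,3)] pq(4) by auto
    then show "p = q" using sep[OF pq(1,2)] \<rho>(1) by simp
  qed
  have c0: "singular_chain (Suc N) (top_of_set (- Z)) c0"
  proof -
    have "c0 = frag_extend (\<lambda>f. if \<not> (\<exists>p\<in>Z. ?hit p f) then frag_of f else 0) c'"
      unfolding c0_def by (rule arg_cong[where f = "\<lambda>F. frag_extend F c'"]) auto
    then show ?thesis
      by (metis (no_types, lifting) singular_chain_filter[OF c'c(1), of "\<lambda>f. \<not> (\<exists>p\<in>Z. ?hit p f)" "- Z"] ComplI subsetI)
  qed
  have ccb: "singular_chain (Suc N) (top_of_set (ball p (\<rho>/2))) (cc p)" if "p \<in> Z" for p
    unfolding cc_def using near that by (intro singular_chain_filter[OF c'c(1)]) auto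
  have cco: "singular_chain (Suc N) (top_of_set (- {p})) (cc q)" if "p \<in> Z" "q \<in> Z" "p \<noteq> q" for p q
  proof (rule singular_chain_mono[OF ccb[OF that(2)]], rule)
    fix x assume "x \<in> ball q (\<rho>/2)"
    then show "x \<in> - {p}" using sep[OF that(1,2)] that(3) \<rho>(1) by (auto simp: dist_commute)
  qed
  have rest: "singular_chain (Suc N) (top_of_set (- {p})) (c' - cc p)" if "p \<in> Z" for p
  proof -
    have "c' - cc p = c0 + (\<Sum>q\<in>Z - {p}. cc q)"
      using that Z(2) by (subst split) (simp add: sum.remove[of Z p])
    moreover have "singular_chain (Suc N) (top_of_set (- {p})) c0"
      by (rule singular_chain_mono[OF c0]) (use that in auto)
    ultimately show ?thesis
      using cco[OF that] by (auto intro!: singular_chain_add singular_chain_sum)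
  qed
  have loc: "homologous_rel N (top_of_set (- {0})) {} (chain_map N g (chain_boundary (Suc N) (cc p)))
       (chain_map N (g \<circ> \<tau> p) s)" if p: "p \<in> Z" for p
  proof -
    \<comment> \<open>Radial retraction of the complement of \<open>p\<close> into the ball of
      radius \<open>\<rho>/2\<close>, minus \<open>p\<close>. The homologies below live in
      \<open>- {p}\<close>, where \<open>g\<close> may have other zeros; \<open>g o \<kappa>\<close>
      has none there, and it agrees with \<open>g\<close> on the ball that carries
      \<open>cc p\<close>.\<close>
    define \<kappa> where "\<kappa> = (\<lambda>x. p + min 1 (\<rho>/2 / norm (x - p)) *\<^sub>R (x - p))"
    have \<kappa>_id: "\<kappa> x = x" if "x \<in> cball p (\<rho>/2)" for x
      using that by (cases "x = p") (auto simp: \<kappa>_def dist_norm norm_minus_commute min_def field_simps)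
    have \<kappa>_in: "\<kappa> x \<in> cball p (\<rho>/2) - {p}" if "x \<noteq> p" for x
    proof -
      have "norm (x - p) > 0" using that by simp
      then have "min 1 (\<rho>/2 / norm (x - p)) * norm (x - p) \<le> \<rho>/2" "min 1 (\<rho>/2 / norm (x - p)) > 0"
        using \<rho>(1) by (auto simp: min_def field_simps)
      then show ?thesis using that by (auto simp: \<kappa>_def dist_norm)
    qed
    have \<kappa>c: "continuous_on (- {p}) \<kappa>"
      unfolding \<kappa>_def by (intro continuous_intros) auto
    have "g (\<kappa> x) \<noteq> 0" if "x \<noteq> p" for x
    proof
      assume "g (\<kappa> x) = 0"
      then have "\<kappa> x \<in> Z" by (simp add: Z)
      moreover have "dist p (\<kappa> x) \<le> \<rho>" using \<kappa>_in[OF that] \<rho>(1) by auto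
      ultimately show False using sep[OF p] \<kappa>_in[OF that] by auto
    qed
    then have G: "continuous_map (top_of_set (- {p})) (top_of_set (- {0})) (g \<circ> \<kappa>)"
      using continuous_on_compose2[OF g \<kappa>c] by auto
    have "homologous_rel (Suc N) euclidean (- Z) c' c"
      using c'(2) by (simp add: homologous_rel_sym)
    then obtain d e where d: "singular_chain (Suc (Suc N)) euclidean d"
        and e: "singular_chain (Suc N) (top_of_set (- Z)) e"
        and de: "chain_boundary (Suc (Suc N)) d + e = c' - c"
      unfolding homologous_rel_def singular_relboundary by blast
    \<comment> \<open>The boundary of the boundary of \<open>d\<close> vanishes, so the boundaries
      of \<open>c'\<close> and \<open>c\<close> differ by that of \<open>e\<close> alone.\<close>
    have "chain_boundary (Suc N) e = chain_boundary (Suc N) c' - chain_boundary (Suc N) c"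
      using chain_boundary_boundary_alt[OF d] de
      by (metis add_0 chain_boundary_add chain_boundary_diff)
    moreover have "singular_chain (Suc N) (top_of_set (- {p})) e"
      by (rule singular_chain_mono[OF e]) (use p in auto)
    ultimately have h1: "homologous_rel N (top_of_set (- {p})) {} (chain_boundary (Suc N) c') (chain_map N \<sigma> s)"
      unfolding homologous_rel_def singular_boundary c(2)[symmetric] by metis
    have h2: "homologous_rel N (top_of_set (- {p})) {} (chain_boundary (Suc N) c') (chain_boundary (Suc N) (cc p))"
      by (rule homologous_rel_boundaries[OF rest[OF p]])
    have h3: "homologous_rel N (top_of_set (- {p})) {} (chain_map N \<sigma> s) (chain_map N (\<tau> p) s)"
    proof (rule homotopic_imp_homologous_rel_chain_maps[OF _ s])
      \<comment> \<open>Both spheres enclose \<open>p\<close>. If a segment between corresponding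
        points met \<open>p\<close>, norms would give
        \<open>(1 - t) * R + t * (\<rho>/2) = (1 - t) * norm p\<close>, contradicting
        \<open>norm p < R\<close>.\<close>
      have ne: "(1 - t) *\<^sub>R R *\<^sub>R w + t *\<^sub>R (p + (\<rho>/2) *\<^sub>R w) \<noteq> p"
        if "0 \<le> t" "t \<le> 1" "norm w = 1" for t and w :: "real^'n"
      proof
        assume "(1 - t) *\<^sub>R R *\<^sub>R w + t *\<^sub>R (p + (\<rho>/2) *\<^sub>R w) = p"
        then have "((1 - t) * R + t * (\<rho>/2)) *\<^sub>R w = (1 - t) *\<^sub>R p"
          by (simp add: algebra_simps)
        then have "norm (((1 - t) * R + t * (\<rho>/2)) *\<^sub>R w) = norm ((1 - t) *\<^sub>R p)" by simp
        moreover have "(1 - t) * R + t * (\<rho>/2) \<ge> 0"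
          using that \<rho>(1) \<open>R > 0\<close> by simp
        ultimately have eq: "(1 - t) * R + t * (\<rho>/2) = (1 - t) * norm p"
          using that by simp
        have "norm p < R" using p Z(3) by auto
        show False
        proof (cases "t = 1")
          case False
          then have "(1 - t) * norm p < (1 - t) * R" using that \<open>norm p < R\<close> by simp
          moreover have "t * (\<rho>/2) \<ge> 0" using that \<rho>(1) by simp
          ultimately show False using eq by linarith
        qed (use eq \<rho>(1) in simp)
      qed
      have "homotopic_with_canon (\<lambda>_. True) (sphere 0 1) (- {p}) (\<lambda>w. R *\<^sub>R w) (\<lambda>w. p + (\<rho>/2) *\<^sub>R w)"
        unfolding homotopic_with_def
        using ne by (intro exI[of _ "\<lambda>(t, w). (1 - t) *\<^sub>R R *\<^sub>R w + t *\<^sub>R (p + (\<rho>/2) *\<^sub>R w)"])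
           (auto simp: split_def intro!: continuous_intros)
      from homotopic_with_compose_continuous_map_right[OF this un, of "\<lambda>_. True"]
      show "homotopic_with (\<lambda>h. h \<in> {} \<rightarrow> {}) (nsphere N) (top_of_set (- {p})) \<sigma> (\<tau> p)"
        by (simp add: \<sigma>_def \<tau>_def o_def)
    qed
    have "homologous_rel N (top_of_set (- {p})) {} (chain_boundary (Suc N) (cc p)) (chain_map N (\<tau> p) s)"
      by (rule homologous_rel_trans[OF homologous_rel_trans[OF h3 h1] homologous_rel_sym[THEN iffD1, OF h2]])
    from homologous_rel_chain_map[OF this G]
    have "homologous_rel N (top_of_set (- {0})) {} (chain_map N (g \<circ> \<kappa>) (chain_boundary (Suc N) (cc p)))
        (chain_map N (g \<circ> \<kappa>) (chain_map N (\<tau> p) s))" by simp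
    moreover have "chain_map N (g \<circ> \<kappa>) (chain_boundary (Suc N) (cc p)) = chain_map N g (chain_boundary (Suc N) (cc p))"
      by (rule chain_map_eq[OF singular_chain_boundary_alt[OF ccb[OF p]]]) (simp add: \<kappa>_id)
    moreover have "chain_map N (g \<circ> \<kappa>) (chain_map N (\<tau> p) s) = chain_map N (g \<circ> \<tau> p) s"
    proof -
      have "chain_map N (g \<circ> \<kappa> \<circ> \<tau> p) s = chain_map N (g \<circ> \<tau> p) s"
      proof (rule chain_map_eq[OF s'])
        fix y assume "y \<in> topspace (nsphere N)"
        then have "norm (uncoords y :: real^'n) = 1"
          using un by (auto simp: continuous_map_def Pi_iff)
        then have "\<tau> p y \<in> cball p (\<rho>/2)"
          using \<rho>(1) by (simp add: \<tau>_def dist_norm)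
        then show "(g \<circ> \<kappa> \<circ> \<tau> p) y = (g \<circ> \<tau> p) y" by (simp add: \<kappa>_id)
      qed
      then show ?thesis by (simp add: chain_map_compose)
    qed
    ultimately show ?thesis by simp
  qed
  have gZ: "continuous_map (top_of_set (- Z)) (top_of_set (- {0})) g"
    using Z(1) by (auto intro!: continuous_on_subset[OF g])
  have "homologous_rel N (top_of_set (- {0})) {} (chain_map N (g \<circ> \<sigma>) s) (\<Sum>p\<in>Z. chain_map N (g \<circ> \<tau> p) s)"
  proof -
    obtain d e where d: "singular_chain (Suc (Suc N)) euclidean d"
        and e: "singular_chain (Suc N) (top_of_set (- Z)) e"
        and de: "chain_boundary (Suc (Suc N)) d + e = c - c'"
      using c'(2) unfolding homologous_rel_def singular_relboundary by blast
    have be: "chain_boundary (Suc N) e = chain_boundary (Suc N) c - chain_boundary (Suc N) c'"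
      using chain_boundary_boundary_alt[OF d] de
      by (metis add_0 chain_boundary_add chain_boundary_diff)
    have "homologous_rel N (top_of_set (- Z)) {} (chain_map N \<sigma> s) (\<Sum>p\<in>Z. chain_boundary (Suc N) (cc p))"
      unfolding homologous_rel_def singular_boundary
    proof (intro exI conjI)
      \<comment> \<open>\<open>e\<close> accounts for the subdivision and \<open>c0\<close> for the
        simplices without zeros; together they bound the difference between the large sphere and the
        local boundaries, away from \<open>Z\<close>.\<close>
      show "singular_chain (Suc N) (top_of_set (- Z)) (e + c0)"
        by (rule singular_chain_add[OF e c0])
      have "chain_boundary (Suc N) c' = chain_boundary (Suc N) c0 + (\<Sum>p\<in>Z. chain_boundary (Suc N) (cc p))"
        by (subst split) (simp add: chain_boundary_add chain_boundary_sum o_def)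
      then show "chain_boundary (Suc N) (e + c0) = chain_map N \<sigma> s - (\<Sum>p\<in>Z. chain_boundary (Suc N) (cc p))"
        using be c(2) by (simp add: chain_boundary_add)
    qed
    from homologous_rel_chain_map[OF this gZ]
    have "homologous_rel N (top_of_set (- {0})) {} (chain_map N (g \<circ> \<sigma>) s)
        (\<Sum>p\<in>Z. chain_map N g (chain_boundary (Suc N) (cc p)))"
      unfolding chain_map_compose comp_apply using Z(2) by (simp add: chain_map_sum o_def)
    then show ?thesis
      by (rule homologous_rel_trans[OF homologous_rel_finite_sum[OF Z(2) loc], rotated])
  qed
  moreover have nrm: "continuous_map (top_of_set (- {0})) (nsphere N) (coords \<circ> (sgn :: real^'n \<Rightarrow> _))"
    unfolding N_def by (rule continuous_map_compose[OF continuous_map_sgn continuous_map_coords])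
  ultimately have "homologous_rel N (nsphere N) {} (chain_map N (coords \<circ> sgn) (chain_map N (g \<circ> \<sigma>) s))
      (chain_map N (coords \<circ> sgn) (\<Sum>p\<in>Z. chain_map N (g \<circ> \<tau> p) s))"
    by (rule homologous_rel_chain_map) auto
  then have A: "homologous_rel N (nsphere N) {} (chain_map N ((coords \<circ> sgn) \<circ> (g \<circ> \<sigma>)) s)
      (\<Sum>p\<in>Z. chain_map N ((coords \<circ> sgn) \<circ> (g \<circ> \<tau> p)) s)"
    unfolding chain_map_compose comp_apply using Z(2) by (simp add: chain_map_sum o_def)
  have \<tau>c: "continuous_map (nsphere N) (nsphere N) ((coords \<circ> sgn) \<circ> (g \<circ> \<tau> p))" if p: "p \<in> Z" for p
  proof (rule continuous_map_compose[OF continuous_map_compose[OF _ gZ] nrm])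
    show "continuous_map (nsphere N) (top_of_set (- Z)) (\<tau> p)"
      unfolding \<tau>_def
    proof (rule un')
      fix w :: "real^'n" assume "norm w = 1"
      then have "dist p (p + (\<rho>/2) *\<^sub>R w) \<le> \<rho>" "p + (\<rho>/2) *\<^sub>R w \<noteq> p" using \<rho>(1) by (auto simp: dist_norm)
      then show "p + (\<rho>/2) *\<^sub>R w \<in> - Z" using sep[OF p] by (metis ComplI)
    qed (auto intro!: continuous_intros)
  qed
  let ?d = "\<lambda>p. Brouwer_degree2 N ((coords \<circ> sgn) \<circ> (g \<circ> \<tau> p))"
  have "homologous_rel N (nsphere N) {} (\<Sum>p\<in>Z. chain_map N ((coords \<circ> sgn) \<circ> (g \<circ> \<tau> p)) s) (\<Sum>p\<in>Z. frag_cmul (?d p) s)"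
    by (rule homologous_rel_finite_sum[OF Z(2)]) (rule deg[OF \<tau>c])
  moreover have "(\<Sum>p\<in>Z. frag_cmul (?d p) s) = frag_cmul (\<Sum>p\<in>Z. ?d p) s"
    using Z(2) by (induction Z rule: finite_induct) (simp_all add: frag_cmul_distrib)
  ultimately have "homologous_rel N (nsphere N) {} (chain_map N ((coords \<circ> sgn) \<circ> (g \<circ> \<sigma>)) s) (frag_cmul (\<Sum>p\<in>Z. ?d p) s)"
    using homologous_rel_trans[OF _ A] by simp
  then have "Brouwer_degree2 N ((coords \<circ> sgn) \<circ> (g \<circ> \<sigma>)) = (\<Sum>p\<in>Z. ?d p)"
    by (intro deg_eq continuous_map_compose[OF continuous_map_compose[OF \<sigma>Z gZ] nrm])
  then have "sphere_degree (\<lambda>w. g (R *\<^sub>R w)) = (\<Sum>p\<in>Z. sphere_degree (\<lambda>w. g (p + (\<rho>/2) *\<^sub>R w)))"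
    by (simp add: sphere_degree_def N_def \<sigma>_def \<tau>_def o_def)
  also have "\<dots> = (\<Sum>p\<in>Z. sphere_degree (\<lambda>w. g (p + r p *\<^sub>R w)))"
  proof (rule sum.cong[OF refl], rule sphere_degree_shrink)
    fix p assume p: "p \<in> Z"
    show "continuous_on (cball p (r p)) g"
      by (rule continuous_on_subset[OF g]) simp
    show "z = p" if "z \<in> cball p (r p)" "g z = 0" for z
    proof -
      have "z \<in> cball p (r p) \<inter> Z" using that Z(1) by blast
      then show ?thesis using r[OF p] by blast
    qed
    show "\<rho>/2 \<le> r p" using \<rho>(1) \<rho>(2)[OF p] by linarith
    show "0 < \<rho>/2" using \<rho>(1) by simp
  qed
  finally show ?thesis .
qed

section \<open>Parity of the degree at an isolated zero\<close>

lemma tilde_scaleR: "tilde c (t *\<^sub>R \<gamma>, x) = t *\<^sub>R tilde c (\<gamma>, x)"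
  by (simp add: tilde_def scaleR_sum_right)

lemma continuous_on_tilde:
  fixes c :: "real^'m \<Rightarrow> (real^'n)^'k"
  assumes "continuous_on S c"
  shows "continuous_on (UNIV \<times> S) (tilde c)"
proof -
  have "continuous_on (UNIV \<times> S) (\<lambda>p :: (real^'k) \<times> (real^'m). c (snd p))"
    by (rule continuous_on_compose2[OF assms]) (auto intro: continuous_intros)
  then show ?thesis
    unfolding tilde_def split_def by (intro continuous_intros)
qed

text \<open>For negative \<open>t\<close> the sign of the degree may change, its parity does
  not.\<close>

lemma sphere_degree_scaleR:
  fixes h :: "real^'n \<Rightarrow> real^'n"
  assumes "continuous_on (sphere 0 1) h" "\<And>w. norm w = 1 \<Longrightarrow> h w \<noteq> 0" "t \<noteq> 0"
  shows "odd (sphere_degree (\<lambda>w. t *\<^sub>R h w)) \<longleftrightarrow> odd (sphere_degree h)"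
proof -
  have lin: "linear (\<lambda>w::real^'n. t *\<^sub>R w)" by (simp add: linear_scale_self)
  have "sphere_degree ((\<lambda>w. t *\<^sub>R w) \<circ> h) = sphere_degree (\<lambda>w::real^'n. t *\<^sub>R w) * sphere_degree h"
    by (rule sphere_degree_compose) (use assms in \<open>auto intro!: continuous_intros\<close>)
  moreover have "odd (sphere_degree (\<lambda>w::real^'n. t *\<^sub>R w))"
    using assms(3) by (intro odd_sphere_degree_linear lin) (simp add: inj_on_def)
  ultimately show ?thesis by (simp add: o_def)
qed

lemma dist_self_add: "dist a (a + b) = norm (b :: 'a::real_normed_vector)"
  by (simp add: dist_norm norm_minus_commute)

lemma norm_fst_snd_le:
  assumes "norm p \<le> r"
  shows "norm (fst p) \<le> r" "norm (snd p) \<le> r"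
  using assms norm_fst_le[of "fst p" "snd p"] norm_snd_le[of "snd p" "fst p"] by auto

text \<open>By homogeneity a zero of \<open>tilde c\<close> is never isolated in the linear space
  around it: with \<open>(\<gamma>\<^sub>0, x\<^sub>0)\<close> all its multiples in the first
  component are zeros. The condition says that there are no others nearby; degrees are then taken on
  \<open>n\<close>-dimensional slices transversal to this line.\<close>

definition isolates :: "(real^'m \<Rightarrow> (real^'n)^'k) \<Rightarrow> real^'k \<Rightarrow> real^'m \<Rightarrow> real \<Rightarrow> bool" where
  "isolates c \<gamma>\<^sub>0 x\<^sub>0 \<rho> \<longleftrightarrow> \<rho> > 0 \<and> cball x\<^sub>0 \<rho> \<subseteq> cball 0 1 \<and>
     (\<forall>\<gamma>\<in>cball \<gamma>\<^sub>0 \<rho>. \<forall>x\<in>cball x\<^sub>0 \<rho>. tilde c (\<gamma>, x) = 0 \<longrightarrow> x = x\<^sub>0 \<and> (\<exists>t. \<gamma> = t *\<^sub>R \<gamma>\<^sub>0))"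

lemma isolates_nbhd:
  assumes "isolates c \<gamma>\<^sub>0 x\<^sub>0 \<rho>" "norm d \<le> \<rho>"
  shows "(\<gamma>\<^sub>0, x\<^sub>0) + d \<in> UNIV \<times> cball 0 1"
    and "tilde c ((\<gamma>\<^sub>0, x\<^sub>0) + d) = 0 \<Longrightarrow> \<exists>t. d = (t *\<^sub>R \<gamma>\<^sub>0, 0)"
proof -
  have d: "\<gamma>\<^sub>0 + fst d \<in> cball \<gamma>\<^sub>0 \<rho>" "x\<^sub>0 + snd d \<in> cball x\<^sub>0 \<rho>"
    using norm_fst_snd_le[OF assms(2)] by (simp_all add: dist_self_add)
  have eq: "(\<gamma>\<^sub>0, x\<^sub>0) + d = (\<gamma>\<^sub>0 + fst d, x\<^sub>0 + snd d)"
    by (simp add: prod_eq_iff)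
  show "(\<gamma>\<^sub>0, x\<^sub>0) + d \<in> UNIV \<times> cball 0 1"
    unfolding eq using d(2) assms(1) unfolding isolates_def by blast
  assume "tilde c ((\<gamma>\<^sub>0, x\<^sub>0) + d) = 0"
  then obtain t where "x\<^sub>0 + snd d = x\<^sub>0" "\<gamma>\<^sub>0 + fst d = t *\<^sub>R \<gamma>\<^sub>0"
    unfolding eq using d assms(1) unfolding isolates_def by blast
  then have "d = ((t - 1) *\<^sub>R \<gamma>\<^sub>0, 0)"
    by (auto simp: prod_eq_iff algebra_simps)
  then show "\<exists>t. d = (t *\<^sub>R \<gamma>\<^sub>0, 0)" ..
qed

text \<open>By convexity the displacements stay in the isolating ball, where \<open>tilde c\<close>
  can vanish only along the line of \<open>\<gamma>\<^sub>0\<close>. Two slices joined by segments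
  that avoid this line therefore have the same degree.\<close>

lemma sphere_degree_straight_line:
  fixes c :: "real^'m \<Rightarrow> (real^'n)^'k" and A B :: "real^'n \<Rightarrow> (real^'k) \<times> (real^'m)"
  assumes c: "continuous_on (cball 0 1) c" and iso: "isolates c \<gamma>\<^sub>0 x\<^sub>0 \<rho>"
    and A: "continuous_on (sphere 0 1) A" "\<And>w. norm w = 1 \<Longrightarrow> norm (A w) \<le> \<rho>"
    and B: "continuous_on (sphere 0 1) B" "\<And>w. norm w = 1 \<Longrightarrow> norm (B w) \<le> \<rho>"
    and ne: "\<And>s w t. 0 \<le> s \<Longrightarrow> s \<le> 1 \<Longrightarrow> norm w = 1 \<Longrightarrow> (1 - s) *\<^sub>R A w + s *\<^sub>R B w \<noteq> (t *\<^sub>R \<gamma>\<^sub>0, 0)"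
  shows "sphere_degree (\<lambda>w. tilde c ((\<gamma>\<^sub>0, x\<^sub>0) + A w)) = sphere_degree (\<lambda>w. tilde c ((\<gamma>\<^sub>0, x\<^sub>0) + B w))"
proof -
  let ?D = "\<lambda>s w. (1 - s) *\<^sub>R A w + s *\<^sub>R B w"
  let ?H = "\<lambda>s w. tilde c ((\<gamma>\<^sub>0, x\<^sub>0) + ?D s w)"
  have D: "norm (?D s w) \<le> \<rho>" if "0 \<le> s" "s \<le> 1" "norm w = 1" for s w
  proof -
    have "norm (?D s w) \<le> (1 - s) * norm (A w) + s * norm (B w)"
      using that by (intro order_trans[OF norm_triangle_ineq]) simp
    also have "\<dots> \<le> (1 - s) * \<rho> + s * \<rho>"
      using that A(2) B(2) by (intro add_mono mult_left_mono) auto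
    finally show ?thesis by (simp add: algebra_simps)
  qed
  have "sphere_degree (?H 0) = sphere_degree (?H 1)"
  proof (rule sphere_degree_homotopy)
    have AB: "continuous_on ({0..1} \<times> sphere 0 1) (\<lambda>x::real \<times> (real^'n). A (snd x))"
       "continuous_on ({0..1} \<times> sphere 0 1) (\<lambda>x::real \<times> (real^'n). B (snd x))"
      by (rule continuous_on_compose2[OF A(1)] continuous_on_compose2[OF B(1)]; auto intro: continuous_intros)+
    show "continuous_on ({0..1} \<times> sphere 0 1) (\<lambda>(s, w). ?H s w)"
      unfolding split_def
    proof (rule continuous_on_compose2[OF continuous_on_tilde[OF c]])
      show "continuous_on ({0..1} \<times> sphere 0 1) (\<lambda>p. (\<gamma>\<^sub>0, x\<^sub>0) + ?D (fst p) (snd p))"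
        by (intro continuous_intros AB)
      show "(\<lambda>p. (\<gamma>\<^sub>0, x\<^sub>0) + ?D (fst p) (snd p)) ` ({0..1} \<times> sphere 0 1) \<subseteq> UNIV \<times> cball 0 1"
      proof (rule image_subsetI)
        fix p :: "real \<times> (real^'n)" assume "p \<in> {0..1} \<times> sphere 0 1"
        then have "norm (?D (fst p) (snd p)) \<le> \<rho>" by (intro D) auto
        then show "(\<gamma>\<^sub>0, x\<^sub>0) + ?D (fst p) (snd p) \<in> UNIV \<times> cball 0 1"
          by (rule isolates_nbhd(1)[OF iso])
      qed
    qed
    show "?H s w \<noteq> 0" if sw: "0 \<le> s" "s \<le> 1" "norm w = 1" for s w
      using isolates_nbhd(2)[OF iso D[OF sw]] ne[OF sw] by blast
  qed
  then show ?thesis by simp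
qed

text \<open>Modulo the line of \<open>\<gamma>\<^sub>0\<close> both \<open>L\<close> and
  \<open>L'\<close> are isomorphisms onto the same \<open>n\<close>-dimensional quotient, so
  \<open>L'\<close> is \<open>L o T\<close> plus a multiple of that direction. Sliding the multiple
  to zero never meets the line, and the change of variables \<open>T\<close> has odd degree.\<close>

lemma local_parity_unique:
  fixes c :: "real^'m \<Rightarrow> (real^'n)^'k" and L L' :: "real^'n \<Rightarrow> (real^'k) \<times> (real^'m)"
  assumes dim: "CARD('n) + 1 = CARD('k) + CARD('m)"
    and c: "continuous_on (cball 0 1) c" and iso: "isolates c \<gamma>\<^sub>0 x\<^sub>0 \<rho>" and "\<gamma>\<^sub>0 \<noteq> 0"
    and L: "linear L" "\<And>w t. L w = (t *\<^sub>R \<gamma>\<^sub>0, 0) \<Longrightarrow> w = 0"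
    and L': "linear L'" "\<And>w t. L' w = (t *\<^sub>R \<gamma>\<^sub>0, 0) \<Longrightarrow> w = 0"
    and \<delta>: "\<delta> > 0" "\<And>w. norm w = 1 \<Longrightarrow> norm (\<delta> *\<^sub>R L w) \<le> \<rho>"
    and \<delta>': "\<delta>' > 0" "\<And>w. norm w = 1 \<Longrightarrow> norm (\<delta>' *\<^sub>R L' w) \<le> \<rho>"
  shows "odd (sphere_degree (\<lambda>w. tilde c ((\<gamma>\<^sub>0, x\<^sub>0) + \<delta> *\<^sub>R L w))) \<longleftrightarrow>
         odd (sphere_degree (\<lambda>w. tilde c ((\<gamma>\<^sub>0, x\<^sub>0) + \<delta>' *\<^sub>R L' w)))"
proof -
  have \<rho>: "\<rho> > 0" using iso by (simp add: isolates_def)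
  \<comment> \<open>The slice \<open>L\<close> completed by the direction of
    \<open>\<gamma>\<^sub>0\<close>: an isomorphism, since \<open>n + 1 = k + m\<close>. Its inverse
    yields the components \<open>T\<close> and \<open>\<theta>\<close> of \<open>L'\<close>.\<close>
  define M :: "(real^'n) \<times> real \<Rightarrow> (real^'k) \<times> (real^'m)" where "M = (\<lambda>p. L (fst p) + snd p *\<^sub>R (\<gamma>\<^sub>0, 0))"
  have linM: "linear M"
    unfolding M_def using L(1) by (intro linearI) (simp_all add: linear_add linear_scale scaleR_add_left scaleR_add_right)
  have "inj M"
  proof (subst linear_injective_0[OF linM], intro allI impI)
    fix p assume "M p = 0"
    then have "L (fst p) = ((- snd p) *\<^sub>R \<gamma>\<^sub>0, 0)" by (auto simp: M_def prod_eq_iff add_eq_0_iff)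
    then have "fst p = 0" by (rule L(2))
    with \<open>M p = 0\<close> \<open>\<gamma>\<^sub>0 \<noteq> 0\<close> show "p = 0"
      using linear_0[OF L(1)] by (auto simp: M_def prod_eq_iff)
  qed
  have "surj M"
  proof -
    have "dim (range M) = dim (UNIV :: ((real^'n) \<times> real) set)"
      by (rule dim_image_eq[OF linM]) (use \<open>inj M\<close> in auto)
    also have "\<dots> = DIM((real^'k) \<times> (real^'m))"
      using dim by (simp add: dim_UNIV)
    finally have "span (range M) = UNIV" by (simp only: dim_eq_full)
    then show ?thesis
      using linear_span_image[OF linM, of UNIV] by simp
  qed
  obtain M' where M': "linear M'" "\<And>y. M (M' y) = y"
    using linear_surjective_right_inverse[OF linM \<open>surj M\<close>] by (metis comp_apply id_apply)
  define T \<theta> where "T = (\<lambda>w. fst (M' (L' w)))" and "\<theta> = (\<lambda>w. snd (M' (L' w)))"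
  have linT: "linear T" and lin\<theta>: "linear \<theta>"
    unfolding T_def \<theta>_def using M'(1) L'(1)
    by (auto intro!: linearI simp: linear_add linear_scale)
  have L'eq: "L' w = L (T w) + \<theta> w *\<^sub>R (\<gamma>\<^sub>0, 0)" for w
    using M'(2)[of "L' w"] by (simp add: M_def T_def \<theta>_def)
  have T0: "w = 0" if "T w = 0" for w
    using L'(2)[of w "\<theta> w"] L'eq[of w] that linear_0[OF L(1)] by simp
  then have "inj T" by (simp add: linear_injective_0[OF linT])
  have cont: "continuous_on S L" "continuous_on S L'" "continuous_on S T" "continuous_on S \<theta>" for S
    using L(1) L'(1) linT lin\<theta> by (auto intro: linear_continuous_on simp: linear_linear)
  obtain K where K: "K > 0" "\<And>w. norm (L (T w)) \<le> K * norm w"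
    using linear_bounded_pos[OF linear_compose[OF linT L(1)]] by (auto simp: o_def)
  \<comment> \<open>Small enough for \<open>\<eta> *\<^sub>R L' w\<close> and
    \<open>\<eta> *\<^sub>R L (T w)\<close> with \<open>norm w = 1\<close> to stay in the isolating
    ball.\<close>
  define \<eta> where "\<eta> = min \<delta>' (\<rho> / K)"
  have \<eta>: "\<eta> > 0" "\<eta> \<le> \<delta>'" "\<eta> * K \<le> \<rho>"
    using \<rho> K(1) \<delta>'(1) by (auto simp: \<eta>_def min_def field_simps)
  have \<eta>T: "norm (\<eta> *\<^sub>R L (T w)) \<le> \<rho>" if "norm w = 1" for w
    using order_trans[OF mult_left_mono[OF K(2)[of w], of \<eta>] _] \<eta> that by simp
  have \<eta>L': "norm (\<eta> *\<^sub>R L' w) \<le> \<rho>" if "norm w = 1" for w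
    using \<delta>'(2)[OF that] \<eta> \<delta>'(1) by (auto intro: order_trans[OF mult_right_mono])
  have "sphere_degree (\<lambda>w. tilde c ((\<gamma>\<^sub>0, x\<^sub>0) + \<delta>' *\<^sub>R L' w)) = sphere_degree (\<lambda>w. tilde c ((\<gamma>\<^sub>0, x\<^sub>0) + \<eta> *\<^sub>R L' w))"
  proof (rule sphere_degree_straight_line[OF c iso])
    fix s t :: real and w :: "real^'n" assume s: "0 \<le> s" "s \<le> 1" and w: "norm w = 1"
    let ?r = "(1 - s) * \<delta>' + s * \<eta>"
    have "?r > 0" using s \<delta>'(1) \<eta>(1) by (cases "s = 1") (auto intro: add_pos_nonneg)
    show "(1 - s) *\<^sub>R \<delta>' *\<^sub>R L' w + s *\<^sub>R \<eta> *\<^sub>R L' w \<noteq> (t *\<^sub>R \<gamma>\<^sub>0, 0)"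
    proof
      assume "(1 - s) *\<^sub>R \<delta>' *\<^sub>R L' w + s *\<^sub>R \<eta> *\<^sub>R L' w = (t *\<^sub>R \<gamma>\<^sub>0, 0)"
      then have "?r *\<^sub>R L' w = (t *\<^sub>R \<gamma>\<^sub>0, 0)" by (simp add: scaleR_add_left)
      then have "(1 / ?r) *\<^sub>R ?r *\<^sub>R L' w = (1 / ?r) *\<^sub>R (t *\<^sub>R \<gamma>\<^sub>0, 0)" by (rule arg_cong)
      then have "L' w = ((t / ?r) *\<^sub>R \<gamma>\<^sub>0, 0)" using \<open>?r > 0\<close> by simp
      then show False using L'(2) w by fastforce
    qed
  qed (use \<delta>' \<eta>L' cont in \<open>auto intro!: continuous_intros\<close>)
  also have "\<dots> = sphere_degree (\<lambda>w. tilde c ((\<gamma>\<^sub>0, x\<^sub>0) + \<eta> *\<^sub>R L (T w)))"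
  proof (rule sphere_degree_straight_line[OF c iso])
    fix s t :: real and w :: "real^'n" assume s: "0 \<le> s" "s \<le> 1" and w: "norm w = 1"
    show "(1 - s) *\<^sub>R \<eta> *\<^sub>R L' w + s *\<^sub>R \<eta> *\<^sub>R L (T w) \<noteq> (t *\<^sub>R \<gamma>\<^sub>0, 0)"
    proof
      assume "(1 - s) *\<^sub>R \<eta> *\<^sub>R L' w + s *\<^sub>R \<eta> *\<^sub>R L (T w) = (t *\<^sub>R \<gamma>\<^sub>0, 0)"
      then have "\<eta> *\<^sub>R L (T w) = ((t - (1 - s) * \<eta> * \<theta> w) *\<^sub>R \<gamma>\<^sub>0, 0)"
        unfolding L'eq by (auto simp: prod_eq_iff algebra_simps)
      then have "(1 / \<eta>) *\<^sub>R \<eta> *\<^sub>R L (T w) = (1 / \<eta>) *\<^sub>R ((t - (1 - s) * \<eta> * \<theta> w) *\<^sub>R \<gamma>\<^sub>0, 0)" by (rule arg_cong)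
      then have "L (T w) = (((t - (1 - s) * \<eta> * \<theta> w) / \<eta>) *\<^sub>R \<gamma>\<^sub>0, 0)" using \<eta>(1) by simp
      then have "T w = 0" by (rule L(2))
      then show False using T0 w by fastforce
    qed
  qed (use \<eta>L' \<eta>T cont in \<open>auto intro!: continuous_intros continuous_on_compose2[OF cont(1) cont(3)]\<close>)
  \<comment> \<open>With \<open>sgn (T w)\<close> the map has the form \<open>h o T\<close> where
    \<open>h\<close> is defined and nonzero off the origin, as \<open>sphere_degree_compose\<close>
    demands.\<close>
  also have "\<dots> = sphere_degree (\<lambda>w. tilde c ((\<gamma>\<^sub>0, x\<^sub>0) + \<delta> *\<^sub>R L (sgn (T w))))"
  proof (rule sphere_degree_straight_line[OF c iso])
    have nT: "T w \<noteq> 0" if "norm w = 1" for w using T0 that by fastforce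
    show "continuous_on (sphere 0 1) (\<lambda>w. \<delta> *\<^sub>R L (sgn (T w)))"
      using nT by (intro continuous_intros continuous_on_compose2[OF cont(1)[of UNIV]] cont) auto
    show "norm (\<delta> *\<^sub>R L (sgn (T w))) \<le> \<rho>" if "norm w = 1" for w
      using nT[OF that] by (intro \<delta>(2)) (simp add: norm_sgn)
    fix s t :: real and w :: "real^'n" assume s: "0 \<le> s" "s \<le> 1" and w: "norm w = 1"
    let ?r = "(1 - s) * \<eta> + s * \<delta> / norm (T w)"
    have "?r > 0" using s \<delta>(1) \<eta>(1) nT[OF w] by (cases "s = 1") (auto intro: add_pos_nonneg)
    show "(1 - s) *\<^sub>R \<eta> *\<^sub>R L (T w) + s *\<^sub>R \<delta> *\<^sub>R L (sgn (T w)) \<noteq> (t *\<^sub>R \<gamma>\<^sub>0, 0)"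
    proof
      assume "(1 - s) *\<^sub>R \<eta> *\<^sub>R L (T w) + s *\<^sub>R \<delta> *\<^sub>R L (sgn (T w)) = (t *\<^sub>R \<gamma>\<^sub>0, 0)"
      then have "?r *\<^sub>R L (T w) = (t *\<^sub>R \<gamma>\<^sub>0, 0)"
        by (simp add: scaleR_add_left sgn_div_norm linear_scale[OF L(1)] divide_inverse mult.assoc)
      then have "(1 / ?r) *\<^sub>R ?r *\<^sub>R L (T w) = (1 / ?r) *\<^sub>R (t *\<^sub>R \<gamma>\<^sub>0, 0)" by (rule arg_cong)
      then have "L (T w) = ((t / ?r) *\<^sub>R \<gamma>\<^sub>0, 0)" using \<open>?r > 0\<close> by simp
      then have "T w = 0" by (rule L(2))
      then show False using nT w by blast
    qed
  qed (use \<eta>T cont in \<open>auto intro!: continuous_intros continuous_on_compose2[OF cont(1) cont(3)]\<close>)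
  also have "\<dots> = sphere_degree (\<lambda>y. tilde c ((\<gamma>\<^sub>0, x\<^sub>0) + \<delta> *\<^sub>R L (sgn y))) * sphere_degree T"
  proof -
    let ?h = "\<lambda>y. tilde c ((\<gamma>\<^sub>0, x\<^sub>0) + \<delta> *\<^sub>R L (sgn y))"
    have in1: "norm (\<delta> *\<^sub>R L (sgn y)) \<le> \<rho>" if "y \<noteq> 0" for y
      using that by (intro \<delta>(2)) (simp add: norm_sgn)
    have "sphere_degree (?h \<circ> T) = sphere_degree ?h * sphere_degree T"
    proof (rule sphere_degree_compose)
      show "continuous_on (- {0}) ?h"
      proof (rule continuous_on_compose2[OF continuous_on_tilde[OF c]])
        show "continuous_on (- {0}) (\<lambda>y. (\<gamma>\<^sub>0, x\<^sub>0) + \<delta> *\<^sub>R L (sgn y))"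
          by (intro continuous_intros continuous_on_compose2[OF cont(1)[of UNIV]]) auto
        show "(\<lambda>y. (\<gamma>\<^sub>0, x\<^sub>0) + \<delta> *\<^sub>R L (sgn y)) ` (- {0}) \<subseteq> UNIV \<times> cball 0 1"
        proof (rule image_subsetI)
          fix y :: "real^'n" assume "y \<in> - {0}"
          then have "y \<noteq> 0" by simp
          then show "(\<gamma>\<^sub>0, x\<^sub>0) + \<delta> *\<^sub>R L (sgn y) \<in> UNIV \<times> cball 0 1"
            by (intro isolates_nbhd(1)[OF iso] in1)
        qed
      qed
      fix y :: "real^'n" assume y: "y \<noteq> 0"
      show "?h y \<noteq> 0"
      proof
        assume "?h y = 0"
        then obtain t where "\<delta> *\<^sub>R L (sgn y) = (t *\<^sub>R \<gamma>\<^sub>0, 0)"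
          using isolates_nbhd(2)[OF iso in1[OF y]] by blast
        then have "(1 / \<delta>) *\<^sub>R \<delta> *\<^sub>R L (sgn y) = (1 / \<delta>) *\<^sub>R (t *\<^sub>R \<gamma>\<^sub>0, 0)" by (rule arg_cong)
        then have "L (sgn y) = ((t / \<delta>) *\<^sub>R \<gamma>\<^sub>0, 0)" using \<delta>(1) by simp
        then have "sgn y = 0" by (rule L(2))
        then show False using y by (simp add: sgn_zero_iff)
      qed
    qed (use cont in \<open>auto dest!: T0\<close>)
    then show ?thesis by (simp add: o_def)
  qed
  also have "sphere_degree (\<lambda>y. tilde c ((\<gamma>\<^sub>0, x\<^sub>0) + \<delta> *\<^sub>R L (sgn y))) = sphere_degree (\<lambda>w. tilde c ((\<gamma>\<^sub>0, x\<^sub>0) + \<delta> *\<^sub>R L w))"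
    by (rule sphere_degree_cong) (simp add: sgn_div_norm)
  finally show ?thesis
    using odd_sphere_degree_linear[OF linT \<open>inj T\<close>] by simp
qed

section \<open>The chart in the definition of the local degree\<close>

lemma rotation_to:
  fixes \<gamma> :: "real^'k"
  assumes "norm \<gamma> = 1" "CARD('k) \<ge> 2"
  shows "orthogonal_transformation (rotation_to \<gamma>)"
    and "rotation_to \<gamma> (axis (from_nat_into UNIV 0) 1) = \<gamma>"
proof -
  obtain R where "orthogonal_transformation R" "det (matrix R) = 1"
      "R (axis (from_nat_into UNIV 0) 1 :: real^'k) = \<gamma>"
    using rotation_exists[of "axis (from_nat_into UNIV 0) 1" \<gamma>] assms by auto
  then have "\<exists>R. orthogonal_transformation R \<and> det (matrix R) = 1 \<and> R (axis (from_nat_into UNIV 0) 1) = \<gamma>"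
    by blast
  from someI_ex[OF this]
  show "orthogonal_transformation (rotation_to \<gamma>)"
    and "rotation_to \<gamma> (axis (from_nat_into UNIV 0) 1) = \<gamma>"
    unfolding rotation_to_def by blast+
qed

text \<open>The derivative of \<open>chart p\<close> at the origin: the polar coordinate
  \<open>sqrt (1 - |u|^2)\<close> is stationary there, hence the 0.\<close>

definition linear_chart :: "(real^'k) \<times> (real^'m) \<Rightarrow> real^'n \<Rightarrow> (real^'k) \<times> (real^'m)" where
  "linear_chart p w =
     (rotation_to (fst p) (\<chi> i. case to_nat_on (UNIV :: 'k set) i of 0 \<Rightarrow> 0 | Suc j \<Rightarrow> coords w j),
      \<chi> j. coords w (CARD('k) - 1 + to_nat_on (UNIV :: 'm set) j))"

lemma coords_add: "coords (v + w) j = coords v j + coords w j"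
  by (simp add: coords_def)

lemma coords_scaleR: "coords (t *\<^sub>R w) j = t * coords w j"
  by (simp add: coords_def)

lemma coords_0 [simp]: "coords 0 j = 0"
  by (simp add: coords_def)

lemma continuous_on_coords_component: "continuous_on S (\<lambda>w::real^'n. coords w j)"
  by (cases "j < CARD('n)") (auto simp: coords_def intro!: continuous_intros)

lemma norm_coords: "(norm w)\<^sup>2 = (\<Sum>j<CARD('n). (coords w j)\<^sup>2)" for w :: "real^'n"
  using norm_uncoords[where 'n='n, of "coords w"] by simp

lemma to_nat_on_eq_0_iff: "to_nat_on (UNIV :: 'k::finite set) i = 0 \<longleftrightarrow> i = from_nat_into UNIV 0"
proof -
  have "(0::nat) < CARD('k)" by simp
  then show ?thesis
    using to_nat_on_from_nat_into_UNIV[where 'n='k] from_nat_into_to_nat_on_UNIV[of i] by metis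
qed

lemma linear_linear_chart:
  fixes p :: "(real^'k) \<times> (real^'m)"
  assumes "norm (fst p) = 1" "CARD('k) \<ge> 2"
  shows "linear (linear_chart p :: real^'n \<Rightarrow> _)"
proof -
  note R = orthogonal_transformation_linear[OF rotation_to(1)[OF assms]]
  have "linear (\<lambda>w::real^'n. (\<chi> i. case to_nat_on (UNIV :: 'k set) i of 0 \<Rightarrow> 0 | Suc j \<Rightarrow> coords w j) :: real^'k)"
    by (rule linearI) (auto simp: vec_eq_iff coords_add coords_scaleR split: nat.split)
  from linear_compose[OF this R]
  have 1: "linear (\<lambda>w::real^'n. rotation_to (fst p) (\<chi> i. case to_nat_on (UNIV :: 'k set) i of 0 \<Rightarrow> 0 | Suc j \<Rightarrow> coords w j))"
    by (simp add: o_def)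
  have 2: "linear (\<lambda>w::real^'n. (\<chi> j. coords w (CARD('k) - 1 + to_nat_on (UNIV :: 'm set) j)) :: real^'m)"
    by (rule linearI) (auto simp: vec_eq_iff coords_add coords_scaleR)
  show ?thesis
    unfolding linear_chart_def[abs_def]
    using linear_add[OF 1] linear_add[OF 2] linear_scale[OF 1] linear_scale[OF 2]
    by (intro linearI) simp_all
qed

text \<open>Before the rotation, which sends the first axis to \<open>fst p\<close>, the vector has
  first coordinate 0, so only zero lies on that axis. The \<open>k - 1\<close> spherical and
  \<open>m\<close> affine coordinates together are all \<open>n\<close> coordinates of
  \<open>w\<close>.\<close>

lemma linear_chart_transversal:
  fixes p :: "(real^'k) \<times> (real^'m)" and w :: "real^'n"
  assumes p: "norm (fst p) = 1" and k: "CARD('k) \<ge> 2" and dim: "CARD('n) + 1 = CARD('k) + CARD('m)"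
    and eq: "linear_chart p w = (t *\<^sub>R fst p, 0)"
  shows "w = 0"
proof -
  let ?e = "axis (from_nat_into UNIV 0) 1 :: real^'k"
  let ?v = "(\<chi> i. case to_nat_on (UNIV :: 'k set) i of 0 \<Rightarrow> 0 | Suc j \<Rightarrow> coords w j) :: real^'k"
  note R = rotation_to[OF p k]
  have "rotation_to (fst p) ?v = t *\<^sub>R rotation_to (fst p) ?e"
    using eq by (simp add: linear_chart_def R(2))
  also have "\<dots> = rotation_to (fst p) (t *\<^sub>R ?e)"
    by (simp add: linear_scale[OF orthogonal_transformation_linear[OF R(1)]])
  finally have v: "?v = t *\<^sub>R ?e"
    using orthogonal_transformation_inj[OF R(1)] by (simp add: inj_eq)
  have 1: "coords w j = 0" if "j < CARD('k) - 1" for j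
  proof -
    let ?i = "from_nat_into UNIV (Suc j) :: 'k"
    have i: "to_nat_on UNIV ?i = Suc j"
      using that by (intro to_nat_on_from_nat_into_UNIV) simp
    then have "?i \<noteq> from_nat_into UNIV 0"
      using to_nat_on_eq_0_iff[of ?i] by simp
    then show ?thesis
      using arg_cong[OF v, of "\<lambda>u. u $ ?i"] i by (simp add: axis_def)
  qed
  have 2: "coords w (CARD('k) - 1 + j) = 0" if "j < CARD('m)" for j
  proof -
    have "(\<chi> j. coords w (CARD('k) - 1 + to_nat_on (UNIV :: 'm set) j)) = (0 :: real^'m)"
      using eq by (simp add: linear_chart_def)
    from arg_cong[OF this, of "\<lambda>u. u $ from_nat_into UNIV j"] show ?thesis
      using to_nat_on_from_nat_into_UNIV[OF that] by simp
  qed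
  have "coords w j = 0" if "j < CARD('n)" for j
  proof (cases "j < CARD('k) - 1")
    case False
    then show ?thesis using 2[of "j - (CARD('k) - 1)"] that dim k by simp
  qed (rule 1)
  then show ?thesis using norm_coords[of w] by simp
qed

text \<open>The chart differs from its linearization exactly, not just to higher order, by a
  multiple of the direction in which \<open>tilde c\<close> is homogeneous. It can thus be
  straightened by a homotopy that avoids the line of \<open>fst p\<close>.\<close>

lemma chart_coords:
  fixes p :: "(real^'k) \<times> (real^'m)" and w :: "real^'n"
  assumes "norm (fst p) = 1" "CARD('k) \<ge> 2"
  shows "chart p (coords w) =
    p + (linear_chart p w + ((sqrt (1 - (\<Sum>j<CARD('k) - 1. (coords w j)\<^sup>2)) - 1) *\<^sub>R fst p, 0))"
proof -
  let ?e = "axis (from_nat_into UNIV 0) 1 :: real^'k"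
  let ?s = "sqrt (1 - (\<Sum>j<CARD('k) - 1. (coords w j)\<^sup>2))"
  let ?v = "(\<chi> i. case to_nat_on (UNIV :: 'k set) i of 0 \<Rightarrow> 0 | Suc j \<Rightarrow> coords w j) :: real^'k"
  note R = rotation_to[OF assms] and lin = orthogonal_transformation_linear[OF rotation_to(1)[OF assms]]
  have "(\<chi> i. case to_nat_on (UNIV :: 'k set) i of 0 \<Rightarrow> ?s | Suc j \<Rightarrow> coords w j) = ?s *\<^sub>R ?e + ?v"
    by (auto simp: vec_eq_iff axis_def to_nat_on_eq_0_iff[symmetric] split: nat.split)
  then have "fst (chart p (coords w)) = ?s *\<^sub>R fst p + rotation_to (fst p) ?v"
    by (simp add: chart_def linear_add[OF lin] linear_scale[OF lin] R(2))
  then show ?thesis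
    by (simp add: prod_eq_iff linear_chart_def chart_def algebra_simps)
qed

lemma norm_fst_chart:
  fixes p :: "(real^'k) \<times> (real^'m)" and w :: "real^'n"
  assumes "norm (fst p) = 1" "CARD('k) \<ge> 2" "CARD('k) \<le> CARD('n) + 1" "norm w \<le> 1"
  shows "norm (fst (chart p (coords w))) = 1"
proof -
  let ?q = "\<Sum>j<CARD('k) - 1. (coords w j)\<^sup>2"
  have "?q \<le> (\<Sum>j<CARD('n). (coords w j)\<^sup>2)"
    using assms(3) by (intro sum_mono2) auto
  also have "\<dots> \<le> 1"
    using assms(4) power_mono[of "norm w" 1 2] by (simp add: norm_coords)
  finally have q: "?q \<le> 1" .
  let ?F = "\<lambda>l. case l of 0 \<Rightarrow> sqrt (1 - ?q) | Suc j \<Rightarrow> coords w j"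
  have "(norm (uncoords ?F :: real^'k))\<^sup>2 = (\<Sum>l<Suc (CARD('k) - 1). (?F l)\<^sup>2)"
    using assms(2) by (simp add: norm_uncoords)
  also have "\<dots> = 1"
    using q by (simp only: sum.lessThan_Suc_shift) simp
  finally have "norm (uncoords ?F :: real^'k) = 1"
    using norm_ge_zero[of "uncoords ?F :: real^'k"] by (simp add: power2_eq_1_iff)
  moreover have "fst (chart p (coords w)) = rotation_to (fst p) (uncoords ?F)"
    by (simp add: chart_def uncoords_def)
  ultimately show ?thesis
    using rotation_to(1)[OF assms(1,2)] by (simp add: orthogonal_transformation)
qed

lemma continuous_on_chart_coords:
  fixes p :: "(real^'k) \<times> (real^'m)"
  assumes "norm (fst p) = 1" "CARD('k) \<ge> 2"
  shows "continuous_on S (\<lambda>w :: real^'n. chart p (coords w))"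
proof -
  have "continuous_on S (linear_chart p :: real^'n \<Rightarrow> _)"
    using linear_linear_chart[OF assms, where 'n='n] by (simp add: linear_continuous_on linear_linear)
  then show ?thesis
    unfolding chart_coords[OF assms]
    by (intro continuous_intros continuous_on_Pair continuous_on_coords_component)
qed

lemma disc_eq:
  assumes \<epsilon>: "\<epsilon> \<ge> 0"
  shows "disc CARD('n) \<epsilon> = coords ` cball (0 :: real^'n) \<epsilon>"
proof (intro equalityI subsetI)
  fix y assume y: "y \<in> disc CARD('n) \<epsilon>"
  then have "coords (uncoords y :: real^'n) = y"
    by (intro coords_uncoords) (auto simp: disc_def topspace_Euclidean_space)
  moreover have "norm (uncoords y :: real^'n) \<le> \<epsilon>"
    using y \<epsilon> by (auto intro!: power2_le_imp_le[OF _ \<epsilon>] simp: norm_uncoords disc_def)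
  ultimately show "y \<in> coords ` cball (0 :: real^'n) \<epsilon>" by (metis image_eqI mem_cball_0)
next
  fix y assume y: "y \<in> coords ` cball (0 :: real^'n) \<epsilon>"
  then obtain w :: "real^'n" where w: "norm w \<le> \<epsilon>" "y = coords w" by auto
  then have "(norm w)\<^sup>2 \<le> \<epsilon>\<^sup>2" by (intro power_mono) auto
  then show "y \<in> disc CARD('n) \<epsilon>"
    using w by (simp add: disc_def topspace_Euclidean_space norm_coords) (simp add: coords_def)
qed

lemma local_degree_sphere_degree:
  fixes f :: "(real^'k) \<times> (real^'m) \<Rightarrow> real^'n"
  shows "local_degree f p = sphere_degree (\<lambda>w. f (chart p (coords ((SOME \<epsilon>. isolating_radius f p \<epsilon>) *\<^sub>R w))))"
proof -
  have *: "coords (\<epsilon> *\<^sub>R uncoords y :: real^'n) = (\<lambda>i. \<epsilon> * y i)" if "y \<in> topspace (nsphere (CARD('n) - 1))" for y \<epsilon>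
  proof -
    have "coords (uncoords y :: real^'n) = y"
      using that unfolding nsphere_top_of_set[where 'n='n] by (intro coords_uncoords) auto
    then show ?thesis by (metis coords_scaleR)
  qed
  show ?thesis
    unfolding local_degree_def Let_def sphere_degree_def
    by (rule Brouwer_degree2_eq) (simp only: *)
qed

text \<open>Any transversal linear slice computes the parity: the chart is deformed into its
  linearization along the line of \<open>\<gamma>\<^sub>0\<close>, and
  \<open>local_parity_unique\<close> compares the linearization with \<open>L\<close>.\<close>

lemma local_degree_parity:
  fixes c :: "real^'m \<Rightarrow> (real^'n)^'k" and L :: "real^'n \<Rightarrow> (real^'k) \<times> (real^'m)"
  assumes dim: "CARD('n) + 1 = CARD('k) + CARD('m)" and k: "CARD('k) \<ge> 2"
    and c: "continuous_on (cball 0 1) c" and iso: "isolates c \<gamma>\<^sub>0 x\<^sub>0 \<rho>" and \<gamma>\<^sub>0: "norm \<gamma>\<^sub>0 = 1"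
    and L: "linear L" "\<And>w t. L w = (t *\<^sub>R \<gamma>\<^sub>0, 0) \<Longrightarrow> w = 0"
    and \<delta>: "\<delta> > 0" "\<And>w. norm w = 1 \<Longrightarrow> norm (\<delta> *\<^sub>R L w) \<le> \<rho>"
  shows "odd (local_degree (tilde c) (\<gamma>\<^sub>0, x\<^sub>0)) \<longleftrightarrow>
         odd (sphere_degree (\<lambda>w. tilde c ((\<gamma>\<^sub>0, x\<^sub>0) + \<delta> *\<^sub>R L w)))"
proof -
  let ?p = "(\<gamma>\<^sub>0, x\<^sub>0)"
  let ?\<psi> = "\<lambda>w :: real^'n. chart ?p (coords w)"
  let ?C = "linear_chart ?p :: real^'n \<Rightarrow> _"
  have p: "norm (fst ?p) = 1" using \<gamma>\<^sub>0 by simp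
  have \<rho>: "\<rho> > 0" using iso by (simp add: isolates_def)
  note lin = linear_linear_chart[OF p k, where 'n='n]
  have trans: "w = 0" if "?C w = (t *\<^sub>R \<gamma>\<^sub>0, 0)" for w t
    using linear_chart_transversal[OF p k dim, of w t] that by simp
  have \<psi>: "\<exists>t. ?\<psi> w = ?p + (?C w + (t *\<^sub>R \<gamma>\<^sub>0, 0))" for w
    using chart_coords[OF p k, of w] by auto
  have \<psi>0: "?\<psi> 0 = ?p"
    using chart_coords[OF p k, of "0::real^'n"] linear_0[OF lin] by simp
  have \<psi>_eq: "w = 0" if "?\<psi> w - ?p = (t *\<^sub>R \<gamma>\<^sub>0, 0)" for w t
  proof -
    obtain t' where "?\<psi> w = ?p + (?C w + (t' *\<^sub>R \<gamma>\<^sub>0, 0))" using \<psi> by blast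
    with that have "?C w = ((t - t') *\<^sub>R \<gamma>\<^sub>0, 0)"
      by (auto simp: prod_eq_iff algebra_simps)
    then show ?thesis by (rule trans)
  qed
  have cont: "continuous_on S ?\<psi>" for S
    by (rule continuous_on_chart_coords[OF p k])
  obtain \<epsilon>\<^sub>1 where \<epsilon>\<^sub>1: "\<epsilon>\<^sub>1 > 0" "\<And>w. norm w \<le> \<epsilon>\<^sub>1 \<Longrightarrow> norm (?\<psi> w - ?p) \<le> \<rho>"
  proof -
    obtain d where d: "d > 0" "\<And>w. norm w < d \<Longrightarrow> dist (?\<psi> w) ?p < \<rho>"
      using cont[of UNIV] \<rho> \<psi>0 unfolding continuous_on_iff by (metis UNIV_I dist_0_norm dist_commute)
    show ?thesis
      by (rule that[of "d/2"]) (use d in \<open>auto simp: dist_norm less_imp_le\<close>)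
  qed
  \<comment> \<open>An isolating radius exists, so the choice made in \<open>local_degree\<close>
    yields one. The bound \<open>1/2\<close> secures the condition
    \<open>\<epsilon> < 1\<close>.\<close>
  have "isolating_radius (tilde c) ?p (min \<epsilon>\<^sub>1 (1/2))"
    unfolding isolating_radius_def
  proof (intro conjI)
    let ?\<epsilon> = "min \<epsilon>\<^sub>1 (1/2)"
    have D: "chart ?p ` disc CARD('n) ?\<epsilon> = ?\<psi> ` cball 0 ?\<epsilon>"
      using \<epsilon>\<^sub>1(1) by (simp add: disc_eq image_image)
    show "chart ?p ` disc CARD('n) ?\<epsilon> \<subseteq> sphere 0 1 \<times> cball 0 1"
      unfolding D
    proof (rule image_subsetI)
      fix w :: "real^'n" assume "w \<in> cball 0 ?\<epsilon>"
      then have w: "norm w \<le> \<epsilon>\<^sub>1" "norm w \<le> 1" by auto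
      have "norm (fst (?\<psi> w)) = 1"
        using dim w by (intro norm_fst_chart[OF p k]) auto
      moreover have "?p + (?\<psi> w - ?p) \<in> UNIV \<times> cball 0 1"
        by (rule isolates_nbhd(1)[OF iso \<epsilon>\<^sub>1(2)[OF w(1)]])
      ultimately show "?\<psi> w \<in> sphere 0 1 \<times> cball 0 1"
        by (simp add: mem_Times_iff)
    qed
    show "\<forall>q\<in>chart ?p ` disc CARD('n) ?\<epsilon>. tilde c q = 0 \<longrightarrow> q = ?p"
      unfolding D
    proof (intro ballI impI)
      fix q assume "q \<in> ?\<psi> ` cball 0 ?\<epsilon>" and 0: "tilde c q = 0"
      then obtain w where w: "norm w \<le> \<epsilon>\<^sub>1" "q = ?\<psi> w" by auto
      have "tilde c (?p + (?\<psi> w - ?p)) = 0" using 0 w(2) by simp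
      then obtain t where "?\<psi> w - ?p = (t *\<^sub>R \<gamma>\<^sub>0, 0)"
        using isolates_nbhd(2)[OF iso \<epsilon>\<^sub>1(2)[OF w(1)]] by blast
      then have "w = 0" by (rule \<psi>_eq)
      then show "q = ?p" using w(2) \<psi>0 by simp
    qed
  qed (use \<epsilon>\<^sub>1 in auto)
  define \<epsilon> where "\<epsilon> = (SOME \<epsilon>. isolating_radius (tilde c) ?p \<epsilon>)"
  have "isolating_radius (tilde c) ?p \<epsilon>"
    unfolding \<epsilon>_def by (rule someI) fact
  then have iso\<epsilon>: "\<epsilon> > 0" "chart ?p ` disc CARD('n) \<epsilon> \<subseteq> sphere 0 1 \<times> cball 0 1"
      "\<forall>q\<in>chart ?p ` disc CARD('n) \<epsilon>. tilde c q = 0 \<longrightarrow> q = ?p"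
    unfolding isolating_radius_def by auto
  have D: "chart ?p ` disc CARD('n) \<epsilon> = ?\<psi> ` cball 0 \<epsilon>"
    using iso\<epsilon>(1) by (simp add: disc_eq image_image)
  have \<epsilon>: "\<epsilon> > 0" "?\<psi> ` cball 0 \<epsilon> \<subseteq> sphere 0 1 \<times> cball 0 1"
      "\<And>q. q \<in> ?\<psi> ` cball 0 \<epsilon> \<Longrightarrow> tilde c q = 0 \<Longrightarrow> q = ?p"
    using iso\<epsilon> unfolding D by blast+
  obtain K where K: "K > 0" "\<And>w. norm (?C w) \<le> K * norm w"
    using linear_bounded_pos[OF lin] by blast
  \<comment> \<open>The chosen \<open>\<epsilon>\<close> is unrelated to \<open>\<rho>\<close>. The
    smaller \<open>\<eta>\<close> keeps both the chart and its linearization in the isolating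
    ball.\<close>
  define \<eta> where "\<eta> = min (min \<epsilon> \<epsilon>\<^sub>1) (\<rho> / K)"
  have \<eta>: "\<eta> > 0" "\<eta> \<le> \<epsilon>" "\<eta> \<le> \<epsilon>\<^sub>1" "\<eta> \<le> \<rho> / K"
    using \<epsilon>(1) \<epsilon>\<^sub>1(1) \<rho> K(1) by (simp_all add: \<eta>_def)
  then have "\<eta> * K \<le> \<rho>" using K(1) by (simp add: pos_le_divide_eq)
  have \<eta>C: "norm (\<eta> *\<^sub>R ?C w) \<le> \<rho>" if "norm w = 1" for w
    using order_trans[OF mult_left_mono[OF K(2)[of w], of \<eta>] _] \<eta>(1) \<open>\<eta> * K \<le> \<rho>\<close> that by simp
  have "local_degree (tilde c) ?p = sphere_degree (\<lambda>w. tilde c (?\<psi> (0 + \<epsilon> *\<^sub>R w)))"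
    unfolding local_degree_sphere_degree \<epsilon>_def[symmetric] by simp
  also have "\<dots> = sphere_degree (\<lambda>w. tilde c (?\<psi> (0 + \<eta> *\<^sub>R w)))"
  proof (rule sphere_degree_shrink[symmetric])
    show "continuous_on (cball 0 \<epsilon>) (\<lambda>w. tilde c (?\<psi> w))"
      by (rule continuous_on_compose2[OF continuous_on_tilde[OF c] cont]) (use \<epsilon>(2) in auto)
    show "w = 0" if "w \<in> cball 0 \<epsilon>" "tilde c (?\<psi> w) = 0" for w
    proof -
      have "?\<psi> w = ?p" using that by (intro \<epsilon>(3)) auto
      then show ?thesis using \<psi>_eq[of w 0] by (simp add: zero_prod_def)
    qed
  qed (use \<eta> in auto)
  also have "\<dots> = sphere_degree (\<lambda>w. tilde c (?p + (?\<psi> (\<eta> *\<^sub>R w) - ?p)))"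
    by simp
  also have "\<dots> = sphere_degree (\<lambda>w. tilde c (?p + \<eta> *\<^sub>R ?C w))"
  proof (rule sphere_degree_straight_line[OF c iso])
    show "norm (?\<psi> (\<eta> *\<^sub>R w) - ?p) \<le> \<rho>" if "norm w = 1" for w
      using \<eta> that by (intro \<epsilon>\<^sub>1(2)) simp
    show "continuous_on (sphere 0 1) (\<lambda>w. ?\<psi> (\<eta> *\<^sub>R w) - ?p)"
      by (intro continuous_intros continuous_on_compose2[OF cont[of UNIV]]) auto
    show "continuous_on (sphere 0 1) (\<lambda>w. \<eta> *\<^sub>R ?C w)"
      using lin by (intro continuous_intros linear_continuous_on) (simp add: linear_linear)
    fix s t :: real and w :: "real^'n" assume s: "0 \<le> s" "s \<le> 1" and w: "norm w = 1"
    obtain t' where t': "?\<psi> (\<eta> *\<^sub>R w) = ?p + (?C (\<eta> *\<^sub>R w) + (t' *\<^sub>R \<gamma>\<^sub>0, 0))" using \<psi> by blast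
    show "(1 - s) *\<^sub>R (?\<psi> (\<eta> *\<^sub>R w) - ?p) + s *\<^sub>R \<eta> *\<^sub>R ?C w \<noteq> (t *\<^sub>R \<gamma>\<^sub>0, 0)"
    proof
      assume "(1 - s) *\<^sub>R (?\<psi> (\<eta> *\<^sub>R w) - ?p) + s *\<^sub>R \<eta> *\<^sub>R ?C w = (t *\<^sub>R \<gamma>\<^sub>0, 0)"
      then have "?C (\<eta> *\<^sub>R w) = ((t - (1 - s) * t') *\<^sub>R \<gamma>\<^sub>0, 0)"
        unfolding t' linear_scale[OF lin] by (auto simp: prod_eq_iff algebra_simps)
      then have "\<eta> *\<^sub>R w = 0" by (rule trans)
      then show False using \<eta>(1) w by auto
    qed
  qed (rule \<eta>C)
  also have "odd \<dots> \<longleftrightarrow> odd (sphere_degree (\<lambda>w. tilde c (?p + \<delta> *\<^sub>R L w)))"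
    by (rule local_parity_unique[OF dim c iso _ lin trans L \<eta>(1) \<eta>C \<delta>]) (use \<gamma>\<^sub>0 in auto)
  finally show ?thesis .
qed

section \<open>The degree in a gnomonic chart\<close>

text \<open>An isometry of \<open>R^n\<close> onto \<open>l^\<bottom> x R^m\<close>, of dimension
  \<open>(k - 1) + m = n\<close>. The choice fixes an arbitrary orientation, to which parities are
  blind.\<close>

definition hyperplane_param :: "real^'k \<Rightarrow> real^'n \<Rightarrow> (real^'k) \<times> (real^'m)" where
  "hyperplane_param l = (SOME J. linear J \<and> (\<forall>z. norm (J z) = norm z) \<and> range J = {p. l \<bullet> fst p = 0})"

lemma hyperplane_param:
  fixes l :: "real^'k"
  assumes "l \<noteq> 0" and dim: "CARD('n) + 1 = CARD('k) + CARD('m)"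
  shows "linear (hyperplane_param l :: real^'n \<Rightarrow> (real^'k) \<times> (real^'m))"
    and "norm (hyperplane_param l z :: (real^'k) \<times> (real^'m)) = norm (z :: real^'n)"
    and "range (hyperplane_param l :: real^'n \<Rightarrow> (real^'k) \<times> (real^'m)) = {p. l \<bullet> fst p = 0}"
proof -
  let ?T = "{p :: (real^'k) \<times> (real^'m). (l, 0) \<bullet> p = 0}"
  have T: "?T = {p. l \<bullet> fst p = 0}" by (auto simp: inner_prod_def)
  have "dim ?T = DIM((real^'k) \<times> (real^'m)) - 1"
    using assms(1) by (intro dim_hyperplane) (simp add: prod_eq_iff)
  also have "\<dots> = dim (UNIV :: (real^'n) set)"
    using dim by (simp add: dim_UNIV)
  finally have "dim (UNIV :: (real^'n) set) = dim ?T" by simp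
  then obtain J :: "real^'n \<Rightarrow> (real^'k) \<times> (real^'m)" where "linear J" "J ` UNIV = ?T" "\<And>x. x \<in> UNIV \<Longrightarrow> norm (J x) = norm x"
    using isometries_subspaces[OF subspace_UNIV subspace_hyperplane, of "(l, 0)"] by metis
  then have "\<exists>J :: real^'n \<Rightarrow> (real^'k) \<times> (real^'m). linear J \<and> (\<forall>z. norm (J z) = norm z) \<and> range J = {p. l \<bullet> fst p = 0}"
    unfolding T by blast
  from someI_ex[OF this] show
    "linear (hyperplane_param l :: real^'n \<Rightarrow> (real^'k) \<times> (real^'m))"
    "norm (hyperplane_param l z :: (real^'k) \<times> (real^'m)) = norm (z :: real^'n)"
    "range (hyperplane_param l :: real^'n \<Rightarrow> (real^'k) \<times> (real^'m)) = {p. l \<bullet> fst p = 0}"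
    unfolding hyperplane_param_def by blast+
qed

definition clamp_ball :: "real^'m \<Rightarrow> real^'m" where
  "clamp_ball x = x /\<^sub>R max 1 (norm x)"

lemma clamp_ball_id: "norm x \<le> 1 \<Longrightarrow> clamp_ball x = x"
  by (simp add: clamp_ball_def max_def)

lemma norm_clamp_ball: "norm (clamp_ball x) \<le> 1" "norm x \<ge> 1 \<Longrightarrow> norm (clamp_ball x) = 1"
  by (auto simp: clamp_ball_def max_def field_simps)

lemma continuous_on_clamp_ball: "continuous_on S clamp_ball"
  unfolding clamp_ball_def by (intro continuous_intros) auto

text \<open>By homogeneity the zeros of \<open>tilde c\<close> with \<open>\<gamma> \<bullet> l \<noteq> 0\<close> are visible on the affine hyperplane
  \<open>l + l\<^sup>\<bottom>\<close>; extending \<open>c\<close> radially makes this a map between Euclidean spaces of equal dimension.\<close>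

definition gnomonic :: "(real^'m \<Rightarrow> (real^'n)^'k) \<Rightarrow> real^'k \<Rightarrow> real^'n \<Rightarrow> real^'n" where
  "gnomonic c l z = (let J = hyperplane_param l :: real^'n \<Rightarrow> (real^'k) \<times> (real^'m)
     in tilde c (l + fst (J z), clamp_ball (snd (J z))))"

text \<open>On the boundary sphere the columns of \<open>c\<close> are linearly independent; inside
  the ball they may become dependent.\<close>

definition admissible :: "(real^'m \<Rightarrow> (real^'n)^'k) \<Rightarrow> bool" where
  "admissible c \<longleftrightarrow> continuous_on (cball 0 1) c \<and>
     (\<forall>x\<in>sphere 0 1. \<forall>\<gamma>. \<gamma> \<noteq> 0 \<longrightarrow> tilde c (\<gamma>, x) \<noteq> 0)"

definition no_zeros_over :: "(real^'m \<Rightarrow> (real^'n)^'k) \<Rightarrow> (real^'k) set \<Rightarrow> bool" where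
  "no_zeros_over c W \<longleftrightarrow> (\<forall>\<gamma>\<in>W. \<forall>x\<in>cball 0 1. \<gamma> \<noteq> 0 \<longrightarrow> tilde c (\<gamma>, x) \<noteq> 0)"

abbreviation hyperplane :: "real^'k \<Rightarrow> (real^'k) set" where
  "hyperplane l \<equiv> {\<gamma>. l \<bullet> \<gamma> = 0}"

text \<open>The degree at infinity, taken on a sphere around all zeros. It is meaningful when the
  zeros are bounded; \<open>gnomonic_degree_radius\<close> then shows that every such radius gives
  the same value.\<close>

definition gnomonic_degree :: "(real^'m \<Rightarrow> (real^'n)^'k) \<Rightarrow> real^'k \<Rightarrow> int" where
  "gnomonic_degree c l = sphere_degree (\<lambda>w. gnomonic c l
     ((SOME R. R > 0 \<and> (\<forall>z. gnomonic c l z = 0 \<longrightarrow> norm z < R)) *\<^sub>R w))"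

lemma continuous_on_gnomonic:
  fixes C :: "real \<Rightarrow> real^'m \<Rightarrow> (real^'n)^'k"
  assumes l: "l \<noteq> 0" and dim: "CARD('n) + 1 = CARD('k) + CARD('m)"
    and C: "continuous_on ({0..1} \<times> cball 0 1) (\<lambda>(s, x). C s x)"
  shows "continuous_on ({0..1} \<times> UNIV) (\<lambda>(s, z). gnomonic (C s) l z)"
proof -
  let ?J = "hyperplane_param l :: real^'n \<Rightarrow> (real^'k) \<times> (real^'m)"
  have J: "continuous_on UNIV ?J"
    using hyperplane_param(1)[OF l dim] by (simp add: linear_continuous_on linear_linear)
  have J': "continuous_on S (\<lambda>p :: real \<times> (real^'n). ?J (snd p))" for S
    by (rule continuous_on_compose2[OF J]) (auto intro: continuous_intros)
  have "continuous_on ({0..1} \<times> UNIV) (\<lambda>p :: real \<times> (real^'n). (fst p, clamp_ball (snd (?J (snd p)))))"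
    by (intro continuous_intros continuous_on_compose2[OF continuous_on_clamp_ball[of UNIV]] J') auto
  then have "continuous_on ({0..1} \<times> UNIV) (\<lambda>p :: real \<times> (real^'n). (\<lambda>(s, x). C s x) (fst p, clamp_ball (snd (?J (snd p)))))"
    by (rule continuous_on_compose2[OF C]) (use norm_clamp_ball(1) in auto)
  then have "continuous_on ({0..1} \<times> UNIV) (\<lambda>p :: real \<times> (real^'n). C (fst p) (clamp_ball (snd (?J (snd p)))))"
    by simp
  then show ?thesis
    unfolding gnomonic_def Let_def tilde_def split_def fst_conv snd_conv
    by (intro continuous_intros J')
qed

text \<open>Outside the open ball \<open>clamp_ball x\<close> is on the boundary sphere, where
  \<open>c\<close> is nonvanishing, so the radial extension creates no zeros. The vector
  \<open>l + u\<close> is nonzero because its component along \<open>l\<close> is fixed.\<close>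

lemma gnomonic_zero:
  fixes c :: "real^'m \<Rightarrow> (real^'n)^'k"
  assumes l: "l \<noteq> 0" and dim: "CARD('n) + 1 = CARD('k) + CARD('m)" and adm: "admissible c"
    and 0: "gnomonic c l z = 0" and J: "hyperplane_param l z = (u, x :: real^'m)"
  shows "l \<bullet> (l + u) = l \<bullet> l" "l + u \<noteq> 0" "norm x < 1" "tilde c (l + u, x) = 0"
proof -
  have "(u, x) \<in> {p. l \<bullet> fst p = 0}"
    using hyperplane_param(3)[OF l dim] J by (metis rangeI)
  then show lu: "l \<bullet> (l + u) = l \<bullet> l" by (simp add: inner_add_right)
  then show ne: "l + u \<noteq> 0" using l by (metis inner_eq_zero_iff inner_zero_right)
  have t: "tilde c (l + u, clamp_ball x) = 0"
    using 0 J by (simp add: gnomonic_def)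
  show x: "norm x < 1"
  proof (rule ccontr)
    assume "\<not> norm x < 1"
    then have "clamp_ball x \<in> sphere 0 1" using norm_clamp_ball(2)[of x] by simp
    then show False using adm ne t unfolding admissible_def by blast
  qed
  then show "tilde c (l + u, x) = 0" using t clamp_ball_id[of x] by simp
qed

text \<open>A zero can run off to infinity in the chart only if its direction tends to the equator
  \<open>l^\<bottom>\<close>. On the compact set \<open>K\<close> of unit zeros of the whole family
  \<open>|l \<bullet> \<gamma>|\<close> has a positive lower bound, which bounds the zeros uniformly
  in \<open>s\<close>.\<close>

lemma gnomonic_zeros_bounded:
  fixes C :: "real \<Rightarrow> real^'m \<Rightarrow> (real^'n)^'k"
  assumes l: "l \<noteq> 0" and dim: "CARD('n) + 1 = CARD('k) + CARD('m)"
    and C: "continuous_on ({0..1} \<times> cball 0 1) (\<lambda>(s, x). C s x)"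
    and adm: "\<And>s. s \<in> {0..1} \<Longrightarrow> admissible (C s)"
    and good: "\<And>s. s \<in> {0..1} \<Longrightarrow> no_zeros_over (C s) (hyperplane l)"
  obtains R where "R > 0" "\<And>s z. s \<in> {0..1} \<Longrightarrow> gnomonic (C s) l z = 0 \<Longrightarrow> norm z < R"
proof -
  let ?X = "{0..1} \<times> sphere (0::real^'k) 1 \<times> cball (0::real^'m) 1"
  let ?f = "\<lambda>q :: real \<times> (real^'k) \<times> (real^'m). tilde (C (fst q)) (snd q)"
  have "continuous_on ?X (\<lambda>q. (\<lambda>(s, x). C s x) (fst q, snd (snd q)))"
    by (rule continuous_on_compose2[OF C]) (auto intro!: continuous_intros)
  then have "continuous_on ?X ?f"
    unfolding tilde_def split_def fst_conv snd_conv by (intro continuous_intros)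
  then have "closed {q \<in> ?X. ?f q = 0}"
    by (intro continuous_closed_preimage_constant closed_Times) auto
  then have cK: "compact (?X \<inter> {q \<in> ?X. ?f q = 0})"
    by (intro compact_Int_closed compact_Times) auto
  define K where "K = ?X \<inter> {q \<in> ?X. ?f q = 0}"
  have "\<exists>\<eta>>0. \<forall>q\<in>K. \<eta> \<le> \<bar>l \<bullet> fst (snd q)\<bar>"
  proof (cases "K = {}")
    case False
    have "continuous_on K (\<lambda>q. \<bar>l \<bullet> fst (snd q)\<bar>)" by (intro continuous_intros)
    then obtain q where q: "q \<in> K" "\<And>r. r \<in> K \<Longrightarrow> \<bar>l \<bullet> fst (snd q)\<bar> \<le> \<bar>l \<bullet> fst (snd r)\<bar>"
      using continuous_attains_inf[OF cK[folded K_def] False] by blast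
    have "l \<bullet> fst (snd q) \<noteq> 0"
    proof
      assume "l \<bullet> fst (snd q) = 0"
      moreover obtain s \<gamma> x where "q = (s, \<gamma>, x)" by (metis prod.collapse)
      ultimately show False
        using q(1) good[of s] unfolding K_def no_zeros_over_def by auto
    qed
    then show ?thesis using q(2) by (intro exI[of _ "\<bar>l \<bullet> fst (snd q)\<bar>"]) auto
  qed (auto intro: exI[of _ 1])
  then obtain \<eta> where \<eta>: "\<eta> > 0" "\<And>q. q \<in> K \<Longrightarrow> \<eta> \<le> \<bar>l \<bullet> fst (snd q)\<bar>" by blast
  show ?thesis
  proof
    \<comment> \<open>The quotient bounds \<open>norm (l + u)\<close>, \<open>norm l\<close> pays
      for the passage to \<open>u\<close>, and a 1 for \<open>norm x\<close>; the other 1 is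
      slack.\<close>
    let ?R = "(l \<bullet> l) / \<eta> + norm l + 1 + 1"
    show "?R > 0" using \<eta>(1) by (intro add_nonneg_pos add_nonneg_nonneg) auto
    fix s z assume s: "s \<in> {0..1}" and 0: "gnomonic (C s) l z = 0"
    obtain u and x :: "real^'m" where J: "hyperplane_param l z = (u, x)" by (metis prod.collapse)
    note z = gnomonic_zero[OF l dim adm[OF s] 0 J]
    let ?\<gamma> = "l + u"
    have "tilde (C s) (?\<gamma> /\<^sub>R norm ?\<gamma>, x) = 0"
      using z(4) by (simp add: tilde_scaleR)
    then have "(s, ?\<gamma> /\<^sub>R norm ?\<gamma>, x) \<in> K"
      using s z(2,3) by (simp add: K_def)
    from \<eta>(2)[OF this] have "\<eta> \<le> (l \<bullet> l) / norm ?\<gamma>"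
      using z(1,2) by (simp add: divide_inverse mult.commute abs_mult)
    then have "norm ?\<gamma> \<le> (l \<bullet> l) / \<eta>"
      using z(2) \<eta>(1) by (simp add: field_simps)
    then have "norm u \<le> (l \<bullet> l) / \<eta> + norm l"
      using norm_triangle_ineq4[of ?\<gamma> l] by simp
    moreover have "norm z \<le> norm u + norm x"
      using hyperplane_param(2)[OF l dim, of z] J norm_Pair_le[of u x] by simp
    ultimately show "norm z < ?R" using z(3) by simp
  qed
qed

lemma gnomonic_degree_radius:
  fixes c :: "real^'m \<Rightarrow> (real^'n)^'k"
  assumes cont: "continuous_on UNIV (gnomonic c l)" and R: "R > 0" "\<And>z. gnomonic c l z = 0 \<Longrightarrow> norm z < R"
  shows "gnomonic_degree c l = sphere_degree (\<lambda>w. gnomonic c l (R *\<^sub>R w))"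
proof -
  define S where "S = (SOME R. R > 0 \<and> (\<forall>z. gnomonic c l z = 0 \<longrightarrow> norm z < R))"
  have S: "S > 0 \<and> (\<forall>z. gnomonic c l z = 0 \<longrightarrow> norm z < S)"
    unfolding S_def by (rule someI[of _ R]) (use R in blast)
  let ?H = "\<lambda>s w. gnomonic c l (((1 - s) * S + s * R) *\<^sub>R w)"
  have "sphere_degree (?H 0) = sphere_degree (?H 1)"
  proof (rule sphere_degree_homotopy)
    show "continuous_on ({0..1} \<times> sphere 0 1) (\<lambda>(s, w). ?H s w)"
      unfolding split_def by (intro continuous_on_compose2[OF cont] continuous_intros) auto
    fix s :: real and w :: "real^'n" assume s: "0 \<le> s" "s \<le> 1" and w: "norm w = 1"
    show "?H s w \<noteq> 0"
    proof
      assume 0: "?H s w = 0"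
      \<comment> \<open>Every intermediate radius is at least \<open>min S R\<close>, and all zeros
        lie strictly inside that radius.\<close>
      have "(1 - s) * min S R \<le> (1 - s) * S" "s * min S R \<le> s * R"
        using s by (intro mult_left_mono; simp)+
      then have "min S R \<le> (1 - s) * S + s * R" by (simp add: algebra_simps)
      moreover have "norm (((1 - s) * S + s * R) *\<^sub>R w) < min S R"
        using R(2)[OF 0] S 0 by (metis min_less_iff_conj)
      then have "\<bar>(1 - s) * S + s * R\<bar> < min S R"
        by (simp only: norm_scaleR w mult_1_right)
      ultimately show False by linarith
    qed
  qed
  then show ?thesis by (simp add: gnomonic_degree_def S_def)
qed

text \<open>A single radius encloses the zeros of the whole family, so on that sphere the maps form
  a homotopy into nonzero vectors.\<close>

lemma gnomonic_degree_homotopy: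
  fixes C :: "real \<Rightarrow> real^'m \<Rightarrow> (real^'n)^'k"
  assumes l: "l \<noteq> 0" and dim: "CARD('n) + 1 = CARD('k) + CARD('m)"
    and C: "continuous_on ({0..1} \<times> cball 0 1) (\<lambda>(s, x). C s x)"
    and adm: "\<And>s. s \<in> {0..1} \<Longrightarrow> admissible (C s)"
    and good: "\<And>s. s \<in> {0..1} \<Longrightarrow> no_zeros_over (C s) (hyperplane l)"
  shows "gnomonic_degree (C 0) l = gnomonic_degree (C 1) l"
proof -
  obtain R where R: "R > 0" "\<And>s z. s \<in> {0..1} \<Longrightarrow> gnomonic (C s) l z = 0 \<Longrightarrow> norm z < R"
    using gnomonic_zeros_bounded[OF assms] by blast
  note cont = continuous_on_gnomonic[OF l dim C]
  have cont': "continuous_on UNIV (gnomonic (C s) l)" if "s \<in> {0..1}" for s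
  proof -
    have "continuous_on UNIV (\<lambda>z. (\<lambda>(s, z). gnomonic (C s) l z) (s, z))"
      by (rule continuous_on_compose2[OF cont]) (use that in \<open>auto intro!: continuous_intros\<close>)
    then show ?thesis by simp
  qed
  have "sphere_degree (\<lambda>w. gnomonic (C 0) l (R *\<^sub>R w)) = sphere_degree (\<lambda>w. gnomonic (C 1) l (R *\<^sub>R w))"
  proof (rule sphere_degree_homotopy)
    have "continuous_on ({0..1} \<times> sphere 0 1) (\<lambda>p. (\<lambda>(s, z). gnomonic (C s) l z) (fst p, R *\<^sub>R snd p))"
      by (rule continuous_on_compose2[OF cont]) (auto intro!: continuous_intros)
    then show "continuous_on ({0..1} \<times> sphere 0 1) (\<lambda>(s, w). gnomonic (C s) l (R *\<^sub>R w))"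
      by (simp add: split_def)
    show "gnomonic (C s) l (R *\<^sub>R w) \<noteq> 0" if "0 \<le> s" "s \<le> 1" "norm w = 1" for s w
      using R(2)[of s "R *\<^sub>R w"] that R(1) by auto
  qed
  then show ?thesis
    using gnomonic_degree_radius[OF cont'[of 0] R(1) R(2)[of 0]] gnomonic_degree_radius[OF cont'[of 1] R(1) R(2)[of 1]]
    by simp
qed

lemma isolates_exists:
  fixes c :: "real^'m \<Rightarrow> (real^'n)^'k"
  assumes fin: "finite (tilde_zeros c)" and p: "(\<gamma>\<^sub>0, x\<^sub>0) \<in> tilde_zeros c" and x\<^sub>0: "norm x\<^sub>0 < 1"
  obtains \<rho> where "isolates c \<gamma>\<^sub>0 x\<^sub>0 \<rho>"
proof -
  obtain d where d: "d > 0" "\<And>q. q \<in> tilde_zeros c \<Longrightarrow> q \<noteq> (\<gamma>\<^sub>0, x\<^sub>0) \<Longrightarrow> d \<le> dist (\<gamma>\<^sub>0, x\<^sub>0) q"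
    using finite_set_avoid[OF fin, of "(\<gamma>\<^sub>0, x\<^sub>0)"] by blast
  \<comment> \<open>\<open>1/2\<close> keeps \<open>\<gamma>\<close> away from 0. Normalizing moves
    \<open>\<gamma>\<close> by at most \<open>\<rho>\<close>, so \<open>(?u, x)\<close> is within
    \<open>3 * \<rho> < d\<close> of the given zero. The last bound keeps \<open>x\<close> in the
    unit ball.\<close>
  define \<rho> where "\<rho> = min (min (1/2) (d/4)) (1 - norm x\<^sub>0)"
  have \<rho>: "\<rho> > 0" "\<rho> \<le> 1/2" "\<rho> \<le> d/4" "\<rho> \<le> 1 - norm x\<^sub>0"
    using d(1) x\<^sub>0 by (auto simp: \<rho>_def min_def)
  have \<gamma>\<^sub>0: "norm \<gamma>\<^sub>0 = 1" using p by (simp add: tilde_zeros_def)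
  have sub: "cball x\<^sub>0 \<rho> \<subseteq> cball 0 1"
  proof
    fix x assume "x \<in> cball x\<^sub>0 \<rho>"
    then show "x \<in> cball 0 1"
      using \<rho>(4) norm_triangle_ineq4[of x\<^sub>0 "x\<^sub>0 - x"] by (simp add: dist_norm)
  qed
  have "isolates c \<gamma>\<^sub>0 x\<^sub>0 \<rho>"
    unfolding isolates_def
  proof (intro conjI ballI impI)
    fix \<gamma> x assume g: "\<gamma> \<in> cball \<gamma>\<^sub>0 \<rho>" and x: "x \<in> cball x\<^sub>0 \<rho>" and 0: "tilde c (\<gamma>, x) = 0"
    have n: "\<bar>norm \<gamma> - 1\<bar> \<le> \<rho>"
      using g \<gamma>\<^sub>0 norm_triangle_ineq3[of \<gamma> \<gamma>\<^sub>0] by (simp add: dist_norm norm_minus_commute)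
    then have \<gamma>: "norm \<gamma> > 0" using \<rho>(2) by linarith
    let ?u = "\<gamma> /\<^sub>R norm \<gamma>"
    have "(?u, x) \<in> tilde_zeros c"
      using 0 \<gamma> x sub by (auto simp: tilde_zeros_def tilde_scaleR)
    moreover have "dist (\<gamma>\<^sub>0, x\<^sub>0) (?u, x) < d"
    proof -
      have "\<gamma> - ?u = (norm \<gamma> - 1) *\<^sub>R ?u"
        using \<gamma> by (simp add: algebra_simps)
      then have "norm (\<gamma> - ?u) = \<bar>norm \<gamma> - 1\<bar> * norm ?u" by (simp only: norm_scaleR)
      then have "norm (\<gamma> - ?u) = \<bar>norm \<gamma> - 1\<bar>" using \<gamma> by simp
      then have "dist \<gamma>\<^sub>0 ?u \<le> \<rho> + \<rho>"
        using n g dist_triangle[of \<gamma>\<^sub>0 ?u \<gamma>] by (simp add: dist_norm)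
      moreover have "dist (\<gamma>\<^sub>0, x\<^sub>0) (?u, x) \<le> dist \<gamma>\<^sub>0 ?u + dist x\<^sub>0 x"
        by (simp add: dist_prod_def sqrt_sum_squares_le_sum)
      ultimately show ?thesis using x \<rho> d(1) by simp
    qed
    ultimately have "(?u, x) = (\<gamma>\<^sub>0, x\<^sub>0)" using d(2) by fastforce
    then show "x = x\<^sub>0" "\<exists>t. \<gamma> = t *\<^sub>R \<gamma>\<^sub>0"
      using \<gamma> by (auto intro!: exI[of _ "norm \<gamma>"])
  qed (use \<rho> sub in auto)
  then show ?thesis by (rule that)
qed

lemma odd_sum_cong:
  fixes f g :: "'a \<Rightarrow> int"
  assumes "finite A" "\<And>a. a \<in> A \<Longrightarrow> odd (f a) \<longleftrightarrow> odd (g a)"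
  shows "odd (sum f A) \<longleftrightarrow> odd (sum g A)"
  using assms by (induction A rule: finite_induct) auto

text \<open>The line through an antipodal pair of zeros meets \<open>l + l^\<bottom>\<close> in one
  point, so any half \<open>P\<close> is in bijection with the zeros of the gnomonic map. Locally
  the two maps differ by a nonzero factor and by the choice of a transversal slice, neither of which
  affects the parity; additivity then applies.\<close>

lemma gnomonic_degree_parity:
  fixes c :: "real^'m \<Rightarrow> (real^'n)^'k"
  assumes l: "l \<noteq> 0" and dim: "CARD('n) + 1 = CARD('k) + CARD('m)" and k: "CARD('k) \<ge> 2"
    and adm: "admissible c" and good: "no_zeros_over c (hyperplane l)"
    and fin: "finite (tilde_zeros c)" and half: "half_of_zeros c P"
  shows "odd (gnomonic_degree c l) \<longleftrightarrow> odd (\<Sum>p\<in>P. local_degree (tilde c) p)"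
proof -
  define J where "J = (hyperplane_param l :: real^'n \<Rightarrow> (real^'k) \<times> (real^'m))"
  note J = hyperplane_param[OF l dim, folded J_def]
  \<comment> \<open>The factor, possibly negative, that moves \<open>fst p\<close> into the affine
    hyperplane: \<open>l \<bullet> (\<mu> p *\<^sub>R fst p) = l \<bullet> l\<close>.\<close>
  define \<mu> where "\<mu> = (\<lambda>p :: (real^'k) \<times> (real^'m). (l \<bullet> l) / (l \<bullet> fst p))"
  define \<theta> where "\<theta> = (\<lambda>p. SOME z. J z = (\<mu> p *\<^sub>R fst p - l, snd p))"
  define Z where "Z = {z. gnomonic c l z = 0}"
  have c: "continuous_on (cball 0 1) c" using adm by (simp add: admissible_def)
  have "continuous_on ({0..1} \<times> cball 0 1) (\<lambda>p :: real \<times> (real^'m). c (snd p))"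
    by (rule continuous_on_compose2[OF c]) (auto intro!: continuous_intros)
  then have C: "continuous_on ({0..1} \<times> cball 0 1) (\<lambda>(s :: real, x). c x)"
    by (simp add: split_def)
  obtain R where R: "R > 0" "\<And>z. gnomonic c l z = 0 \<Longrightarrow> norm z < R"
  proof (rule gnomonic_zeros_bounded[OF l dim C])
    show "admissible c" "no_zeros_over c (hyperplane l)" by fact+
    fix R assume R: "R > 0" "\<And>s z. s \<in> {0..1::real} \<Longrightarrow> gnomonic c l z = 0 \<Longrightarrow> norm z < R"
    show thesis by (rule that[OF R(1)]) (rule R(2)[of 0], simp_all)
  qed
  have "continuous_on UNIV (\<lambda>z. (\<lambda>(s :: real, z). gnomonic c l z) (0, z))"
    by (rule continuous_on_compose2[OF continuous_on_gnomonic[OF l dim C]]) (auto intro!: continuous_intros)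
  then have contg: "continuous_on UNIV (gnomonic c l)" by simp
  have J0: "w = 0" if "J w = 0" for w using J(2)[of w] that by simp
  then have injJ: "z = z'" if "J z = J z'" for z z'
    using that J0[of "z - z'"] linear_diff[OF J(1)] by simp
  have zero: "norm \<gamma> = 1" "l \<bullet> \<gamma> \<noteq> 0" "norm x < 1" "tilde c (\<gamma>, x) = 0" if "(\<gamma>, x) \<in> tilde_zeros c" for \<gamma> x
  proof -
    show 1: "norm \<gamma> = 1" "tilde c (\<gamma>, x) = 0" using that by (auto simp: tilde_zeros_def)
    have x: "norm x \<le> 1" "\<gamma> \<noteq> 0" using that by (auto simp: tilde_zeros_def)
    then show "l \<bullet> \<gamma> \<noteq> 0" using 1 good by (auto simp: no_zeros_over_def)
    have "norm x \<noteq> 1" using 1 x adm by (auto simp: admissible_def)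
    then show "norm x < 1" using x by simp
  qed
  have ll: "l \<bullet> l \<noteq> 0" using l by simp
  have \<mu>0: "\<mu> p \<noteq> 0" if "p \<in> tilde_zeros c" for p
    using zero(2)[of "fst p" "snd p"] that ll by (simp add: \<mu>_def)
  have J\<theta>: "J (\<theta> p) = (\<mu> p *\<^sub>R fst p - l, snd p)" if "p \<in> tilde_zeros c" for p
  proof -
    have "(\<mu> p *\<^sub>R fst p - l, snd p) \<in> range J"
      unfolding J(3) using zero(2)[of "fst p" "snd p"] that by (simp add: inner_diff_right \<mu>_def)
    then have "\<exists>z. J z = (\<mu> p *\<^sub>R fst p - l, snd p)" by (metis rangeE)
    from someI_ex[OF this] show ?thesis unfolding \<theta>_def .
  qed
  have PZ: "P \<subseteq> tilde_zeros c" and xor: "\<And>\<gamma> x. (\<gamma>, x) \<in> tilde_zeros c \<Longrightarrow> ((\<gamma>, x) \<in> P) \<noteq> ((- \<gamma>, x) \<in> P)"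
    using half by (auto simp: half_of_zeros_def)
  have finP: "finite P" using fin PZ by (rule rev_finite_subset)
  have bij: "bij_betw \<theta> P Z"
    unfolding bij_betw_def
  proof
    show "inj_on \<theta> P"
    proof (rule inj_onI)
      fix p q assume p: "p \<in> P" and q: "q \<in> P" and eq: "\<theta> p = \<theta> q"
      obtain \<gamma> x \<gamma>' x' where pq: "p = (\<gamma>, x)" "q = (\<gamma>', x')" by (metis prod.collapse)
      have "p \<in> tilde_zeros c" "q \<in> tilde_zeros c" using p q PZ by auto
      then have e: "\<mu> p *\<^sub>R \<gamma> = \<mu> q *\<^sub>R \<gamma>'" "x = x'" "\<mu> p \<noteq> 0" "norm \<gamma> = 1" "norm \<gamma>' = 1"
        using J\<theta>[of p] J\<theta>[of q] eq pq \<mu>0 zero(1) by auto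
      have "\<bar>\<mu> p\<bar> = \<bar>\<mu> q\<bar>" using arg_cong[OF e(1), of norm] e(4,5) by simp
      then have "\<mu> p = \<mu> q \<or> \<mu> p = - \<mu> q" by linarith
      then have "\<gamma>' = \<gamma> \<or> \<gamma>' = - \<gamma>"
      proof
        assume "\<mu> p = - \<mu> q"
        then have "\<mu> p *\<^sub>R (\<gamma> + \<gamma>') = 0" using e(1) by (simp add: scaleR_add_right)
        then show ?thesis using e(3) by (simp add: eq_neg_iff_add_eq_0 add.commute)
      next
        assume "\<mu> p = \<mu> q"
        then show ?thesis using e(1,3) by simp
      qed
      then show "p = q" using xor[of \<gamma> x] p q PZ pq e(2) by auto
    qed
    show "\<theta> ` P = Z"
    proof (intro equalityI subsetI)
      fix z assume "z \<in> \<theta> ` P"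
      then obtain p where p: "p \<in> P" "z = \<theta> p" by blast
      then have pz: "p \<in> tilde_zeros c" using PZ by blast
      have "gnomonic c l z = tilde c (\<mu> p *\<^sub>R fst p, snd p)"
        using J\<theta>[OF pz] zero(3)[of "fst p" "snd p"] pz p(2)
        by (simp add: gnomonic_def J_def[symmetric] clamp_ball_id)
      then show "z \<in> Z" using zero(4)[of "fst p" "snd p"] pz by (simp add: Z_def tilde_scaleR)
    next
      fix z assume "z \<in> Z"
      then have 0: "gnomonic c l z = 0" by (simp add: Z_def)
      obtain u and x :: "real^'m" where Jz: "J z = (u, x)" by (metis prod.collapse)
      note g = gnomonic_zero[OF l dim adm 0 Jz[unfolded J_def]]
      let ?v = "(l + u) /\<^sub>R norm (l + u)"
      have v: "(?v, x) \<in> tilde_zeros c"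
        using g by (simp add: tilde_zeros_def tilde_scaleR)
      \<comment> \<open>One of the two opposite unit vectors belongs to \<open>P\<close>. Both lead
        to the same point of the hyperplane, as \<open>\<mu>\<close> changes sign with the
        vector.\<close>
      have "\<exists>\<epsilon>\<in>{1, -1 :: real}. (\<epsilon> *\<^sub>R ?v, x) \<in> P"
        using xor[OF v] by (cases "(?v, x) \<in> P") auto
      then obtain \<epsilon> :: real where \<epsilon>: "\<epsilon> = 1 \<or> \<epsilon> = -1" "(\<epsilon> *\<^sub>R ?v, x) \<in> P" by blast
      have "\<mu> (\<epsilon> *\<^sub>R ?v, x) *\<^sub>R \<epsilon> *\<^sub>R ?v = l + u"
        using g(1,2) ll \<epsilon>(1) by (auto simp: \<mu>_def)
      then have "J (\<theta> (\<epsilon> *\<^sub>R ?v, x)) = J z"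
        using J\<theta>[of "(\<epsilon> *\<^sub>R ?v, x)"] \<epsilon>(2) PZ Jz by auto
      then have "z = \<theta> (\<epsilon> *\<^sub>R ?v, x)" using injJ by simp
      then show "z \<in> \<theta> ` P" using \<epsilon>(2) by blast
    qed
  qed
  then have finZ: "finite Z" using finP by (metis bij_betw_finite)
  have "\<exists>r>0. cball (\<theta> p) r \<inter> Z = {\<theta> p} \<and>
      (odd (sphere_degree (\<lambda>w. gnomonic c l (\<theta> p + r *\<^sub>R w))) \<longleftrightarrow> odd (local_degree (tilde c) p))"
    if pP: "p \<in> P" for p
  proof -
    obtain \<gamma>\<^sub>0 x\<^sub>0 where p: "p = (\<gamma>\<^sub>0, x\<^sub>0)" by (metis prod.collapse)
    have pz: "(\<gamma>\<^sub>0, x\<^sub>0) \<in> tilde_zeros c" using pP p PZ by blast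
    note z = zero[OF pz]
    obtain \<rho> where iso: "isolates c \<gamma>\<^sub>0 x\<^sub>0 \<rho>"
      using isolates_exists[OF fin pz z(3)] by blast
    then have \<rho>: "\<rho> > 0" by (simp add: isolates_def)
    have lam: "\<mu> p \<noteq> 0" using \<mu>0 pz p by simp
    have Jp: "J (\<theta> p) = (\<mu> p *\<^sub>R \<gamma>\<^sub>0 - l, x\<^sub>0)"
      using J\<theta>[of p] pz by (simp add: p)
    \<comment> \<open>Pulling the factor \<open>\<mu> p\<close> out of \<open>tilde c\<close>
      divides the displacement of \<open>\<gamma>\<close> by it. What remains is a linear slice
      through the unit zero, transversal because
      \<open>l \<bullet> \<gamma>\<^sub>0 \<noteq> 0\<close>.\<close>
    define L where "L = (\<lambda>w. ((1 / \<mu> p) *\<^sub>R fst (J w), snd (J w)))"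
    have linL: "linear L"
      unfolding L_def using J(1) by (intro linearI) (simp_all add: linear_add linear_scale algebra_simps)
    have trans: "w = 0" if "L w = (t *\<^sub>R \<gamma>\<^sub>0, 0)" for w t
    proof -
      have e: "(1 / \<mu> p) *\<^sub>R fst (J w) = t *\<^sub>R \<gamma>\<^sub>0" "snd (J w) = 0"
        using that by (simp_all add: L_def)
      have "fst (J w) = \<mu> p *\<^sub>R ((1 / \<mu> p) *\<^sub>R fst (J w))" using lam by simp
      then have fs: "fst (J w) = (\<mu> p * t) *\<^sub>R \<gamma>\<^sub>0" "snd (J w) = 0"
        unfolding e(1) using e(2) by simp_all
      have "l \<bullet> fst (J w) = 0" using J(3) by blast
      then have "t = 0" using fs(1) lam z(2) by simp
      then show "w = 0" using fs J0[of w] by (simp add: prod_eq_iff)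
    qed
    obtain K where K: "K > 0" "\<And>w. norm (L w) \<le> K * norm w"
      using linear_bounded_pos[OF linL] by blast
    obtain d where d: "d > 0" "\<And>q. q \<in> Z \<Longrightarrow> q \<noteq> \<theta> p \<Longrightarrow> d \<le> dist (\<theta> p) q"
      using finite_set_avoid[OF finZ, of "\<theta> p"] by blast
    define r where "r = min (d/2) (\<rho> / K)"
    have r: "r > 0" "r \<le> d/2" "r \<le> \<rho> / K"
      unfolding r_def using d(1) \<rho> K(1) by (simp, linarith, linarith)
    then have rK: "r * K \<le> \<rho>" using K(1) by (simp add: pos_le_divide_eq)
    have rL: "norm (r *\<^sub>R L w) \<le> \<rho>" if "norm w = 1" for w
      using order_trans[OF mult_left_mono[OF K(2)[of w], of r] _] r(1) rK that by simp
    have "\<theta> p \<in> Z" using bij pP by (auto simp: bij_betw_def)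
    then have "cball (\<theta> p) r \<inter> Z = {\<theta> p}"
      using d r by fastforce
    moreover have "odd (sphere_degree (\<lambda>w. gnomonic c l (\<theta> p + r *\<^sub>R w))) \<longleftrightarrow> odd (local_degree (tilde c) p)"
    proof -
      have "gnomonic c l (\<theta> p + r *\<^sub>R w) = \<mu> p *\<^sub>R tilde c ((\<gamma>\<^sub>0, x\<^sub>0) + r *\<^sub>R L w)" if w: "norm w = 1" for w
      proof -
        have Jw: "J (\<theta> p + r *\<^sub>R w) = (\<mu> p *\<^sub>R \<gamma>\<^sub>0 - l + r *\<^sub>R fst (J w), x\<^sub>0 + r *\<^sub>R snd (J w))"
          unfolding linear_add[OF J(1)] linear_scale[OF J(1)] Jp by (simp add: prod_eq_iff)
        have "norm (x\<^sub>0 + r *\<^sub>R snd (J w)) \<le> 1"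
          using isolates_nbhd(1)[OF iso rL[OF w]] by (simp add: L_def)
        then have "gnomonic c l (\<theta> p + r *\<^sub>R w) = tilde c (\<mu> p *\<^sub>R \<gamma>\<^sub>0 + r *\<^sub>R fst (J w), x\<^sub>0 + r *\<^sub>R snd (J w))"
          by (simp add: gnomonic_def J_def[symmetric] Jw clamp_ball_id)
        also have "\<dots> = tilde c (\<mu> p *\<^sub>R (\<gamma>\<^sub>0 + (r / \<mu> p) *\<^sub>R fst (J w)), x\<^sub>0 + r *\<^sub>R snd (J w))"
          using lam by (simp add: scaleR_add_right)
        finally show ?thesis by (simp add: tilde_scaleR L_def)
      qed
      then have "sphere_degree (\<lambda>w. gnomonic c l (\<theta> p + r *\<^sub>R w)) =
          sphere_degree (\<lambda>w. \<mu> p *\<^sub>R tilde c ((\<gamma>\<^sub>0, x\<^sub>0) + r *\<^sub>R L w))"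
        by (rule sphere_degree_cong)
      also have "odd \<dots> \<longleftrightarrow> odd (sphere_degree (\<lambda>w. tilde c ((\<gamma>\<^sub>0, x\<^sub>0) + r *\<^sub>R L w)))"
      proof (rule sphere_degree_scaleR[OF _ _ lam])
        show "continuous_on (sphere 0 1) (\<lambda>w. tilde c ((\<gamma>\<^sub>0, x\<^sub>0) + r *\<^sub>R L w))"
        proof (rule continuous_on_compose2[OF continuous_on_tilde[OF c]])
          have "continuous_on (sphere 0 1) L" using linL by (simp add: linear_continuous_on linear_linear)
          then show "continuous_on (sphere 0 1) (\<lambda>w. (\<gamma>\<^sub>0, x\<^sub>0) + r *\<^sub>R L w)"
            by (intro continuous_intros)
          show "(\<lambda>w. (\<gamma>\<^sub>0, x\<^sub>0) + r *\<^sub>R L w) ` sphere 0 1 \<subseteq> UNIV \<times> cball 0 1"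
            by (intro image_subsetI isolates_nbhd(1)[OF iso] rL) simp
        qed
        show "tilde c ((\<gamma>\<^sub>0, x\<^sub>0) + r *\<^sub>R L w) \<noteq> 0" if w: "norm w = 1" for w
        proof
          assume "tilde c ((\<gamma>\<^sub>0, x\<^sub>0) + r *\<^sub>R L w) = 0"
          then obtain t where "r *\<^sub>R L w = (t *\<^sub>R \<gamma>\<^sub>0, 0)"
            using isolates_nbhd(2)[OF iso rL[OF w]] by blast
          then have "L (r *\<^sub>R w) = (t *\<^sub>R \<gamma>\<^sub>0, 0)" by (simp add: linear_scale[OF linL])
          then have "r *\<^sub>R w = 0" by (rule trans)
          then show False using r(1) w by auto
        qed
      qed
      also have "\<dots> \<longleftrightarrow> odd (local_degree (tilde c) p)"
        unfolding p by (rule local_degree_parity[OF dim k c iso z(1) linL _ r(1) rL, symmetric]) (rule trans)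
      finally show ?thesis .
    qed
    ultimately show ?thesis using r(1) by blast
  qed
  then obtain r where r: "\<And>p. p \<in> P \<Longrightarrow> r p > 0 \<and> cball (\<theta> p) (r p) \<inter> Z = {\<theta> p} \<and>
      (odd (sphere_degree (\<lambda>w. gnomonic c l (\<theta> p + r p *\<^sub>R w))) \<longleftrightarrow> odd (local_degree (tilde c) p))"
    by metis
  \<comment> \<open>The radii were chosen along \<open>P\<close>; additivity wants them indexed by
    the zeros in the chart.\<close>
  define r' where "r' = (\<lambda>z. r (the_inv_into P \<theta> z))"
  have r': "r' (\<theta> p) = r p" if "p \<in> P" for p
    using the_inv_into_f_f[OF _ that, of \<theta>] bij by (simp add: r'_def bij_betw_def)
  have "gnomonic_degree c l = sphere_degree (\<lambda>w. gnomonic c l (R *\<^sub>R w))"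
    by (rule gnomonic_degree_radius[OF contg R])
  also have "\<dots> = (\<Sum>z\<in>Z. sphere_degree (\<lambda>w. gnomonic c l (z + r' z *\<^sub>R w)))"
  proof (rule sphere_degree_additive[OF _ contg Z_def finZ _ _ R(1)])
    have "CARD('m) \<ge> 1" by (simp add: Suc_leI)
    then show "CARD('n) \<ge> 2" using dim k by linarith
    show "Z \<subseteq> ball 0 R" using R(2) by (auto simp: Z_def)
    show "0 < r' z \<and> cball z (r' z) \<inter> Z = {z}" if "z \<in> Z" for z
    proof -
      have "z \<in> \<theta> ` P" using that bij_betw_imp_surj_on[OF bij] by simp
      then obtain p where "p \<in> P" "z = \<theta> p" by (rule imageE)
      then show ?thesis using r[of p] r' by simp
    qed
  qed
  also have "\<dots> = (\<Sum>p\<in>P. sphere_degree (\<lambda>w. gnomonic c l (\<theta> p + r' (\<theta> p) *\<^sub>R w)))"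
    by (rule sum.reindex_bij_betw[OF bij, symmetric])
  also have "odd \<dots> \<longleftrightarrow> odd (\<Sum>p\<in>P. local_degree (tilde c) p)"
    by (rule odd_sum_cong[OF finP]) (use r r' in simp)
  finally show ?thesis .
qed

section \<open>Generic perturbations\<close>

text \<open>Sard's theorem is available only for coordinates indexed by a well-ordered type; this copy of
  the index type supplies the order.\<close>

typedef (overloaded) ('n :: finite) ordered_index = "{..<CARD('n)}"
  by (intro exI[of _ 0]) simp

instantiation ordered_index :: (finite) wellorder
begin

definition less_eq_ordered_index :: "'a ordered_index \<Rightarrow> 'a ordered_index \<Rightarrow> bool" where
  "less_eq_ordered_index i j \<longleftrightarrow> Rep_ordered_index i \<le> Rep_ordered_index j"

definition less_ordered_index :: "'a ordered_index \<Rightarrow> 'a ordered_index \<Rightarrow> bool" where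
  "less_ordered_index i j \<longleftrightarrow> Rep_ordered_index i < Rep_ordered_index j"

instance
proof
  fix P :: "'a ordered_index \<Rightarrow> bool" and a
  assume step: "\<And>x. (\<And>y. y < x \<Longrightarrow> P y) \<Longrightarrow> P x"
  show "P a"
    by (induction a rule: measure_induct_rule[of Rep_ordered_index])
       (rule step, simp add: less_ordered_index_def)
qed (auto simp: less_eq_ordered_index_def less_ordered_index_def Rep_ordered_index_inject)

end

lemma card_ordered_index: "CARD('n::finite ordered_index) = CARD('n)"
  by (simp add: type_definition.card[OF type_definition_ordered_index])

instance ordered_index :: (finite) finite
proof
  have "finite (range (Rep_ordered_index :: 'a ordered_index \<Rightarrow> nat))"
    by (simp add: type_definition.Rep_range[OF type_definition_ordered_index])
  then show "finite (UNIV :: 'a ordered_index set)"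
    by (rule finite_imageD) (simp add: inj_on_def Rep_ordered_index_inject)
qed

text \<open>Conjugation with a linear isomorphism moves \<open>f\<close> to ordered coordinates and
  turns a singular derivative into one of deficient rank; the linear map back preserves negligible
  sets.\<close>

lemma Sard_square:
  fixes f :: "real^'n \<Rightarrow> real^'n"
  assumes der: "\<And>x. x \<in> S \<Longrightarrow> (f has_derivative f' x) (at x)" and sing: "\<And>x. x \<in> S \<Longrightarrow> \<not> inj (f' x)"
  shows "negligible (f ` S)"
proof -
  have d: "dim (UNIV :: (real^'n) set) = dim (UNIV :: (real^('n ordered_index)) set)"
    by (simp add: dim_UNIV card_ordered_index)
  obtain h :: "real^'n \<Rightarrow> real^('n ordered_index)" and g where hg: "linear h" "linear g" "\<And>x. g (h x) = x" "\<And>y. h (g y) = y"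
    using isometries_subspaces[OF subspace_UNIV subspace_UNIV d] by (metis UNIV_I)
  have bl: "bounded_linear h" "bounded_linear g"
    using hg by (simp_all add: linear_linear)
  have "negligible ((h \<circ> f \<circ> g) ` (h ` S))"
  proof (rule baby_Sard[where f' = "\<lambda>y. h \<circ> f' (g y) \<circ> g"])
    fix y assume "y \<in> h ` S"
    then have gy: "g y \<in> S" using hg(3) by auto
    have "(f has_derivative f' (g y)) (at (g y))" by (rule der[OF gy])
    with bl have 1: "((f \<circ> g) has_derivative (f' (g y) \<circ> g)) (at y)"
      by (intro diff_chain_at bounded_linear_imp_has_derivative)
    have D: "((h \<circ> f \<circ> g) has_derivative (h \<circ> f' (g y) \<circ> g)) (at y)"
      using diff_chain_at[OF 1 bounded_linear_imp_has_derivative[OF bl(1)]] by (simp add: o_assoc)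
    then show "((h \<circ> f \<circ> g) has_derivative (h \<circ> f' (g y) \<circ> g)) (at y within h ` S)"
      by (rule has_derivative_at_withinI)
    have lin: "linear (h \<circ> f' (g y) \<circ> g)"
      using has_derivative_linear[OF D] .
    have "\<not> inj (h \<circ> f' (g y) \<circ> g)"
    proof
      assume inj: "inj (h \<circ> f' (g y) \<circ> g)"
      have "inj (f' (g y))"
      proof (rule injI)
        fix u v assume "f' (g y) u = f' (g y) v"
        then have "(h \<circ> f' (g y) \<circ> g) (h u) = (h \<circ> f' (g y) \<circ> g) (h v)" by (simp add: hg)
        then have "h u = h v" using inj by (simp only: inj_eq)
        then show "u = v" by (metis hg(3))
      qed
      then show False using sing[OF gy] by blast
    qed
    then show "rank (matrix (h \<circ> f' (g y) \<circ> g)) < CARD('n ordered_index)"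
      using lin by (simp add: less_rank_noninjective matrix_vector_mul)
  qed simp
  moreover have "g differentiable_on T" for T
    using bl(2) by (simp add: bounded_linear_imp_differentiable_on)
  ultimately have "negligible (g ` ((h \<circ> f \<circ> g) ` (h ` S)))"
    by (rule negligible_differentiable_image_negligible[rotated]) (auto simp: card_ordered_index)
  then show ?thesis by (simp add: image_image hg)
qed

section \<open>Stability under small perturbations\<close>

definition lincomb :: "(real^'n)^'k \<Rightarrow> real^'k \<Rightarrow> real^'n" where
  "lincomb A \<gamma> = (\<Sum>i\<in>UNIV. (\<gamma> $ i) *\<^sub>R (A $ i))"

lemma tilde_lincomb: "tilde c (\<gamma>, x) = lincomb (c x) \<gamma>"
  by (simp add: tilde_def lincomb_def)

lemma lincomb_scaleR: "lincomb A (t *\<^sub>R \<gamma>) = t *\<^sub>R lincomb A \<gamma>"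
  by (simp add: lincomb_def scaleR_sum_right)

lemma lincomb_add: "lincomb (A + B) \<gamma> = lincomb A \<gamma> + lincomb B \<gamma>"
  by (simp add: lincomb_def scaleR_add_right sum.distrib)

lemma lincomb_diff: "lincomb (A - B) \<gamma> = lincomb A \<gamma> - lincomb B \<gamma>"
  by (simp add: lincomb_def scaleR_diff_right sum_subtractf)

lemma norm_lincomb_le: "norm (lincomb A \<gamma>) \<le> CARD('k) * norm \<gamma> * norm A" for A :: "(real^'n)^'k"
proof -
  have "norm (lincomb A \<gamma>) \<le> (\<Sum>i\<in>UNIV. norm ((\<gamma> $ i) *\<^sub>R (A $ i)))"
    unfolding lincomb_def by (rule norm_sum)
  also have "\<dots> \<le> (\<Sum>i\<in>(UNIV::'k set). norm \<gamma> * norm A)"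
    by (intro sum_mono) (simp add: mult_mono component_le_norm_cart Finite_Cartesian_Product.norm_nth_le)
  finally show ?thesis by simp
qed

text \<open>For \<open>W = UNIV\<close> this is linear independence of the columns; for a hyperplane
  it excludes zeros on the equator of a gnomonic chart.\<close>

definition nonvanishing :: "(real^'n)^'k \<Rightarrow> (real^'k) set \<Rightarrow> bool" where
  "nonvanishing A W \<longleftrightarrow> (\<forall>\<gamma>\<in>W. \<gamma> \<noteq> 0 \<longrightarrow> lincomb A \<gamma> \<noteq> 0)"

lemma no_zeros_over_iff: "no_zeros_over c W \<longleftrightarrow> (\<forall>x\<in>cball 0 1. nonvanishing (c x) W)"
  by (auto simp: no_zeros_over_def nonvanishing_def tilde_lincomb)

lemma admissible_iff:
  "admissible c \<longleftrightarrow> continuous_on (cball 0 1) c \<and> (\<forall>x\<in>sphere 0 1. nonvanishing (c x) UNIV)"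
  by (auto simp: admissible_def nonvanishing_def tilde_lincomb)

text \<open>By homogeneity unit vectors suffice, and on the compact product of the unit sphere of
  \<open>W\<close> with \<open>S\<close> the norm of the linear combination has a positive lower
  bound.\<close>

lemma nonvanishing_stable:
  fixes c :: "'a::topological_space \<Rightarrow> (real^'n)^'k"
  assumes S: "compact S" and c: "continuous_on S c" and W: "subspace W"
    and nv: "\<And>x. x \<in> S \<Longrightarrow> nonvanishing (c x) W"
  obtains \<eta> where "\<eta> > 0" "\<And>x A. x \<in> S \<Longrightarrow> norm (A - c x) \<le> \<eta> \<Longrightarrow> nonvanishing A W"
proof -
  let ?K = "(sphere 0 1 \<inter> W) \<times> S"
  have cK: "compact ?K"
    using S closed_subspace[OF W] by (intro compact_Times compact_Int_closed) auto
  have "\<exists>\<epsilon>>0. \<forall>q\<in>?K. \<epsilon> \<le> norm (lincomb (c (snd q)) (fst q))"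
  proof (cases "?K = {}")
    case False
    have "continuous_on ?K (\<lambda>q. c (snd q))"
      by (rule continuous_on_compose2[OF c]) (auto intro: continuous_intros)
    then have "continuous_on ?K (\<lambda>q. norm (lincomb (c (snd q)) (fst q)))"
      unfolding lincomb_def by (intro continuous_intros)
    then obtain q where q: "q \<in> ?K" "\<And>r. r \<in> ?K \<Longrightarrow> norm (lincomb (c (snd q)) (fst q)) \<le> norm (lincomb (c (snd r)) (fst r))"
      using continuous_attains_inf[OF cK False] by blast
    have "norm (fst q) = 1" "fst q \<in> W" "snd q \<in> S" using q(1) by auto
    then have "lincomb (c (snd q)) (fst q) \<noteq> 0"
      using nv[of "snd q"] unfolding nonvanishing_def by (metis norm_eq_1_imp)
    then show ?thesis using q(2) by (intro exI[of _ "norm (lincomb (c (snd q)) (fst q))"]) auto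
  qed (auto intro: exI[of _ 1])
  then obtain \<epsilon> where \<epsilon>: "\<epsilon> > 0" "\<And>q. q \<in> ?K \<Longrightarrow> \<epsilon> \<le> norm (lincomb (c (snd q)) (fst q))" by blast
  show ?thesis
  proof
    \<comment> \<open>A linear combination with unit coefficients moves by at most
      \<open>CARD('k)\<close> times the perturbation, here half of the lower bound.\<close>
    show "\<epsilon> / (2 * CARD('k)) > 0" using \<epsilon>(1) by simp
    fix x A assume x: "x \<in> S" and A: "norm (A - c x) \<le> \<epsilon> / (2 * CARD('k))"
    show "nonvanishing A W"
      unfolding nonvanishing_def
    proof (intro ballI impI notI)
      fix \<gamma> assume \<gamma>: "\<gamma> \<in> W" "\<gamma> \<noteq> 0" and 0: "lincomb A \<gamma> = 0"
      let ?u = "\<gamma> /\<^sub>R norm \<gamma>"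
      have u: "norm ?u = 1" "?u \<in> W" using \<gamma> subspace_scale[OF W] by auto
      have "lincomb A ?u = 0" using 0 by (simp add: lincomb_scaleR)
      then have "norm (lincomb (A - c x) ?u) = norm (lincomb (c x) ?u)" by (simp add: lincomb_diff)
      moreover have "\<epsilon> \<le> norm (lincomb (c x) ?u)" using \<epsilon>(2)[of "(?u, x)"] u x by simp
      moreover have "norm (lincomb (A - c x) ?u) \<le> CARD('k) * norm (A - c x)"
        using norm_lincomb_le[of "A - c x" ?u] u(1) by simp
      moreover have "CARD('k) * norm (A - c x) \<le> \<epsilon> / 2"
        using A by (simp add: field_simps)
      ultimately show False using \<epsilon>(1) by linarith
    qed
  qed
qed

text \<open>Both conditions are open, uniformly by compactness, so the straight path from
  \<open>c\<close> to \<open>c'\<close> satisfies them throughout.\<close>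

lemma gnomonic_degree_stable:
  fixes c :: "real^'m \<Rightarrow> (real^'n)^'k"
  assumes l: "l \<noteq> 0" and dim: "CARD('n) + 1 = CARD('k) + CARD('m)"
    and adm: "admissible c" and good: "no_zeros_over c (hyperplane l)"
  obtains \<eta> where "\<eta> > 0"
    "\<And>c'. continuous_on (cball 0 1) c' \<Longrightarrow> (\<And>x. x \<in> cball 0 1 \<Longrightarrow> norm (c' x - c x) \<le> \<eta>) \<Longrightarrow>
       admissible c' \<and> no_zeros_over c' (hyperplane l) \<and> gnomonic_degree c' l = gnomonic_degree c l"
proof -
  have c: "continuous_on (cball 0 1) c" "continuous_on (sphere 0 1) c"
    using adm by (auto simp: admissible_def intro: continuous_on_subset)
  obtain \<eta>1 where \<eta>1: "\<eta>1 > 0" "\<And>x A. x \<in> sphere 0 1 \<Longrightarrow> norm (A - c x) \<le> \<eta>1 \<Longrightarrow> nonvanishing A UNIV"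
    using nonvanishing_stable[OF compact_sphere c(2) subspace_UNIV] adm unfolding admissible_iff by metis
  obtain \<eta>2 where \<eta>2: "\<eta>2 > 0" "\<And>x A. x \<in> cball 0 1 \<Longrightarrow> norm (A - c x) \<le> \<eta>2 \<Longrightarrow> nonvanishing A (hyperplane l)"
    using nonvanishing_stable[OF compact_cball c(1) subspace_hyperplane] good unfolding no_zeros_over_iff by metis
  show ?thesis
  proof
    show "min \<eta>1 \<eta>2 > 0" using \<eta>1(1) \<eta>2(1) by simp
    fix c' assume c': "continuous_on (cball 0 1) c'" and near: "\<And>x. x \<in> cball 0 1 \<Longrightarrow> norm (c' x - c x) \<le> min \<eta>1 \<eta>2"
    let ?C = "\<lambda>s x. c x + s *\<^sub>R (c' x - c x)"
    have nearC: "norm (?C s x - c x) \<le> \<eta>1" "norm (?C s x - c x) \<le> \<eta>2" if "s \<in> {0..1}" "x \<in> cball 0 1" for s x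
    proof -
      have "norm (?C s x - c x) \<le> 1 * norm (c' x - c x)"
        using that(1) by (simp add: mult_left_le_one_le)
      then show "norm (?C s x - c x) \<le> \<eta>1" "norm (?C s x - c x) \<le> \<eta>2"
        using near[OF that(2)] by linarith+
    qed
    have "continuous_on ({0..1} \<times> cball 0 1) (\<lambda>p :: real \<times> (real^'m). c (snd p))"
         "continuous_on ({0..1} \<times> cball 0 1) (\<lambda>p :: real \<times> (real^'m). c' (snd p))"
      by (rule continuous_on_compose2[OF c(1)] continuous_on_compose2[OF c']; auto intro!: continuous_intros)+
    then have C: "continuous_on ({0..1} \<times> cball 0 1) (\<lambda>(s, x). ?C s x)"
      unfolding split_def by (intro continuous_intros)
    have admC: "admissible (?C s)" if s: "s \<in> {0..1}" for s
      unfolding admissible_iff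
    proof (intro conjI ballI)
      show "continuous_on (cball 0 1) (?C s)" by (intro continuous_intros c c')
      show "nonvanishing (?C s x) UNIV" if "x \<in> sphere 0 1" for x
        using that by (intro \<eta>1(2)[of x] nearC(1)[OF s]) auto
    qed
    have goodC: "no_zeros_over (?C s) (hyperplane l)" if s: "s \<in> {0..1}" for s
      unfolding no_zeros_over_iff using \<eta>2(2) nearC(2)[OF s] by blast
    have "gnomonic_degree (?C 0) l = gnomonic_degree (?C 1) l"
      by (rule gnomonic_degree_homotopy[OF l dim C admC goodC])
    then show "admissible c' \<and> no_zeros_over c' (hyperplane l) \<and> gnomonic_degree c' l = gnomonic_degree c l"
      using admC[of 1] goodC[of 1] by simp
  qed
qed

section \<open>Polynomial maps and finiteness of the zero set\<close>

lemma polynomial_approximation: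
  fixes c :: "real^'m \<Rightarrow> (real^'n)^'k"
  assumes "continuous_on (cball 0 1) c" "e > 0"
  obtains p where "polynomial_function p" "\<And>x. x \<in> cball 0 1 \<Longrightarrow> norm (p x - c x) < e"
  using Stone_Weierstrass_polynomial_function[OF compact_cball assms] by (metis norm_minus_commute)

text \<open>Its linear combination along \<open>\<gamma>\<close> is
  \<open>(l \<bullet> \<gamma>) *\<^sub>R v\<close>: zero over \<open>l^\<bottom>\<close> and
  constant on \<open>l + l^\<bottom>\<close>. Adding it translates the gnomonic map by
  \<open>(l \<bullet> l) *\<^sub>R v\<close>.\<close>

definition rank_one :: "real^'k \<Rightarrow> real^'n \<Rightarrow> (real^'n)^'k" where
  "rank_one l v = (\<chi> i. (l $ i) *\<^sub>R v)"

lemma lincomb_rank_one: "lincomb (rank_one l v) \<gamma> = (l \<bullet> \<gamma>) *\<^sub>R v"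
  by (simp add: lincomb_def rank_one_def inner_vec_def scaleR_sum_left mult.commute)

lemma norm_rank_one: "norm (rank_one l v) = norm l * norm v"
proof -
  have "norm (rank_one l v) = L2_set (\<lambda>i. norm (rank_one l v $ i)) UNIV" by (rule norm_vec_def)
  then show ?thesis by (simp add: norm_vec_def[of l] rank_one_def L2_set_left_distrib)
qed

lemma small_vector_outside_negligible:
  fixes N :: "(real^'n) set"
  assumes "negligible N" "e > 0"
  obtains w where "norm w < e" "w \<notin> N"
proof -
  have "\<not> negligible (ball (0 :: real^'n) e)" using assms(2) by (intro open_not_negligible) auto
  then have "\<not> ball 0 e \<subseteq> N" using assms(1) negligible_subset by blast
  then obtain w where "w \<in> ball 0 e" "w \<notin> N" by blast
  then show ?thesis using that by simp
qed

text \<open>This is the gnomonic expression without \<open>clamp_ball\<close>, which is not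
  differentiable across the unit sphere; over the closed ball the two agree.\<close>

lemma polynomial_gnomonic_differentiable:
  fixes p :: "real^'m \<Rightarrow> (real^'n)^'k" and J :: "real^'n \<Rightarrow> (real^'k) \<times> (real^'m)"
  assumes p: "polynomial_function p" and J: "linear J"
  shows "(\<lambda>z. lincomb (p (snd (J z))) (l + fst (J z))) differentiable (at z)"
proof -
  have bl: "bounded_linear J" using J by (simp add: linear_linear)
  have fs: "(\<lambda>z. fst (J z)) differentiable (at z)" "(\<lambda>z. snd (J z)) differentiable (at z)"
    using bounded_linear_compose[OF bounded_linear_fst bl] bounded_linear_compose[OF bounded_linear_snd bl]
    by (auto simp: bounded_linear_imp_differentiable)
  have "(p \<circ> (\<lambda>z. snd (J z))) differentiable (at z)"
    by (intro differentiable_chain_at fs differentiable_at_polynomial_function p)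
  then have "(\<lambda>z. p (snd (J z))) differentiable (at z)" by (simp add: o_def)
  then have "(\<lambda>z. p (snd (J z)) $ i) differentiable (at z)" for i
    by (rule differentiable_compose[OF bounded_linear_imp_differentiable[OF bounded_linear_vec_nth]])
  moreover have "(\<lambda>z. (l + fst (J z)) $ i) differentiable (at z)" for i
    by (rule differentiable_compose[OF bounded_linear_imp_differentiable[OF bounded_linear_vec_nth]])
       (intro differentiable_add differentiable_const fs)
  ultimately show ?thesis
    unfolding lincomb_def by (intro differentiable_sum differentiable_scaleR) auto
qed

text \<open>The derivative stretches by at least \<open>B\<close> and the remainder is at most
  \<open>B/2\<close> times the distance, so near \<open>z\<close> the value \<open>f z\<close> is
  not taken again.\<close>

lemma nonzero_near_injective_derivative:
  fixes f :: "real^'n \<Rightarrow> real^'n"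
  assumes "(f has_derivative f') (at z)" "inj f'"
  shows "\<not> z islimpt {y. f y = f z}"
proof -
  have lin: "linear f'" using assms(1) by (rule has_derivative_linear)
  obtain B where B: "B > 0" "\<And>x. B * norm x \<le> norm (f' x)"
    using linear_inj_bounded_below_pos[OF lin assms(2)] by blast
  obtain d where d: "d > 0" "\<And>y. norm (y - z) < d \<Longrightarrow> norm (f y - f z - f' (y - z)) \<le> (B/2) * norm (y - z)"
    using assms(1) B(1) unfolding has_derivative_at_alt by (metis half_gt_zero)
  show ?thesis
    unfolding islimpt_approachable
  proof
    assume "\<forall>\<epsilon>>0. \<exists>x'\<in>{y. f y = f z}. x' \<noteq> z \<and> dist x' z < \<epsilon>"
    then obtain y where y: "f y = f z" "y \<noteq> z" "norm (y - z) < d" using d(1) by (auto simp: dist_norm)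
    have "B * norm (y - z) \<le> (B/2) * norm (y - z)"
      using B(2)[of "y - z"] d(2)[OF y(3)] y(1) by simp
    then show False using B(1) y(2) by simp
  qed
qed

text \<open>The perturbation subtracts a constant \<open>w\<close>, so the new zeros form a level
  set of the old chart expression. At a regular value it is discrete, and it is compact since no
  zeros lie over the equator.\<close>

lemma finite_zeros_perturbation:
  fixes p :: "real^'m \<Rightarrow> (real^'n)^'k"
  assumes l: "l \<noteq> 0" and dim: "CARD('n) + 1 = CARD('k) + CARD('m)"
    and p: "polynomial_function p" and adm: "admissible p" and good: "no_zeros_over p (hyperplane l)"
    and e: "e > 0"
  obtains v where "norm (rank_one l v) < e" "finite (tilde_zeros (\<lambda>x. p x + rank_one l v))"
proof -
  define J where "J = (hyperplane_param l :: real^'n \<Rightarrow> (real^'k) \<times> (real^'m))"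
  note J = hyperplane_param[OF l dim, folded J_def]
  define f where "f = (\<lambda>z. lincomb (p (snd (J z))) (l + fst (J z)))"
  have "f differentiable (at z)" for z
    unfolding f_def by (rule polynomial_gnomonic_differentiable[OF p J(1)])
  then obtain f' where f': "\<And>z. (f has_derivative f' z) (at z)"
    unfolding differentiable_def by metis
  have contf: "continuous_on UNIV f"
    using f' has_derivative_continuous_on[of UNIV f f'] by (simp add: has_derivative_at_withinI)
  have neg: "negligible (f ` {z. \<not> inj (f' z)})"
    by (rule Sard_square[OF f']) simp
  obtain \<eta> where \<eta>: "\<eta> > 0" "\<And>c'. continuous_on (cball 0 1) c' \<Longrightarrow> (\<And>x. x \<in> cball 0 1 \<Longrightarrow> norm (c' x - p x) \<le> \<eta>) \<Longrightarrow>
       admissible c' \<and> no_zeros_over c' (hyperplane l) \<and> gnomonic_degree c' l = gnomonic_degree p l"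
    using gnomonic_degree_stable[OF l dim adm good] by metis
  \<comment> \<open>Chosen so that \<open>norm (rank_one l v) < min e \<eta>\<close>, given
    \<open>norm v = norm w / (l \<bullet> l)\<close>. The sign of \<open>v\<close> makes the
    perturbed expression \<open>f z - w\<close>.\<close>
  define \<epsilon> where "\<epsilon> = min e \<eta> * (l \<bullet> l) / norm l"
  have ll: "l \<bullet> l > 0" using l by simp
  have "\<epsilon> > 0" unfolding \<epsilon>_def using e \<eta>(1) ll l by simp
  then obtain w where w: "norm w < \<epsilon>" "w \<notin> f ` {z. \<not> inj (f' z)}"
    using small_vector_outside_negligible[OF neg] by blast
  define v where "v = - (1 / (l \<bullet> l)) *\<^sub>R w"
  have "norm (rank_one l v) = norm l * norm w / (l \<bullet> l)"
    using ll by (simp add: norm_rank_one v_def)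
  also have "\<dots> < norm l * \<epsilon> / (l \<bullet> l)"
    using w(1) ll l by (intro divide_strict_right_mono mult_strict_left_mono) auto
  also have "\<dots> = min e \<eta>" using ll l by (simp add: \<epsilon>_def)
  finally have small: "norm (rank_one l v) < e" "norm (rank_one l v) < \<eta>" by simp_all
  let ?q = "\<lambda>x. p x + rank_one l v"
  have q: "admissible ?q \<and> no_zeros_over ?q (hyperplane l) \<and> gnomonic_degree ?q l = gnomonic_degree p l"
  proof (rule \<eta>(2))
    show "continuous_on (cball 0 1) ?q"
      using p by (intro continuous_intros continuous_on_polymonial_function)
  qed (use small in simp)
  then have admq: "admissible ?q" and goodq: "no_zeros_over ?q (hyperplane l)" by auto
  have "continuous_on (cball 0 1) ?q" using admq by (simp add: admissible_def)
  then have "continuous_on ({0..1} \<times> cball 0 1) (\<lambda>r :: real \<times> (real^'m). ?q (snd r))"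
    by (rule continuous_on_compose2) (auto intro!: continuous_intros)
  then have C: "continuous_on ({0..1} \<times> cball 0 1) (\<lambda>(s :: real, x). ?q x)"
    by (simp add: split_def)
  have "\<exists>R. \<forall>z. gnomonic ?q l z = 0 \<longrightarrow> norm z < R"
  proof (rule gnomonic_zeros_bounded[OF l dim C])
    show "admissible ?q" "no_zeros_over ?q (hyperplane l)" by fact+
    fix R assume R: "R > 0" "\<And>s z. s \<in> {0..1::real} \<Longrightarrow> gnomonic ?q l z = 0 \<Longrightarrow> norm z < R"
    show "\<exists>R. \<forall>z. gnomonic ?q l z = 0 \<longrightarrow> norm z < R"
      using R(2)[of 0] by auto
  qed
  then obtain R where R: "\<And>z. gnomonic ?q l z = 0 \<Longrightarrow> norm z < R" by blast
  have lperp: "l \<bullet> fst (J z) = 0" for z using J(3) by blast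
  have tq: "tilde ?q (l + fst (J z), snd (J z)) = f z - w" for z
    using ll lperp[of z] by (simp add: tilde_lincomb lincomb_add lincomb_rank_one f_def v_def inner_add_right)
  define Z where "Z = {z. snd (J z) \<in> cball 0 1 \<and> f z = w}"
  have "Z \<subseteq> ball 0 R"
  proof
    fix z assume z: "z \<in> Z"
    then have "gnomonic ?q l z = 0"
      using tq[of z] by (simp add: Z_def gnomonic_def J_def[symmetric] clamp_ball_id)
    then show "z \<in> ball 0 R" using R by simp
  qed
  moreover have "closed Z"
  proof -
    have "continuous_on UNIV J" using J(1) by (simp add: linear_continuous_on linear_linear)
    then have "closed {z. snd (J z) \<in> cball 0 1}"
      by (intro closed_vimage[unfolded vimage_def] closed_cball continuous_intros)
    moreover have "closed {z. f z = w}"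
      using contf by (intro closed_Collect_eq continuous_on_const)
    ultimately show ?thesis unfolding Z_def by (intro closed_Collect_conj)
  qed
  ultimately have "compact Z"
    by (meson bounded_ball bounded_subset compact_eq_bounded_closed)
  moreover have "\<not> z islimpt Z" if "z \<in> Z" for z
  proof -
    have "inj (f' z)" using that w(2) by (auto simp: Z_def)
    then have "\<not> z islimpt {y. f y = f z}"
      by (rule nonzero_near_injective_derivative[OF f'])
    then show ?thesis using that islimpt_subset[of z Z "{y. f y = f z}"] by (auto simp: Z_def)
  qed
  ultimately have finZ: "finite Z"
    using finite_not_islimpt_in_compact[of Z Z] by simp
  \<comment> \<open>Back from the chart to the unit sphere; the sign selects one of two antipodal
    zeros.\<close>
  let ?\<phi> = "\<lambda>(\<epsilon> :: real, z). ((\<epsilon> / norm (l + fst (J z))) *\<^sub>R (l + fst (J z)), snd (J z))"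
  have "tilde_zeros ?q \<subseteq> ?\<phi> ` ({1, -1} \<times> Z)"
  proof
    fix y assume y: "y \<in> tilde_zeros ?q"
    obtain \<gamma> x where yx: "y = (\<gamma>, x)" by (metis prod.collapse)
    have \<gamma>: "norm \<gamma> = 1" "norm x \<le> 1" "tilde ?q (\<gamma>, x) = 0"
      using y yx by (auto simp: tilde_zeros_def)
    then have l\<gamma>: "l \<bullet> \<gamma> \<noteq> 0" using goodq by (fastforce simp: no_zeros_over_def)
    let ?\<mu> = "(l \<bullet> l) / (l \<bullet> \<gamma>)"
    have "(?\<mu> *\<^sub>R \<gamma> - l, x) \<in> range J"
      unfolding J(3) using l\<gamma> by (simp add: inner_diff_right)
    then obtain z where z: "J z = (?\<mu> *\<^sub>R \<gamma> - l, x)" by (metis rangeE)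
    have "tilde ?q (?\<mu> *\<^sub>R \<gamma>, x) = 0" using \<gamma>(3) by (simp only: tilde_scaleR scaleR_zero_right)
    then have "z \<in> Z" using tq[of z] z \<gamma>(2) by (simp add: Z_def)
    moreover have "y = ?\<phi> (sgn ?\<mu>, z)"
    proof -
      have "sgn m / \<bar>m\<bar> * m = 1" if "m \<noteq> 0" for m :: real
        using that by (simp add: sgn_real_def)
      then have "sgn ?\<mu> / \<bar>?\<mu>\<bar> * ?\<mu> = 1" using l\<gamma> ll by (metis divide_eq_0_iff less_irrefl)
      then have "(sgn ?\<mu> / norm (?\<mu> *\<^sub>R \<gamma>)) *\<^sub>R (?\<mu> *\<^sub>R \<gamma>) = \<gamma>"
        using \<gamma>(1) by (simp only: norm_scaleR scaleR_scaleR mult_1_right scaleR_one)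
      moreover have "l + fst (J z) = ?\<mu> *\<^sub>R \<gamma>" using z by simp
      ultimately show ?thesis unfolding yx split_conv using z by (simp only: snd_conv)
    qed
    moreover have "sgn ?\<mu> \<in> {1, -1}" using l\<gamma> ll by (auto simp: sgn_real_def)
    ultimately show "y \<in> ?\<phi> ` ({1, -1} \<times> Z)" by blast
  qed
  then have "finite (tilde_zeros ?q)"
    by (rule finite_subset) (use finZ in simp)
  then show ?thesis using that small(1) by blast
qed

section \<open>Invariance of the parity\<close>

lemma norm_le_columns:
  fixes A :: "(real^'n)^'k" and r :: real
  assumes "\<And>i. norm (A $ i) \<le> r"
  shows "norm A \<le> CARD('k) * r"
proof -
  have "norm A \<le> (\<Sum>i\<in>UNIV. norm (A $ i))"
    unfolding norm_vec_def[of A] by (rule L2_set_le_sum) simp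
  also have "\<dots> \<le> (\<Sum>i\<in>(UNIV :: 'k set). r)"
    by (rule sum_mono) (rule assms)
  finally show ?thesis by simp
qed

lemma continuous_on_polynomial_add:
  fixes p :: "real^'m \<Rightarrow> (real^'n)^'k"
  shows "polynomial_function p \<Longrightarrow> continuous_on S (\<lambda>x. p x + v)"
  by (intro continuous_intros continuous_on_polymonial_function)

text \<open>A perturbation too small to alter either degree makes the zeros finite in number. A
  single half of them then computes the parity for both poles, because any half will do for
  each.\<close>

lemma gnomonic_degree_indep:
  fixes c :: "real^'m \<Rightarrow> (real^'n)^'k"
  assumes dim: "CARD('n) + 1 = CARD('k) + CARD('m)" and k: "CARD('k) \<ge> 2" and adm: "admissible c"
    and l: "l \<noteq> 0" "no_zeros_over c (hyperplane l)" and l': "l' \<noteq> 0" "no_zeros_over c (hyperplane l')"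
  shows "odd (gnomonic_degree c l) \<longleftrightarrow> odd (gnomonic_degree c l')"
proof -
  obtain \<eta> where \<eta>: "\<eta> > 0" "\<And>c'. continuous_on (cball 0 1) c' \<Longrightarrow> (\<And>x. x \<in> cball 0 1 \<Longrightarrow> norm (c' x - c x) \<le> \<eta>) \<Longrightarrow>
       admissible c' \<and> no_zeros_over c' (hyperplane l) \<and> gnomonic_degree c' l = gnomonic_degree c l"
    using gnomonic_degree_stable[OF l(1) dim adm l(2)] by metis
  obtain \<eta>' where \<eta>': "\<eta>' > 0" "\<And>c'. continuous_on (cball 0 1) c' \<Longrightarrow> (\<And>x. x \<in> cball 0 1 \<Longrightarrow> norm (c' x - c x) \<le> \<eta>') \<Longrightarrow>
       admissible c' \<and> no_zeros_over c' (hyperplane l') \<and> gnomonic_degree c' l' = gnomonic_degree c l'"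
    using gnomonic_degree_stable[OF l'(1) dim adm l'(2)] by metis
  define e where "e = min \<eta> \<eta>'"
  have e: "e > 0" "e \<le> \<eta>" "e \<le> \<eta>'" using \<eta>(1) \<eta>'(1) by (auto simp: e_def)
  have near: "admissible q \<and> no_zeros_over q (hyperplane l) \<and> no_zeros_over q (hyperplane l') \<and>
      gnomonic_degree q l = gnomonic_degree c l \<and> gnomonic_degree q l' = gnomonic_degree c l'"
    if "continuous_on (cball 0 1) q" "\<And>x. x \<in> cball 0 1 \<Longrightarrow> norm (q x - c x) < e" for q
  proof -
    have "\<And>x. x \<in> cball 0 1 \<Longrightarrow> norm (q x - c x) \<le> \<eta>" "\<And>x. x \<in> cball 0 1 \<Longrightarrow> norm (q x - c x) \<le> \<eta>'"
      using that(2) e(2,3) by (meson less_imp_le order_trans)+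
    then show ?thesis using \<eta>(2)[OF that(1)] \<eta>'(2)[OF that(1)] by blast
  qed
  have "continuous_on (cball 0 1) c" using adm by (simp add: admissible_def)
  then obtain p where p: "polynomial_function p" "\<And>x. x \<in> cball 0 1 \<Longrightarrow> norm (p x - c x) < e/2"
    using polynomial_approximation[of c "e/2"] e(1) by auto
  have "admissible p \<and> no_zeros_over p (hyperplane l)"
    using near[of p] p(2) e(1) continuous_on_polymonial_function[OF p(1)] by fastforce
  then obtain v where v: "norm (rank_one l v) < e/2" "finite (tilde_zeros (\<lambda>x. p x + rank_one l v))"
    using finite_zeros_perturbation[OF l(1) dim p(1), of "e/2"] e(1) by auto
  let ?q = "\<lambda>x. p x + rank_one l v"
  have q: "admissible ?q \<and> no_zeros_over ?q (hyperplane l) \<and> no_zeros_over ?q (hyperplane l') \<and>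
      gnomonic_degree ?q l = gnomonic_degree c l \<and> gnomonic_degree ?q l' = gnomonic_degree c l'"
  proof (rule near)
    show "continuous_on (cball 0 1) ?q" by (rule continuous_on_polynomial_add[OF p(1)])
    show "norm (?q x - c x) < e" if "x \<in> cball 0 1" for x
      using norm_triangle_ineq[of "p x - c x" "rank_one l v"] p(2)[OF that] v(1) by (simp add: algebra_simps)
  qed
  define P where "P = {r \<in> tilde_zeros ?q. l \<bullet> fst r > 0}"
  have "half_of_zeros ?q P"
    unfolding half_of_zeros_def
  proof (intro conjI ballI)
    fix r assume r: "r \<in> tilde_zeros ?q"
    obtain \<gamma> x where rx: "r = (\<gamma>, x)" by (metis prod.collapse)
    have \<gamma>: "norm \<gamma> = 1" "norm x \<le> 1" "tilde ?q (\<gamma>, x) = 0" using r rx by (auto simp: tilde_zeros_def)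
    then have "l \<bullet> \<gamma> \<noteq> 0" using q by (fastforce simp: no_zeros_over_def)
    moreover have "tilde ?q ((-1) *\<^sub>R \<gamma>, x) = 0" using \<gamma>(3) by (simp only: tilde_scaleR scaleR_zero_right)
    ultimately show "case r of (\<gamma>, x) \<Rightarrow> ((\<gamma>, x) \<in> P) \<noteq> ((- \<gamma>, x) \<in> P)"
      using \<gamma> rx by (auto simp: P_def tilde_zeros_def)
  qed (auto simp: P_def)
  then show ?thesis
    using gnomonic_degree_parity[OF l(1) dim k _ _ v(2)] gnomonic_degree_parity[OF l'(1) dim k _ _ v(2)] q by metis
qed

section \<open>Clearing the equator of a coordinate axis\<close>

definition supported_on :: "'k set \<Rightarrow> (real^'k) set" where
  "supported_on I = {\<gamma>. \<forall>i. i \<notin> I \<longrightarrow> \<gamma> $ i = 0}"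

lemma hyperplane_axis: "hyperplane (axis j 1) = supported_on (UNIV - {j})"
  by (auto simp: supported_on_def inner_axis')

lemma subspace_supported_on: "subspace (supported_on I)"
  by (auto simp: subspace_def supported_on_def)

text \<open>A rank-one matrix along axis \<open>j\<close> does nothing over
  \<open>\<gamma> $ j = 0\<close>, so what was achieved for \<open>I\<close> survives exactly. Zeros
  with \<open>\<gamma> $ j \<noteq> 0\<close> are scaled to \<open>\<gamma> $ j = 1\<close>, where
  the parameters have dimension \<open>card I + m < n\<close>; their image is negligible and misses
  some small \<open>w\<close>.\<close>

lemma support_perturbation:
  fixes p :: "real^'m \<Rightarrow> (real^'n)^'k"
  assumes dim: "CARD('n) + 1 = CARD('k) + CARD('m)" and p: "polynomial_function p"
    and "finite I" "card I < CARD('k)" "e > 0"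
  shows "\<exists>v. norm v < e \<and> no_zeros_over (\<lambda>x. p x + v) (supported_on I)"
  using assms(3-5)
proof (induction I arbitrary: e rule: finite_induct)
  case empty
  have "no_zeros_over (\<lambda>x. p x + 0) (supported_on {})"
    by (auto simp: no_zeros_over_def supported_on_def vec_eq_iff)
  then show ?case using empty by (intro exI[of _ 0]) simp
next
  case (insert j I)
  then obtain v where v: "norm v < e/2" "no_zeros_over (\<lambda>x. p x + v) (supported_on I)"
    by (metis card_insert_disjoint Suc_lessD half_gt_zero)
  let ?l = "axis j 1 :: real^'k"
  have l: "?l \<noteq> 0" by (simp add: axis_eq_0_iff)
  define J where "J = (hyperplane_param ?l :: real^'n \<Rightarrow> (real^'k) \<times> (real^'m))"
  note J = hyperplane_param[OF l dim, folded J_def]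
  define q where "q = (\<lambda>x. p x + v)"
  have q: "polynomial_function q" unfolding q_def using p by (intro polynomial_function_add) auto
  define f where "f = (\<lambda>z. lincomb (q (snd (J z))) (?l + fst (J z)))"
  define T where "T = {z. fst (J z) \<in> supported_on I}"
  have "linear (\<lambda>z. fst (J z))" using linear_compose[OF J(1) linear_fst] by (simp add: o_def)
  then have subT: "subspace T"
    unfolding T_def using linear_subspace_vimage[OF _ subspace_supported_on, of "\<lambda>z. fst (J z)" I] by (simp add: vimage_def)
  \<comment> \<open>As \<open>card (insert j I) < CARD('k)\<close>, a coordinate \<open>i\<close> is
    left over, and its axis is a direction of the chart not in \<open>T\<close>.\<close>
  have "T \<noteq> UNIV"
  proof -
    have "card (insert j I) < card (UNIV :: 'k set)" using insert by simp
    then have "insert j I \<noteq> UNIV" by (metis less_irrefl)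
    then obtain i where i: "i \<notin> insert j I" by blast
    have "(axis i 1, 0) \<in> range J"
      unfolding J(3) using i by (auto simp: inner_axis_axis)
    then obtain z where "J z = (axis i 1, 0)" by (metis rangeE)
    then have "z \<notin> T" using i by (auto simp: T_def supported_on_def)
    then show ?thesis by blast
  qed
  then have "dim T \<noteq> DIM(real^'n)"
    using subT by (metis dim_eq_full span_eq_iff)
  then have "dim T < DIM(real^'n)"
    using dim_subset_UNIV[of T] by linarith
  then have "negligible T" by (rule negligible_lowdim)
  moreover have "f differentiable_on T"
    unfolding f_def differentiable_on_def
    using polynomial_gnomonic_differentiable[OF q J(1)] differentiable_at_withinI by blast
  ultimately have "negligible (f ` T)"
    by (intro negligible_differentiable_image_negligible) auto
  then obtain w where w: "norm w < e/2" "w \<notin> f ` T"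
    using small_vector_outside_negligible[of "f ` T" "e/2"] insert.prems by auto
  let ?v = "v + rank_one ?l (- w)"
  have "norm ?v < e"
    using norm_triangle_ineq[of v "rank_one ?l (- w)"] v(1) w(1) by (simp add: norm_rank_one)
  moreover have "no_zeros_over (\<lambda>x. p x + ?v) (supported_on (insert j I))"
    unfolding no_zeros_over_def
  proof (intro ballI impI notI)
    fix \<gamma> x assume \<gamma>: "\<gamma> \<in> supported_on (insert j I)" "\<gamma> \<noteq> 0" and x: "x \<in> cball (0::real^'m) 1"
      and 0: "tilde (\<lambda>x. p x + ?v) (\<gamma>, x) = 0"
    have eq: "tilde (\<lambda>x. p x + ?v) (\<gamma>', x) = lincomb (q x) \<gamma>' - (\<gamma>' $ j) *\<^sub>R w" for \<gamma>'
      by (simp add: tilde_lincomb lincomb_add lincomb_rank_one q_def inner_axis')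
    show False
    proof (cases "\<gamma> $ j = 0")
      case True
      then have "\<gamma> \<in> supported_on I" using \<gamma>(1) by (auto simp: supported_on_def)
      moreover have "tilde (\<lambda>x. p x + v) (\<gamma>, x) = 0"
        using 0 eq[of \<gamma>] True by (simp add: tilde_lincomb q_def)
      ultimately show False using v(2) \<gamma>(2) x unfolding no_zeros_over_def by blast
    next
      case False
      let ?u = "(1 / \<gamma> $ j) *\<^sub>R \<gamma> - ?l"
      have "(?u, x) \<in> range J" unfolding J(3) using False by (simp add: inner_axis' )
      then obtain z where z: "J z = (?u, x)" by (metis rangeE)
      have "?u \<in> supported_on I"
        using \<gamma>(1) False by (auto simp: supported_on_def axis_def)
      then have "z \<in> T" using z by (simp add: T_def)
      moreover have "f z = w"
      proof -
        have "tilde (\<lambda>x. p x + ?v) ((1 / \<gamma> $ j) *\<^sub>R \<gamma>, x) = 0"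
          using 0 by (simp only: tilde_scaleR scaleR_zero_right)
        then show ?thesis using eq[of "(1 / \<gamma> $ j) *\<^sub>R \<gamma>"] False z by (simp add: f_def)
      qed
      ultimately show False using w(2) by blast
    qed
  qed
  ultimately show ?case by blast
qed

lemma hyperplane_perturbation:
  fixes p :: "real^'m \<Rightarrow> (real^'n)^'k"
  assumes dim: "CARD('n) + 1 = CARD('k) + CARD('m)" and p: "polynomial_function p" and e: "e > 0"
  obtains v where "norm v < e" "no_zeros_over (\<lambda>x. p x + v) (hyperplane (axis j 1))"
proof -
  have "card (UNIV - {j}) < CARD('k)" by (intro psubset_card_mono) auto
  then show ?thesis
    using support_perturbation[OF dim p _ _ e, of "UNIV - {j}"] that by (auto simp: hyperplane_axis)
qed

text \<open>The path adds matrices \<open>rank_one (axis j 1) _\<close>, invisible over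
  \<open>\<gamma> $ j = 0\<close>: the equator stays clear however far \<open>q\<close> and
  \<open>r\<close> are apart inside the ball. On the boundary sphere the path is covered by the
  hypothesis.\<close>

lemma gnomonic_parity_column_exchange:
  fixes q r :: "real^'m \<Rightarrow> (real^'n)^'k"
  assumes dim: "CARD('n) + 1 = CARD('k) + CARD('m)"
    and q: "continuous_on (cball 0 1) q" "no_zeros_over q (hyperplane (axis j 1))"
    and r: "continuous_on (cball 0 1) r"
    and nv: "\<And>x s. x \<in> sphere 0 1 \<Longrightarrow> 0 \<le> s \<Longrightarrow> s \<le> 1 \<Longrightarrow>
        nonvanishing (q x + s *\<^sub>R rank_one (axis j 1) ((r x - q x) $ j)) UNIV"
  defines "q' \<equiv> \<lambda>x. q x + rank_one (axis j 1) ((r x - q x) $ j)"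
  shows "admissible q'" "no_zeros_over q' (hyperplane (axis j 1))"
    "gnomonic_degree q' (axis j 1) = gnomonic_degree q (axis j 1)"
proof -
  let ?l = "axis j 1 :: real^'k"
  have l: "?l \<noteq> 0" by (simp add: axis_eq_0_iff)
  let ?C = "\<lambda>s x. q x + s *\<^sub>R rank_one ?l ((r x - q x) $ j)"
  have "continuous_on ({0..1} \<times> cball 0 1) (\<lambda>p :: real \<times> (real^'m). q (snd p))"
       "continuous_on ({0..1} \<times> cball 0 1) (\<lambda>p :: real \<times> (real^'m). r (snd p))"
    by (rule continuous_on_compose2[OF q(1)] continuous_on_compose2[OF r]; auto intro!: continuous_intros)+
  then have C: "continuous_on ({0..1} \<times> cball 0 1) (\<lambda>(s, x). ?C s x)"
    unfolding split_def rank_one_def by (intro continuous_intros)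
  have adm: "admissible (?C s)" if "s \<in> {0..1}" for s
    unfolding admissible_iff
  proof
    show "continuous_on (cball 0 1) (?C s)"
      unfolding rank_one_def by (intro continuous_intros q r)
    show "\<forall>x\<in>sphere 0 1. nonvanishing (?C s x) UNIV" using nv that by simp
  qed
  have "lincomb (?C s x) \<gamma> = lincomb (q x) \<gamma>" if "\<gamma> \<in> hyperplane ?l" for s x \<gamma>
  proof -
    have "?C s x = q x + rank_one ?l (s *\<^sub>R ((r x - q x) $ j))"
      by (simp add: rank_one_def vec_eq_iff mult.left_commute)
    then show ?thesis using that by (simp add: lincomb_add lincomb_rank_one)
  qed
  then have good: "no_zeros_over (?C s) (hyperplane ?l)" for s
    using q(2) unfolding no_zeros_over_def tilde_lincomb by simp
  show "admissible q'" "no_zeros_over q' (hyperplane ?l)"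
    using adm[of 1] good[of 1] by (simp_all add: q'_def)
  show "gnomonic_degree q' ?l = gnomonic_degree q ?l"
    using gnomonic_degree_homotopy[OF l dim C adm good] by (simp add: q'_def)
qed

lemma rank_one_axis: "rank_one (axis j 1) w $ i = (if i = j then w else 0)"
  by (simp add: rank_one_def axis_def)

lemma polynomial_function_column_exchange:
  fixes q r :: "real^'m \<Rightarrow> (real^'n)^'k"
  assumes "polynomial_function q" "polynomial_function r"
  shows "polynomial_function (\<lambda>x. q x + rank_one (axis j 1) ((r x - q x) $ j))"
proof -
  have "linear (\<lambda>A :: (real^'n)^'k. rank_one (axis j 1 :: real^'k) (A $ j))"
    by (intro linearI) (simp_all add: vec_eq_iff rank_one_axis)
  then have "polynomial_function (\<lambda>A :: (real^'n)^'k. rank_one (axis j 1 :: real^'k) (A $ j))"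
    by (simp add: polynomial_function_bounded_linear linear_linear)
  from polynomial_function_compose[OF polynomial_function_diff[OF assms(2,1)] this]
  show ?thesis using assms(1) by (intro polynomial_function_add) (simp_all add: o_def)
qed

text \<open>\<open>c\<^sub>0\<close> and \<open>c\<^sub>1\<close> are close on the boundary sphere
  only. Before each exchange a small perturbation clears the equator of the column concerned, and
  \<open>gnomonic_degree_indep\<close> permits the change of pole.\<close>

lemma gnomonic_parity_near:
  fixes c\<^sub>0 c\<^sub>1 g :: "real^'m \<Rightarrow> (real^'n)^'k"
  assumes dim: "CARD('n) + 1 = CARD('k) + CARD('m)" and k: "CARD('k) \<ge> 2"
    and c\<^sub>0: "admissible c\<^sub>0" "l\<^sub>0 \<noteq> 0" "no_zeros_over c\<^sub>0 (hyperplane l\<^sub>0)"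
    and c\<^sub>1: "admissible c\<^sub>1" "l\<^sub>1 \<noteq> 0" "no_zeros_over c\<^sub>1 (hyperplane l\<^sub>1)"
    and \<eta>: "\<eta> > 0" and nv: "\<And>x A. x \<in> sphere 0 1 \<Longrightarrow> (\<And>i. norm (A $ i - g x $ i) \<le> \<eta>) \<Longrightarrow> nonvanishing A UNIV"
    and near: "\<And>x. x \<in> sphere 0 1 \<Longrightarrow> norm (c\<^sub>0 x - g x) \<le> \<eta>/2" "\<And>x. x \<in> sphere 0 1 \<Longrightarrow> norm (c\<^sub>1 x - g x) \<le> \<eta>/2"
  shows "odd (gnomonic_degree c\<^sub>0 l\<^sub>0) \<longleftrightarrow> odd (gnomonic_degree c\<^sub>1 l\<^sub>1)"
proof -
  obtain \<eta>\<^sub>0 where \<eta>\<^sub>0: "\<eta>\<^sub>0 > 0" "\<And>c'. continuous_on (cball 0 1) c' \<Longrightarrow> (\<And>x. x \<in> cball 0 1 \<Longrightarrow> norm (c' x - c\<^sub>0 x) \<le> \<eta>\<^sub>0) \<Longrightarrow>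
       admissible c' \<and> no_zeros_over c' (hyperplane l\<^sub>0) \<and> gnomonic_degree c' l\<^sub>0 = gnomonic_degree c\<^sub>0 l\<^sub>0"
    using gnomonic_degree_stable[OF c\<^sub>0(2) dim c\<^sub>0(1,3)] by metis
  obtain \<eta>\<^sub>1 where \<eta>\<^sub>1: "\<eta>\<^sub>1 > 0" "\<And>c'. continuous_on (cball 0 1) c' \<Longrightarrow> (\<And>x. x \<in> cball 0 1 \<Longrightarrow> norm (c' x - c\<^sub>1 x) \<le> \<eta>\<^sub>1) \<Longrightarrow>
       admissible c' \<and> no_zeros_over c' (hyperplane l\<^sub>1) \<and> gnomonic_degree c' l\<^sub>1 = gnomonic_degree c\<^sub>1 l\<^sub>1"
    using gnomonic_degree_stable[OF c\<^sub>1(2) dim c\<^sub>1(1,3)] by metis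
  \<comment> \<open>In turn: approximating \<open>c\<^sub>0\<close> keeps its degree; two errors in
    each of the \<open>k\<close> columns stay within \<open>\<eta>\<^sub>1\<close>; two errors on
    top of \<open>\<eta>/2\<close> stay within \<open>\<eta>\<close> on the sphere.\<close>
  define \<epsilon> where "\<epsilon> = min (min \<eta>\<^sub>0 (\<eta>\<^sub>1 / (2 * CARD('k)))) (\<eta>/4)"
  have \<epsilon>: "\<epsilon> > 0" "\<epsilon> \<le> \<eta>\<^sub>0" "\<epsilon> \<le> \<eta>\<^sub>1 / (2 * CARD('k))" "\<epsilon> \<le> \<eta>/4"
    unfolding \<epsilon>_def using \<eta>\<^sub>0(1) \<eta>\<^sub>1(1) \<eta> by (simp, linarith, linarith, linarith)
  have cont: "continuous_on (cball 0 1) c\<^sub>0" "continuous_on (cball 0 1) c\<^sub>1"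
    using c\<^sub>0(1) c\<^sub>1(1) by (simp_all add: admissible_def)
  obtain p\<^sub>0 where p\<^sub>0: "polynomial_function p\<^sub>0" "\<And>x. x \<in> cball 0 1 \<Longrightarrow> norm (p\<^sub>0 x - c\<^sub>0 x) < \<epsilon>"
    using polynomial_approximation[OF cont(1) \<epsilon>(1)] by blast
  obtain p\<^sub>1 where p\<^sub>1: "polynomial_function p\<^sub>1" "\<And>x. x \<in> cball 0 1 \<Longrightarrow> norm (p\<^sub>1 x - c\<^sub>1 x) < \<epsilon>"
    using polynomial_approximation[OF cont(2) \<epsilon>(1)] by blast
  \<comment> \<open>The intermediate targets: columns in \<open>I\<close> already come from
    \<open>p\<^sub>1\<close>, the others still from \<open>p\<^sub>0\<close>.\<close>
  define t where "t = (\<lambda>I x i. if i \<in> I then p\<^sub>1 x $ i else p\<^sub>0 x $ i)"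
  have tg: "norm (t I x i - g x $ i) \<le> \<epsilon> + \<eta>/2" if x: "x \<in> sphere 0 1" for I x i
  proof -
    have "norm (p x $ i - g x $ i) \<le> \<epsilon> + \<eta>/2"
      if "norm (p x - c x) < \<epsilon>" "norm (c x - g x) \<le> \<eta>/2" for p c :: "real^'m \<Rightarrow> (real^'n)^'k"
    proof -
      have "norm (p x - g x) \<le> \<epsilon> + \<eta>/2"
        using norm_triangle_ineq[of "p x - c x" "c x - g x"] that by simp
      then show ?thesis
        using Finite_Cartesian_Product.norm_nth_le[of "p x - g x" i] by simp
    qed
    then show ?thesis
      using p\<^sub>0(2)[of x] p\<^sub>1(2)[of x] near x by (simp add: t_def)
  qed
  \<comment> \<open>The tolerance \<open>e\<close> is left free so that the induction hypothesis can
    be used at \<open>e/2\<close>; the other half goes to the perturbation \<open>v\<close>.\<close>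
  have main: "\<exists>q l. polynomial_function q \<and> l \<noteq> 0 \<and> admissible q \<and> no_zeros_over q (hyperplane l) \<and>
      (odd (gnomonic_degree q l) \<longleftrightarrow> odd (gnomonic_degree c\<^sub>0 l\<^sub>0)) \<and>
      (\<forall>x\<in>cball 0 1. \<forall>i. norm (q x $ i - t I x i) < e)"
    if "finite I" "0 < e" "e \<le> \<epsilon>" for I e
    using that
  proof (induction I arbitrary: e rule: finite_induct)
    case empty
    have "admissible p\<^sub>0 \<and> no_zeros_over p\<^sub>0 (hyperplane l\<^sub>0) \<and> gnomonic_degree p\<^sub>0 l\<^sub>0 = gnomonic_degree c\<^sub>0 l\<^sub>0"
      using p\<^sub>0(2) \<epsilon>(2) by (intro \<eta>\<^sub>0(2) continuous_on_polymonial_function p\<^sub>0(1)) (meson less_imp_le order_trans)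
    then show ?case using c\<^sub>0(2) p\<^sub>0(1) empty by (intro exI[of _ p\<^sub>0] exI[of _ l\<^sub>0]) (simp add: t_def)
  next
    case (insert j I)
    let ?l = "axis j 1 :: real^'k"
    have l: "?l \<noteq> 0" by (simp add: axis_eq_0_iff)
    have "0 < e/2" "e/2 \<le> \<epsilon>" using insert.prems by auto
    from insert.IH[OF this] obtain q l' where q: "polynomial_function q" "l' \<noteq> 0" "admissible q"
        "no_zeros_over q (hyperplane l')" "odd (gnomonic_degree q l') \<longleftrightarrow> odd (gnomonic_degree c\<^sub>0 l\<^sub>0)"
        "\<And>x i. x \<in> cball 0 1 \<Longrightarrow> norm (q x $ i - t I x i) < e/2"
      by blast
    obtain \<eta>\<^sub>q where \<eta>\<^sub>q: "\<eta>\<^sub>q > 0" "\<And>c'. continuous_on (cball 0 1) c' \<Longrightarrow> (\<And>x. x \<in> cball 0 1 \<Longrightarrow> norm (c' x - q x) \<le> \<eta>\<^sub>q) \<Longrightarrow>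
         admissible c' \<and> no_zeros_over c' (hyperplane l') \<and> gnomonic_degree c' l' = gnomonic_degree q l'"
      using gnomonic_degree_stable[OF q(2) dim q(3,4)] by metis
    have "min (e/2) \<eta>\<^sub>q > 0" using \<eta>\<^sub>q(1) insert.prems by simp
    then obtain v where v: "norm v < min (e/2) \<eta>\<^sub>q" "no_zeros_over (\<lambda>x. q x + v) (hyperplane ?l)"
      using hyperplane_perturbation[OF dim q(1)] by blast
    define q\<^sub>1 where "q\<^sub>1 = (\<lambda>x. q x + v)"
    have q\<^sub>1p: "polynomial_function q\<^sub>1" unfolding q\<^sub>1_def using q(1) by (intro polynomial_function_add) auto
    then have q\<^sub>1c: "continuous_on (cball 0 1) q\<^sub>1" by (rule continuous_on_polymonial_function)
    have q\<^sub>1: "admissible q\<^sub>1 \<and> no_zeros_over q\<^sub>1 (hyperplane l') \<and> gnomonic_degree q\<^sub>1 l' = gnomonic_degree q l'"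
      using v(1) by (intro \<eta>\<^sub>q(2) q\<^sub>1c) (simp add: q\<^sub>1_def)
    have q\<^sub>1g: "no_zeros_over q\<^sub>1 (hyperplane ?l)" using v(2) by (simp add: q\<^sub>1_def)
    have q\<^sub>1t: "norm (q\<^sub>1 x $ i - t I x i) < e" if "x \<in> cball 0 1" for x i
    proof -
      have vi: "norm (v $ i) < e/2" using v(1) Finite_Cartesian_Product.norm_nth_le[of v i] by simp
      have eq: "q\<^sub>1 x $ i - t I x i = (q x $ i - t I x i) + v $ i" by (simp add: q\<^sub>1_def)
      show ?thesis
        unfolding eq using norm_triangle_ineq[of "q x $ i - t I x i" "v $ i"] q(6)[OF that, of i] vi by linarith
    qed
    have nv': "nonvanishing (q\<^sub>1 x + s *\<^sub>R rank_one ?l ((p\<^sub>1 x - q\<^sub>1 x) $ j)) UNIV"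
      if x: "x \<in> sphere 0 1" and s: "0 \<le> s" "s \<le> 1" for x s
    proof (rule nv[OF x])
      \<comment> \<open>The error on the sphere is at most \<open>e + \<epsilon> + \<eta>/2\<close>
        with \<open>e \<le> \<epsilon> \<le> \<eta>/4\<close>; column \<open>j\<close> moves on a
        segment between two points within \<open>\<eta>\<close>.\<close>
      fix i
      have q\<^sub>1x: "norm (q\<^sub>1 x $ i - g x $ i) \<le> \<eta>"
        using norm_triangle_ineq[of "q\<^sub>1 x $ i - t I x i" "t I x i - g x $ i"] q\<^sub>1t[of x i] tg[OF x, of I i] x
          insert.prems(2) \<epsilon>(4) by simp
      have p\<^sub>1x: "norm (p\<^sub>1 x $ i - g x $ i) \<le> \<eta>"
        using tg[OF x, of UNIV i] \<epsilon>(4) \<eta> by (simp add: t_def)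
      show "norm ((q\<^sub>1 x + s *\<^sub>R rank_one ?l ((p\<^sub>1 x - q\<^sub>1 x) $ j)) $ i - g x $ i) \<le> \<eta>"
      proof (cases "i = j")
        case True
        have "(q\<^sub>1 x + s *\<^sub>R rank_one ?l ((p\<^sub>1 x - q\<^sub>1 x) $ j)) $ i - g x $ i =
            (1 - s) *\<^sub>R (q\<^sub>1 x $ i - g x $ i) + s *\<^sub>R (p\<^sub>1 x $ i - g x $ i)"
          using True by (simp add: rank_one_axis algebra_simps)
        also have "norm \<dots> \<le> (1 - s) * norm (q\<^sub>1 x $ i - g x $ i) + s * norm (p\<^sub>1 x $ i - g x $ i)"
          using s by (intro order_trans[OF norm_triangle_ineq]) simp
        also have "\<dots> \<le> (1 - s) * \<eta> + s * \<eta>"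
          using s q\<^sub>1x p\<^sub>1x by (intro add_mono mult_left_mono) auto
        finally show ?thesis by (simp add: algebra_simps)
      qed (use q\<^sub>1x in \<open>simp add: rank_one_axis\<close>)
    qed
    define q\<^sub>2 where "q\<^sub>2 = (\<lambda>x. q\<^sub>1 x + rank_one ?l ((p\<^sub>1 x - q\<^sub>1 x) $ j))"
    note ex = gnomonic_parity_column_exchange[OF dim q\<^sub>1c q\<^sub>1g continuous_on_polymonial_function[OF p\<^sub>1(1)] nv', folded q\<^sub>2_def]
    have "polynomial_function q\<^sub>2"
      unfolding q\<^sub>2_def by (rule polynomial_function_column_exchange[OF q\<^sub>1p p\<^sub>1(1)])
    moreover have "odd (gnomonic_degree q\<^sub>2 ?l) \<longleftrightarrow> odd (gnomonic_degree c\<^sub>0 l\<^sub>0)"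
      using ex(3) gnomonic_degree_indep[OF dim k _ l q\<^sub>1g q(2)] q\<^sub>1 q(5) by metis
    moreover have "norm (q\<^sub>2 x $ i - t (insert j I) x i) < e" if "x \<in> cball 0 1" for x i
      using q\<^sub>1t[OF that, of i] insert.prems(1) by (cases "i = j") (simp_all add: q\<^sub>2_def rank_one_axis t_def)
    ultimately show ?case using l ex(1,2) by blast
  qed
  obtain q l where q: "polynomial_function q" "l \<noteq> 0" "admissible q" "no_zeros_over q (hyperplane l)"
      "odd (gnomonic_degree q l) \<longleftrightarrow> odd (gnomonic_degree c\<^sub>0 l\<^sub>0)"
      "\<And>x i. x \<in> cball 0 1 \<Longrightarrow> norm (q x $ i - t UNIV x i) < \<epsilon>"
    using main[OF finite_class.finite_UNIV \<epsilon>(1) order_refl] by blast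
  have "admissible q \<and> no_zeros_over q (hyperplane l\<^sub>1) \<and> gnomonic_degree q l\<^sub>1 = gnomonic_degree c\<^sub>1 l\<^sub>1"
  proof (intro \<eta>\<^sub>1(2) continuous_on_polymonial_function q(1))
    fix x assume x: "x \<in> cball (0::real^'m) 1"
    have "norm ((q x - c\<^sub>1 x) $ i) \<le> \<epsilon> + \<epsilon>" for i
      using norm_triangle_ineq[of "q x $ i - p\<^sub>1 x $ i" "(p\<^sub>1 x - c\<^sub>1 x) $ i"] q(6)[OF x, of i] p\<^sub>1(2)[OF x]
        Finite_Cartesian_Product.norm_nth_le[of "p\<^sub>1 x - c\<^sub>1 x" i] by (simp add: t_def)
    then have "norm (q x - c\<^sub>1 x) \<le> CARD('k) * (\<epsilon> + \<epsilon>)" by (rule norm_le_columns)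
    also have "\<dots> \<le> \<eta>\<^sub>1" using \<epsilon>(3) by (simp add: field_simps)
    finally show "norm (q x - c\<^sub>1 x) \<le> \<eta>\<^sub>1" .
  qed
  then show ?thesis
    using q(5) gnomonic_degree_indep[OF dim k q(3) q(2,4) c\<^sub>1(2)] by metis
qed

text \<open>The Tietze extension may degenerate inside the ball, which \<open>admissible\<close>
  permits. Its polynomial approximation is perturbed to clear one coordinate equator; both changes
  remain within the tolerance on the sphere.\<close>

lemma admissible_extension:
  fixes g :: "real^'m \<Rightarrow> (real^'n)^'k"
  assumes dim: "CARD('n) + 1 = CARD('k) + CARD('m)" and g: "continuous_on (sphere 0 1) g"
    and nv: "\<And>x. x \<in> sphere 0 1 \<Longrightarrow> nonvanishing (g x) UNIV" and e: "e > 0"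
  obtains c l where "l \<noteq> 0" "admissible c" "no_zeros_over c (hyperplane l)"
    "\<And>x. x \<in> sphere 0 1 \<Longrightarrow> norm (c x - g x) \<le> e"
proof -
  have "closedin (top_of_set (cball 0 1)) (sphere (0::real^'m) 1)"
    by (rule closed_subset) auto
  then obtain G where G: "continuous_on (cball 0 1) G" "\<And>x. x \<in> sphere 0 1 \<Longrightarrow> G x = g x"
    using Tietze_unbounded[OF g] by metis
  obtain \<eta> where \<eta>: "\<eta> > 0" "\<And>x A. x \<in> sphere 0 1 \<Longrightarrow> norm (A - g x) \<le> \<eta> \<Longrightarrow> nonvanishing A UNIV"
    using nonvanishing_stable[OF compact_sphere g subspace_UNIV nv] by blast
  define \<epsilon> where "\<epsilon> = min e \<eta> / 2"
  have \<epsilon>: "\<epsilon> > 0" "2 * \<epsilon> \<le> e" "2 * \<epsilon> \<le> \<eta>" using e \<eta>(1) by (auto simp: \<epsilon>_def)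
  obtain p where p: "polynomial_function p" "\<And>x. x \<in> cball 0 1 \<Longrightarrow> norm (p x - G x) < \<epsilon>"
    using polynomial_approximation[OF G(1) \<epsilon>(1)] by blast
  fix j :: 'k
  obtain v where v: "norm v < \<epsilon>" "no_zeros_over (\<lambda>x. p x + v) (hyperplane (axis j 1))"
    using hyperplane_perturbation[OF dim p(1) \<epsilon>(1)] by blast
  have near: "norm ((p x + v) - g x) \<le> 2 * \<epsilon>" if "x \<in> sphere 0 1" for x
    using norm_triangle_ineq[of "p x - G x" v] p(2)[of x] G(2)[OF that] v(1) that by (simp add: algebra_simps)
  show ?thesis
  proof
    show "axis j 1 \<noteq> (0 :: real^'k)" by (simp add: axis_eq_0_iff)
    show "admissible (\<lambda>x. p x + v)"
      unfolding admissible_iff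
    proof
      show "continuous_on (cball 0 1) (\<lambda>x. p x + v)" by (rule continuous_on_polynomial_add[OF p(1)])
      show "\<forall>x\<in>sphere 0 1. nonvanishing (p x + v) UNIV"
        using near \<epsilon>(3) by (intro ballI \<eta>(2)) (auto intro: order_trans)
    qed
    show "norm ((p x + v) - g x) \<le> e" if "x \<in> sphere 0 1" for x
      using near[OF that] \<epsilon>(2) by linarith
  qed (rule v(2))
qed

text \<open>Injectivity excludes repeated columns, so coefficients indexed by \<open>'k\<close>
  become coefficients on the set of columns.\<close>

lemma frames_nonvanishing: "A \<in> frames \<Longrightarrow> nonvanishing A UNIV" for A :: "(real^'n)^'k"
proof -
  assume A: "A \<in> frames"
  then have inj: "inj (($) A)" and ind: "independent (range (($) A))" by (auto simp: frames_def)
  show ?thesis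
    unfolding nonvanishing_def
  proof (intro ballI impI notI)
    fix \<gamma> assume "\<gamma> \<noteq> 0" and 0: "lincomb A \<gamma> = 0"
    let ?u = "\<lambda>v. \<gamma> $ (the_inv (($) A) v)"
    have "(\<Sum>v\<in>range (($) A). ?u v *\<^sub>R v) = (\<Sum>i\<in>UNIV. ?u (A $ i) *\<^sub>R (A $ i))"
      using sum.reindex[OF inj, of "\<lambda>v. ?u v *\<^sub>R v"] by (simp add: o_def)
    also have "\<dots> = 0" using 0 by (simp add: the_inv_f_f[OF inj] lincomb_def)
    finally have "\<forall>v\<in>range (($) A). ?u v = 0"
      using ind by (auto simp: independent_explicit)
    then have "\<gamma> $ i = 0" for i by (auto simp: the_inv_f_f[OF inj])
    then show False using \<open>\<gamma> \<noteq> 0\<close> by (simp add: vec_eq_iff)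
  qed
qed

lemma smooth_map_on_continuous: "smooth_map_on A f \<Longrightarrow> continuous_on A f"
proof -
  assume f: "smooth_map_on A f"
  show ?thesis
    unfolding continuous_on_eq_continuous_within
  proof
    fix x assume "x \<in> A"
    with f obtain U g where U: "open U" "x \<in> U" "\<forall>r. C_times_on r g U" "\<forall>y\<in>A \<inter> U. g y = f y"
      unfolding smooth_map_on_def by meson
    have "continuous_on (A \<inter> U) g"
      using spec[OF U(3), of 0] by (auto intro: continuous_on_subset)
    then have "continuous_on (A \<inter> U) f"
      by (rule continuous_on_eq) (use U(4) in blast)
    then have "continuous (at x within A \<inter> U) f"
      using U(2) \<open>x \<in> A\<close> by (simp add: continuous_on_eq_continuous_within)
    moreover have "at x within A \<inter> U = at x within A"
      by (rule at_within_nhd[OF U(2,1)]) auto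
    ultimately show "continuous (at x within A) f" by simp
  qed
qed

text \<open>Each zero forbids one hyperplane of poles, and finitely many hyperplanes do not cover
  the space.\<close>

lemma finite_zeros_pole:
  fixes c :: "real^'m \<Rightarrow> (real^'n)^'k"
  assumes "finite (tilde_zeros c)"
  obtains l where "l \<noteq> 0" "no_zeros_over c (hyperplane l)"
proof -
  let ?N = "insert 0 (\<Union>r\<in>tilde_zeros c. {l. fst r \<bullet> l = 0})"
  have "negligible {l. fst r \<bullet> l = 0}" if "r \<in> tilde_zeros c" for r
  proof (rule negligible_hyperplane)
    have "norm (fst r) = 1" using that by (auto simp: tilde_zeros_def)
    then show "fst r \<noteq> 0 \<or> (0::real) \<noteq> 0" by auto
  qed
  then have "negligible (\<Union>r\<in>tilde_zeros c. {l. fst r \<bullet> l = 0})"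
    by (intro negligible_Union finite_imageI assms) blast
  then have "negligible ?N" by (simp only: negligible_insert)
  then obtain l where l: "l \<notin> ?N"
    by (rule small_vector_outside_negligible[OF _ zero_less_one])
  have "no_zeros_over c (hyperplane l)"
    unfolding no_zeros_over_def
  proof (intro ballI impI notI)
    fix \<gamma> x assume \<gamma>: "\<gamma> \<in> hyperplane l" "\<gamma> \<noteq> 0" and x: "x \<in> cball (0::real^'m) 1" and 0: "tilde c (\<gamma>, x) = 0"
    have "(\<gamma> /\<^sub>R norm \<gamma>, x) \<in> tilde_zeros c"
      using \<gamma> x 0 by (simp add: tilde_zeros_def tilde_scaleR)
    then have "(\<gamma> /\<^sub>R norm \<gamma>) \<bullet> l \<noteq> 0" using l by force
    then show False using \<gamma>(1) by (simp add: inner_commute)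
  qed
  then show ?thesis using that l by blast
qed

text \<open>The homotopy is cut into slices whose neighbours are close on the sphere. Each slice is
  extended over the ball approximately, and \<open>gnomonic_parity_near\<close> compares neighbours
  whatever the extensions do inside.\<close>

lemma gnomonic_parity_homotopic:
  fixes a b :: "real^'m \<Rightarrow> (real^'n)^'k" and h :: "real \<times> (real^'m) \<Rightarrow> (real^'n)^'k"
  assumes dim: "CARD('n) + 1 = CARD('k) + CARD('m)" and k: "CARD('k) \<ge> 2"
    and a: "admissible a" "l \<noteq> 0" "no_zeros_over a (hyperplane l)"
    and b: "admissible b" "l' \<noteq> 0" "no_zeros_over b (hyperplane l')"
    and h: "continuous_on ({0..1} \<times> sphere 0 1) h" "\<And>q. q \<in> {0..1} \<times> sphere 0 1 \<Longrightarrow> nonvanishing (h q) UNIV"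
    and ha: "\<And>x. x \<in> sphere 0 1 \<Longrightarrow> h (0, x) = a x" and hb: "\<And>x. x \<in> sphere 0 1 \<Longrightarrow> h (1, x) = b x"
  shows "odd (gnomonic_degree a l) \<longleftrightarrow> odd (gnomonic_degree b l')"
proof -
  let ?S = "{0..1::real} \<times> sphere (0::real^'m) 1"
  have S: "compact ?S" by (intro compact_Times) auto
  obtain \<eta>\<^sub>0 where \<eta>\<^sub>0: "\<eta>\<^sub>0 > 0" "\<And>q A. q \<in> ?S \<Longrightarrow> norm (A - h q) \<le> \<eta>\<^sub>0 \<Longrightarrow> nonvanishing A UNIV"
    using nonvanishing_stable[OF S h(1) subspace_UNIV h(2)] by blast
  \<comment> \<open>\<open>gnomonic_parity_near\<close> measures nearness column by column, which
    costs the factor \<open>CARD('k)\<close>.\<close>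
  define \<eta> where "\<eta> = \<eta>\<^sub>0 / CARD('k)"
  have \<eta>: "\<eta> > 0" using \<eta>\<^sub>0(1) by (simp add: \<eta>_def)
  have nv: "nonvanishing A UNIV" if q: "q \<in> ?S" and A: "\<And>i. norm (A $ i - h q $ i) \<le> \<eta>" for q A
  proof -
    have "norm (A - h q) \<le> CARD('k) * \<eta>" using A by (intro norm_le_columns) simp
    then show ?thesis by (intro \<eta>\<^sub>0(2)[OF q]) (simp add: \<eta>_def)
  qed
  \<comment> \<open>A quarter for the distance of a map to its slice and a quarter for that between
    neighbouring slices make the \<open>\<eta>/2\<close> asked for.\<close>
  have "\<eta>/4 > 0" using \<eta> by simp
  then obtain d where d: "d > 0" "\<And>q q'. q \<in> ?S \<Longrightarrow> q' \<in> ?S \<Longrightarrow> dist q' q < d \<Longrightarrow> dist (h q') (h q) < \<eta>/4"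
    using compact_uniformly_continuous[OF h(1) S] unfolding uniformly_continuous_on_def by meson
  obtain N where N: "N > 0" "inverse (real N) < d"
    using ex_inverse_of_nat_less[OF d(1)] by auto
  have inS: "(real r / N, x) \<in> ?S" if "r \<le> N" "x \<in> sphere 0 1" for r x
    using that N(1) by (simp add: divide_le_eq)
  \<comment> \<open>Stated for every map near the slice: the induction step uses it for a newly
    built extension, the conclusion for \<open>b\<close>.\<close>
  have "odd (gnomonic_degree c l'') \<longleftrightarrow> odd (gnomonic_degree a l)"
    if "r \<le> N" "l'' \<noteq> 0" "admissible c" "no_zeros_over c (hyperplane l'')"
      "\<And>x. x \<in> sphere 0 1 \<Longrightarrow> norm (c x - h (real r / N, x)) \<le> \<eta>/4" for r c l''
    using that
  proof (induction r arbitrary: c l'')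
    case 0
    have "odd (gnomonic_degree a l) \<longleftrightarrow> odd (gnomonic_degree c l'')"
    proof (rule gnomonic_parity_near[OF dim k a 0(3,2,4) \<eta>, where g = "\<lambda>x. h (0, x)"])
      show "nonvanishing A UNIV" if "x \<in> sphere 0 1" "\<And>i. norm (A $ i - h (0, x) $ i) \<le> \<eta>" for x A
        using that by (intro nv[of "(0, x)"]) auto
      show "norm (a x - h (0, x)) \<le> \<eta>/2" if "x \<in> sphere 0 1" for x
        using ha[OF that] \<eta> by simp
      show "norm (c x - h (0, x)) \<le> \<eta>/2" if "x \<in> sphere 0 1" for x
        using 0(5)[OF that] \<eta> by simp
    qed
    then show ?case by simp
  next
    case (Suc r)
    have r: "r \<le> N" using Suc.prems(1) by simp
    have cg: "continuous_on (sphere 0 1) (\<lambda>x. h (real r / N, x))"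
      by (rule continuous_on_compose2[OF h(1)]) (use inS[OF r] in \<open>auto intro!: continuous_intros\<close>)
    obtain c' m where c': "m \<noteq> 0" "admissible c'" "no_zeros_over c' (hyperplane m)"
        "\<And>x. x \<in> sphere 0 1 \<Longrightarrow> norm (c' x - h (real r / N, x)) \<le> \<eta>/4"
    proof (rule admissible_extension[OF dim cg h(2)[OF inS[OF r]] \<open>\<eta>/4 > 0\<close>])
      fix m c' assume *: "m \<noteq> 0" "admissible c'" "no_zeros_over c' (hyperplane m)"
        "\<And>x. x \<in> sphere 0 1 \<Longrightarrow> norm (c' x - h (real r / N, x)) \<le> \<eta>/4"
      show thesis by (rule that[OF *])
    qed
    have "odd (gnomonic_degree c' m) \<longleftrightarrow> odd (gnomonic_degree c l'')"
    proof (rule gnomonic_parity_near[OF dim k c'(2,1,3) Suc.prems(3,2,4) \<eta>, where g = "\<lambda>x. h (real r / N, x)"])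
      show "nonvanishing A UNIV" if "x \<in> sphere 0 1" "\<And>i. norm (A $ i - h (real r / N, x) $ i) \<le> \<eta>" for x A
        using that by (intro nv[OF inS[OF r]]) auto
      show "norm (c' x - h (real r / N, x)) \<le> \<eta>/2" if "x \<in> sphere 0 1" for x
        using c'(4)[OF that] \<eta> by simp
      show "norm (c x - h (real r / N, x)) \<le> \<eta>/2" if x: "x \<in> sphere 0 1" for x
      proof -
        have "real (Suc r) / N - real r / N = inverse (real N)"
          by (simp add: diff_divide_distrib[symmetric] inverse_eq_divide)
        then have "dist (real (Suc r) / N, x) (real r / N, x) < d"
          using N(2) by (simp add: dist_prod_def dist_real_def)
        then have "norm (h (real (Suc r) / N, x) - h (real r / N, x)) < \<eta>/4"
          using d(2)[OF inS[OF r x] inS[OF Suc.prems(1) x]] by (simp add: dist_norm)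
        then show ?thesis
          using norm_triangle_ineq[of "c x - h (real (Suc r) / N, x)" "h (real (Suc r) / N, x) - h (real r / N, x)"]
            Suc.prems(5)[OF x] by simp
      qed
    qed
    then show ?case using Suc.IH[OF r c'(1-3)] c'(4) by blast
  qed
  from this[of N l' b] show ?thesis
    using N(1) b hb \<eta> by simp
qed

theorem theorem2p3:
  fixes n k :: nat
    and \<alpha> \<beta> a b :: "real^'m \<Rightarrow> (real^'n)^'k"
    and P Q :: "((real^'k) \<times> (real^'m)) set"
  assumes "CARD('n) = n" and "CARD('k) = k" and "CARD('m) = n - k + 1"
    and "n - k > 0" and "odd (n - k)" and "k > 1"
    and "smooth_map_on (sphere 0 1) \<alpha>" and "\<alpha> ` sphere 0 1 \<subseteq> frames"
    and "smooth_map_on (sphere 0 1) \<beta>" and "\<beta> ` sphere 0 1 \<subseteq> frames"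
    and "smooth_map_on (cball 0 1) a" and "\<forall>x\<in>sphere 0 1. a x = \<alpha> x"
    and "smooth_map_on (cball 0 1) b" and "\<forall>x\<in>sphere 0 1. b x = \<beta> x"
    and "finite (tilde_zeros a)" and "finite (tilde_zeros b)"
    and "homotopic_with_canon (\<lambda>_. True) (sphere 0 1) frames \<alpha> \<beta>"
    and "half_of_zeros a P" and "half_of_zeros b Q"
  shows "Lambda a P = Lambda b Q"
proof -
  \<comment> \<open>Subtraction on naturals is truncated; \<open>n - k > 0\<close> ensures that
    \<open>CARD('m) = n - k + 1\<close> means \<open>n + 1 = k + CARD('m)\<close>.\<close>
  have dim: "CARD('n) + 1 = CARD('k) + CARD('m)" and k: "CARD('k) \<ge> 2"
    using assms(1-4,6) by simp_all
  have "\<forall>x\<in>sphere 0 1. nonvanishing (a x) UNIV" "\<forall>x\<in>sphere 0 1. nonvanishing (b x) UNIV"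
    using assms(8,10,12,14) frames_nonvanishing by (metis image_subset_iff)+
  then have adm: "admissible a" "admissible b"
    unfolding admissible_iff
    using smooth_map_on_continuous[OF assms(11)] smooth_map_on_continuous[OF assms(13)] by blast+
  obtain l where l: "l \<noteq> 0" "no_zeros_over a (hyperplane l)"
    using finite_zeros_pole[OF assms(15)] by blast
  obtain l' where l': "l' \<noteq> 0" "no_zeros_over b (hyperplane l')"
    using finite_zeros_pole[OF assms(16)] by blast
  obtain h :: "real \<times> (real^'m) \<Rightarrow> (real^'n)^'k" where h: "continuous_on ({0..1} \<times> sphere 0 1) h"
      "h ` ({0..1} \<times> sphere 0 1) \<subseteq> frames" "\<And>x. h (0, x) = \<alpha> x" "\<And>x. h (1, x) = \<beta> x"
    using assms(17) unfolding homotopic_with_def by (auto simp: image_subset_iff)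
  have "odd (gnomonic_degree a l) \<longleftrightarrow> odd (gnomonic_degree b l')"
  proof (rule gnomonic_parity_homotopic[OF dim k adm(1) l adm(2) l' h(1)])
    show "nonvanishing (h q) UNIV" if "q \<in> {0..1} \<times> sphere 0 1" for q
      using h(2) that by (intro frames_nonvanishing) blast
  qed (use h(3,4) assms(12,14) in auto)
  moreover have "odd (gnomonic_degree a l) \<longleftrightarrow> odd (\<Sum>p\<in>P. local_degree (tilde a) p)"
    by (rule gnomonic_degree_parity[OF l(1) dim k adm(1) l(2) assms(15,18)])
  moreover have "odd (gnomonic_degree b l') \<longleftrightarrow> odd (\<Sum>p\<in>Q. local_degree (tilde b) p)"
    by (rule gnomonic_degree_parity[OF l'(1) dim k adm(2) l'(2) assms(16,19)])
  ultimately show ?thesis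
    unfolding Lambda_def by (simp add: mod2_eq_if)
qed

end
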